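(* Let $n\geq 2$ and let $a,b\in\mathbb{C}^{2n}$ be linearly independent vectors such that $$(a,a)=(a,b)=(J_na,b)=0\neq(b,b).$$ Let the complex-valued function $\phi_{a,b}:\mathbf{SO}^*(2n)/\mathbf{U}(n)\to\mathbb{C}$ be defined by $$\phi_{a,b}(z\cdot\mathbf{U}(n))=\operatorname{trace}(ab^tzJ_nz^t).$$ Then the inverse image $\phi_{a,b}^{-1}(\{0\})$ is a complete minimal submanifold of $\mathbf{SO}^*(2n)/\mathbf{U}(n)$ of codimension two.
   Context: Let $J_n=\begin{pmatrix}0&I_n\\-I_n&0\end{pmatrix}$, and let $(u,v)=u^tv$ denote the standard complex bilinear form on $\mathbb{C}^{2n}$ (column vectors; $t$ is transpose without conjugation). $\mathbf{SO}(2n,\mathbb{C})$ is the group of complex $2n\times 2n$ matrices $z$ with $zz^t=I_{2n}$ and $\det z=1$, and $\mathbf{SO}^*(2n)=\{z\in\mathbf{SO}(2n,\mathbb{C}) : \bar zJ_nz^t=J_n\}$. The unitary group $\mathbf{U}(n)=\{z\in\mathbb{C}^{n\times n}: zz^*=I_n\}$ is embedded in $\mathbf{SO}^*(2n)$ as a maximal compact subgroup by $z=x+iy\mapsto\begin{pmatrix}x&y\\-y&x\end{pmatrix}$ with $x,y$ real. Metric: $\mathbf{GL}_{2n}(\mathbb{C})$ carries the left-invariant Riemannian metric induced by the inner product $g(Z,W)=\operatorname{Re}\operatorname{trace}(ZW^* )$ on its Lie algebra $\mathbb{C}^{2n\times 2n}$, where $W^*$ is the conjugate transpose. $\mathbf{SO}^*(2n)$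 carries the induced left-invariant metric, and $\mathbf{SO}^*(2n)/\mathbf{U}(n)$ carries the Riemannian metric for which the natural projection $\mathbf{SO}^*(2n)\to\mathbf{SO}^*(2n)/\mathbf{U}(n)$ is a Riemannian submersion; it is a non-compact Riemannian symmetric space. *)

theory Defs
  imports "HOL-Analysis.Analysis"
begin

section \<open>Smooth maps between Euclidean spaces\<close>

primrec Ck_on :: "nat \<Rightarrow> 'a::euclidean_space set \<Rightarrow> ('a \<Rightarrow> 'b::real_normed_vector) \<Rightarrow> bool" where
  "Ck_on 0 W f \<longleftrightarrow> continuous_on W f"
| "Ck_on (Suc k) W f \<longleftrightarrow>
     f differentiable_on W \<and> (\<forall>v. Ck_on k W (\<lambda>x. frechet_derivative f (at x) v))"

text \<open>On a set that need not be open (a matrix group, an open part of a linear subspace), smooth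
  means: locally the restriction of a smooth map defined on an open set.\<close>

definition smooth_on :: "'a::euclidean_space set \<Rightarrow> ('a \<Rightarrow> 'b::real_normed_vector) \<Rightarrow> bool" where
  "smooth_on A f \<longleftrightarrow>
     (\<forall>p\<in>A. \<exists>W F. open W \<and> p \<in> W \<and> (\<forall>k. Ck_on k W F) \<and> (\<forall>q\<in>A \<inter> W. F q = f q))"

definition curve_through ::
    "'a::euclidean_space set \<Rightarrow> (real \<Rightarrow> 'a) \<Rightarrow> 'a \<Rightarrow> 'a \<Rightarrow> bool" where
  "curve_through S c p v \<longleftrightarrow>
     (\<exists>e>0. smooth_on {-e<..<e} c \<and> c ` {-e<..<e} \<subseteq> S) \<and> c 0 = p \<and>
     (c has_vector_derivative v) (at 0)"

definition tangent_space :: "'a::euclidean_space set \<Rightarrow> 'a \<Rightarrow> 'a set" where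
  "tangent_space S p = {v. \<exists>c. curve_through S c p v}"


section \<open>Riemannian geometry in charts\<close>

text \<open>A manifold is given by its maximal atlas \<open>A\<close>; a chart \<open>(U, x)\<close> maps \<open>U\<close> bijectively onto a
  relatively open subset of a fixed linear subspace \<open>E\<close> of a Euclidean space (so that the
  dimension \<open>dim E\<close> is not tied to a type). A Riemannian metric is given by its local
  representations: \<open>g (U, x) q v w\<close> is the inner product, at the point of \<open>U\<close> with coordinate
  \<open>q \<in> x ` U\<close>, of the tangent vectors with coordinates \<open>v, w \<in> E\<close>.\<close>

type_synonym ('a, 'e) chart = "'a set \<times> ('a \<Rightarrow> 'e)"
type_synonym ('a, 'e) metric = "('a, 'e) chart \<Rightarrow> 'e \<Rightarrow> 'e \<Rightarrow> 'e \<Rightarrow> real"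

definition slice_chart ::
    "'e::euclidean_space set \<Rightarrow> ('a, 'e) chart set \<Rightarrow> 'a set \<Rightarrow> ('a, 'e) chart \<Rightarrow> 'e set \<Rightarrow> bool" where
  "slice_chart E A N X L \<longleftrightarrow>
     X \<in> A \<and> subspace L \<and> L \<subseteq> E \<and> snd X ` (fst X \<inter> N) = snd X ` fst X \<inter> L"

definition submanifold_of_codim ::
    "'e::euclidean_space set \<Rightarrow> ('a, 'e) chart set \<Rightarrow> 'a set \<Rightarrow> nat \<Rightarrow> bool" where
  "submanifold_of_codim E A N k \<longleftrightarrow>
     (\<forall>p\<in>N. \<exists>X L. slice_chart E A N X L \<and> p \<in> fst X \<and> dim L + k = dim E)"

text \<open>The covariant derivative \<open>\<nabla>\<^sub>u v\<close>, at the coordinate \<open>q\<close>, of the vector field with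
  constant coordinates \<open>v\<close>, given by the Koszul formula (constant fields commute).\<close>

definition levi_civita ::
    "'e::euclidean_space set \<Rightarrow> ('a, 'e) metric \<Rightarrow> ('a, 'e) chart \<Rightarrow> 'e \<Rightarrow> 'e \<Rightarrow> 'e \<Rightarrow> 'e" where
  "levi_civita E g X q u v =
     (let D = (\<lambda>a b c. deriv (\<lambda>t. g X (q + t *\<^sub>R a) b c) 0)
      in THE y. y \<in> E \<and> (\<forall>w\<in>E. 2 * g X q y w = D u v w + D v u w - D w u v))"

definition normal_part ::
    "'e::euclidean_space set \<Rightarrow> ('a, 'e) metric \<Rightarrow> ('a, 'e) chart \<Rightarrow> 'e set \<Rightarrow> 'e \<Rightarrow> 'e \<Rightarrow> 'e" where
  "normal_part E g X L q y = (THE n. n \<in> E \<and> y - n \<in> L \<and> (\<forall>l\<in>L. g X q n l = 0))"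

text \<open>In a slice chart, fields with constant coordinates in \<open>L\<close> are tangent to the submanifold and
  extend the tangent vectors \<open>u, v \<in> L\<close>, so the second fundamental form is the normal part of
  their covariant derivative.\<close>

definition second_fundamental_form ::
    "'e::euclidean_space set \<Rightarrow> ('a, 'e) metric \<Rightarrow> ('a, 'e) chart \<Rightarrow> 'e set \<Rightarrow> 'e \<Rightarrow> 'e \<Rightarrow> 'e \<Rightarrow> 'e"
  where
  "second_fundamental_form E g X L q u v = normal_part E g X L q (levi_civita E g X q u v)"

definition orthonormal_basis ::
    "('a, 'e) metric \<Rightarrow> ('a, 'e) chart \<Rightarrow> 'e \<Rightarrow> 'e::euclidean_space set \<Rightarrow> 'e set \<Rightarrow> bool" where
  "orthonormal_basis g X q L B \<longleftrightarrow>
     finite B \<and> span B = L \<and> (\<forall>e\<in>B. \<forall>f\<in>B. g X q e f = (if e = f then 1 else 0))"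

definition mean_curvature ::
    "'e::euclidean_space set \<Rightarrow> ('a, 'e) metric \<Rightarrow> ('a, 'e) chart \<Rightarrow> 'e set \<Rightarrow> 'e \<Rightarrow> 'e set \<Rightarrow> 'e" where
  "mean_curvature E g X L q B =
     (1 / real (card B)) *\<^sub>R (\<Sum>e\<in>B. second_fundamental_form E g X L q e e)"

definition minimal_submanifold ::
    "'e::euclidean_space set \<Rightarrow> ('a, 'e) chart set \<Rightarrow> ('a, 'e) metric \<Rightarrow> 'a set \<Rightarrow> bool" where
  "minimal_submanifold E A g N \<longleftrightarrow>
     (\<forall>X L q B. slice_chart E A N X L \<longrightarrow> q \<in> snd X ` (fst X \<inter> N) \<longrightarrow>
        orthonormal_basis g X q L B \<longrightarrow> mean_curvature E g X L q B = 0)"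

text \<open>Piecewise \<open>C\<^sup>1\<close> curves on the unit interval, with the library's convention that finitely many
  parameters are exempt from differentiability.\<close>

definition piecewise_C1_curve :: "('a, 'e::euclidean_space) chart set \<Rightarrow> (real \<Rightarrow> 'a) \<Rightarrow> bool" where
  "piecewise_C1_curve A c \<longleftrightarrow>
     (\<forall>(U, x)\<in>A. openin (top_of_set {0..1}) ({0..1} \<inter> c -` U) \<and>
                 continuous_on ({0..1} \<inter> c -` U) (x \<circ> c)) \<and>
     (\<exists>T. finite T \<and> (\<forall>(U, x)\<in>A. (x \<circ> c) C1_differentiable_on ({0<..<1} \<inter> c -` U - T)))"

text \<open>The speed does not depend on the chart chosen around \<open>c t\<close>.\<close>

definition speed ::
    "('a, 'e::euclidean_space) chart set \<Rightarrow> ('a, 'e) metric \<Rightarrow> (real \<Rightarrow> 'a) \<Rightarrow> real \<Rightarrow> real" where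
  "speed A g c t =
     (let X = (SOME X. X \<in> A \<and> c t \<in> fst X); v = vector_derivative (snd X \<circ> c) (at t)
      in sqrt (g X (snd X (c t)) v v))"

text \<open>The Riemannian distance of the metric induced on \<open>N\<close>; it is \<open>\<infinity>\<close> between points in different
  components of \<open>N\<close>.\<close>

definition intrinsic_dist ::
    "('a, 'e::euclidean_space) chart set \<Rightarrow> ('a, 'e) metric \<Rightarrow> 'a set \<Rightarrow> 'a \<Rightarrow> 'a \<Rightarrow> ereal" where
  "intrinsic_dist A g N p q =
     Inf {ereal l | l c. piecewise_C1_curve A c \<and> c ` {0..1} \<subseteq> N \<and> c 0 = p \<and> c 1 = q \<and>
                         (speed A g c has_integral l) {0..1}}"

definition complete_submanifold ::
    "('a, 'e::euclidean_space) chart set \<Rightarrow> ('a, 'e) metric \<Rightarrow> 'a set \<Rightarrow> bool" where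
  "complete_submanifold A g N \<longleftrightarrow>
     (\<forall>p. (\<forall>i::nat. p i \<in> N) \<longrightarrow>
          (\<forall>e>0. \<exists>k. \<forall>i\<ge>k. \<forall>j\<ge>k. intrinsic_dist A g N (p i) (p j) < ereal e) \<longrightarrow>
          (\<exists>l\<in>N. (\<lambda>i. intrinsic_dist A g N (p i) l) \<longlonglongrightarrow> 0))"


section \<open>The symmetric space \<open>SO*(2n)/U(n)\<close>\<close>

text \<open>The index type \<open>'n + 'n\<close> gives \<open>2n \<times> 2n\<close> matrices with \<open>n \<times> n\<close> blocks, \<open>n = CARD('n)\<close>.\<close>

type_synonym 'n cvec2 = "complex ^ ('n + 'n)"
type_synonym 'n cmat2 = "complex ^ ('n + 'n) ^ ('n + 'n)"

definition blocks ::
    "complex^'n^'n \<Rightarrow> complex^'n^'n \<Rightarrow> complex^'n^'n \<Rightarrow> complex^'n^'n \<Rightarrow> ('n::finite) cmat2" where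
  "blocks P Q R S =
     (\<chi> i j. case i of
          Inl k \<Rightarrow> (case j of Inl l \<Rightarrow> P $ k $ l | Inr l \<Rightarrow> Q $ k $ l)
        | Inr k \<Rightarrow> (case j of Inl l \<Rightarrow> R $ k $ l | Inr l \<Rightarrow> S $ k $ l))"

definition Jn :: "('n::finite) cmat2" where
  "Jn = blocks 0 (mat 1) (- mat 1) 0"

definition bilin :: "complex^'m \<Rightarrow> complex^'m::finite \<Rightarrow> complex" where
  "bilin u v = (\<Sum>i\<in>UNIV. u $ i * v $ i)"

definition outer :: "complex^'m \<Rightarrow> complex^'m \<Rightarrow> complex^'m^'m::finite" where
  "outer a b = (\<chi> i j. a $ i * b $ j)"

definition cnj_mat :: "complex^'m^'m \<Rightarrow> complex^'m^'m::finite" where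
  "cnj_mat z = (\<chi> i j. cnj (z $ i $ j))"

definition ctranspose :: "complex^'m^'m \<Rightarrow> complex^'m^'m::finite" where
  "ctranspose z = transpose (cnj_mat z)"

definition SO_star :: "('n::finite) cmat2 set" where
  "SO_star = {z. z ** transpose z = mat 1 \<and> det z = 1 \<and> cnj_mat z ** Jn ** transpose z = Jn}"

definition unitary_mats :: "(complex^'n^'n::finite) set" where
  "unitary_mats = {z. z ** ctranspose z = mat 1}"

definition Un_embed :: "complex^'n^'n \<Rightarrow> ('n::finite) cmat2" where
  "Un_embed z =
     (let x = (\<chi> i j. complex_of_real (Re (z $ i $ j)));
          y = (\<chi> i j. complex_of_real (Im (z $ i $ j)))
      in blocks x y (- y) x)"

definition coset :: "('n::finite) cmat2 \<Rightarrow> 'n cmat2 set" where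
  "coset z = (\<lambda>k. z ** Un_embed k) ` unitary_mats"

definition SOU :: "('n::finite) cmat2 set set" where
  "SOU = coset ` SO_star"

definition GL_metric :: "('n::finite) cmat2 \<Rightarrow> 'n cmat2 \<Rightarrow> 'n cmat2 \<Rightarrow> real" where
  "GL_metric z Z W = Re (trace ((matrix_inv z ** Z) ** ctranspose (matrix_inv z ** W)))"

text \<open>The vertical space at \<open>z\<close> is the tangent space of the fibre \<open>coset z\<close> of the projection.\<close>

definition horizontal_space :: "('n::finite) cmat2 \<Rightarrow> 'n cmat2 set" where
  "horizontal_space z =
     {X \<in> tangent_space SO_star z. \<forall>Y\<in>tangent_space (coset z) z. GL_metric z X Y = 0}"

text \<open>The model space of the charts is the tangent space of the quotient at the base point.\<close>

definition SOU_model :: "('n::finite) cmat2 set" where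
  "SOU_model = horizontal_space (mat 1)"

text \<open>The quotient topology and the quotient smooth structure, that is, the unique one for which
  \<open>coset\<close> is a smooth submersion: a chart composed with \<open>coset\<close> is smooth, and its inverse lifts
  locally to a smooth map into the group.\<close>

definition SOU_atlas :: "(('n::finite) cmat2 set, 'n cmat2) chart set" where
  "SOU_atlas = {(U, x). U \<subseteq> SOU \<and> inj_on x U \<and>
     openin (top_of_set SO_star) {z \<in> SO_star. coset z \<in> U} \<and>
     openin (top_of_set SOU_model) (x ` U) \<and>
     smooth_on {z \<in> SO_star. coset z \<in> U} (x \<circ> coset) \<and>
     (\<forall>q\<in>x ` U. \<exists>V s. q \<in> V \<and> V \<subseteq> x ` U \<and> openin (top_of_set SOU_model) V \<and> smooth_on V s \<and>
        (\<forall>r\<in>V. s r \<in> SO_star \<and> coset (s r) \<in> U \<and> x (coset (s r)) = r))}"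

text \<open>The horizontal vector at \<open>z\<close> that the differential of \<open>x \<circ> coset\<close> maps to \<open>v\<close>.\<close>

definition horizontal_lift ::
    "(('n::finite) cmat2 set \<Rightarrow> 'n cmat2) \<Rightarrow> 'n cmat2 \<Rightarrow> 'n cmat2 \<Rightarrow> 'n cmat2" where
  "horizontal_lift x z v =
     (THE X. X \<in> horizontal_space z \<and>
        (\<exists>c. curve_through SO_star c z X \<and> ((x \<circ> coset \<circ> c) has_vector_derivative v) (at 0)))"

text \<open>The metric for which \<open>coset\<close> is a Riemannian submersion. Its value does not depend on the
  representative \<open>z\<close>, since right translations by elements of the embedded unitary group (which
  are real orthogonal matrices) preserve the left-invariant metric and the fibres.\<close>

definition SOU_metric :: "(('n::finite) cmat2 set, 'n cmat2) metric" where
  "SOU_metric = (\<lambda>(U, x) q v w.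
     let z = (SOME z. z \<in> SO_star \<and> coset z \<in> U \<and> x (coset z) = q)
     in GL_metric z (horizontal_lift x z v) (horizontal_lift x z w))"

definition phi :: "('n::finite) cvec2 \<Rightarrow> 'n cvec2 \<Rightarrow> 'n cmat2 set \<Rightarrow> complex" where
  "phi a b p = (let z = (SOME z. z \<in> SO_star \<and> p = coset z)
                in trace (outer a b ** z ** Jn ** transpose z))"

lemma phi_coset:
  fixes a b :: "('n::finite) cvec2"
  assumes "z \<in> SO_star"
  shows "phi a b (coset z) = trace (outer a b ** z ** Jn ** transpose z)"
proof -
  have sum_UNIV: "(\<Sum>i\<in>UNIV. f i) = (\<Sum>k\<in>UNIV. f (Inl k)) + (\<Sum>k\<in>UNIV. f (Inr k))"
    for f :: "'n + 'n \<Rightarrow> complex"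
    using sum.Plus[of "UNIV :: 'n set" "UNIV :: 'n set" f] by simp
  have mult: "blocks P Q R S ** blocks P' Q' R' S' =
      blocks (P ** P' + Q ** R') (P ** Q' + Q ** S') (R ** P' + S ** R') (R ** Q' + S ** S')"
    for P Q R S P' Q' R' S' :: "complex^'n^'n"
    by (simp add: vec_eq_iff blocks_def matrix_matrix_mult_def sum_UNIV split: sum.split)
  have transp: "transpose (blocks P Q R S) =
      blocks (transpose P) (transpose R) (transpose Q) (transpose S)"
    for P Q R S :: "complex^'n^'n"
    by (simp add: vec_eq_iff blocks_def transpose_def split: sum.split)
  have stab: "Un_embed k ** Jn ** transpose (Un_embed k) = (Jn :: 'n cmat2)"
    if "k \<in> unitary_mats" for k :: "complex^'n^'n"
  proof -
    define x :: "complex^'n^'n" where "x = (\<chi> i j. complex_of_real (Re (k $ i $ j)))"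
    define y :: "complex^'n^'n" where "y = (\<chi> i j. complex_of_real (Im (k $ i $ j)))"
    have k: "(\<Sum>l\<in>UNIV. k $ i $ l * cnj (k $ j $ l)) = (if i = j then 1 else 0)" for i j
      using that unfolding unitary_mats_def
      by (auto simp: vec_eq_iff matrix_matrix_mult_def ctranspose_def cnj_mat_def transpose_def
          mat_def)
    have re: "(\<Sum>l\<in>UNIV. Re (k $ i $ l) * Re (k $ j $ l) + Im (k $ i $ l) * Im (k $ j $ l))
        = (if i = j then 1 else 0)" for i j
      using arg_cong[OF k[of i j], of Re] by (auto split: if_splits)
    have im: "(\<Sum>l\<in>UNIV. Im (k $ i $ l) * Re (k $ j $ l) - Re (k $ i $ l) * Im (k $ j $ l)) = 0"
      for i j
      using arg_cong[OF k[of i j], of Im] by (auto split: if_splits)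
    have 1: "x ** transpose x + y ** transpose y = mat 1"
      using arg_cong[OF re, of complex_of_real]
      by (auto simp: vec_eq_iff matrix_matrix_mult_def x_def y_def transpose_def mat_def
          sum.distrib)
    have 2: "y ** transpose x = x ** transpose y"
      using arg_cong[OF im, of complex_of_real]
      by (auto simp: vec_eq_iff matrix_matrix_mult_def x_def y_def transpose_def mat_def
          sum_subtractf)
    have neg: "(- P) ** Q = - (P ** Q)" "P ** (- Q) = - (P ** Q)" for P Q :: "complex^'n^'n"
      by (simp_all add: vec_eq_iff matrix_matrix_mult_def sum_negf)
    have tneg: "transpose (- P) = - transpose P" for P :: "complex^'n^'n"
      by (simp add: vec_eq_iff transpose_def)
    have emb: "Un_embed k = blocks x y (- y) x"
      by (simp add: Un_embed_def x_def y_def Let_def)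
    have 3: "- (x ** transpose x) - y ** transpose y = - mat 1"
      using 1 by (metis minus_add_distrib diff_conv_add_uminus)
    show ?thesis
      using 1 2 3
      by (simp add: emb Jn_def mult transp neg tneg add.commute)
  qed
  define w where "w = (SOME w. w \<in> SO_star \<and> coset z = coset w)"
  have "w \<in> SO_star \<and> coset z = coset w"
    unfolding w_def by (rule someI[of _ z]) (use assms in simp)
  moreover have "w \<in> coset w"
  proof -
    have "mat 1 \<in> (unitary_mats :: (complex^'n^'n) set)"
    proof -
      have "ctranspose (mat 1) = (mat 1 :: complex^'n^'n)"
        by (auto simp: vec_eq_iff ctranspose_def cnj_mat_def transpose_def mat_def)
      then show ?thesis by (simp add: unitary_mats_def)
    qed
    moreover have "Un_embed (mat 1) = (mat 1 :: 'n cmat2)"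
      by (auto simp: vec_eq_iff Un_embed_def Let_def blocks_def mat_def split: sum.split)
    ultimately show ?thesis
      unfolding coset_def by (metis image_eqI matrix_mul_rid)
  qed
  ultimately obtain k where k: "k \<in> unitary_mats" "w = z ** Un_embed k"
    unfolding coset_def by (metis (no_types, lifting) imageE)
  have "w ** Jn ** transpose w = z ** (Un_embed k ** Jn ** transpose (Un_embed k)) ** transpose z"
    by (simp add: k(2) matrix_transpose_mul matrix_mul_assoc)
  then have "w ** Jn ** transpose w = z ** Jn ** transpose z"
    using stab[OF k(1)] by simp
  then have "outer a b ** w ** Jn ** transpose w = outer a b ** z ** Jn ** transpose z"
    by (metis matrix_mul_assoc)
  then show ?thesis
    by (simp add: phi_def w_def[symmetric])
qed

end

theory Submission
  imports Defs
begin

text \<open>The space is identified with the orbit of the complex structures \<open>\<Phi> = z ** Jn ** transpose z\<close>,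
  on which \<open>\<Phi> ** \<Phi> = - mat 1\<close>, the metric is a quarter of the ambient trace form and \<open>phi\<close> is the
  linear function \<open>bilin b (\<Phi> *v a)\<close>. With \<open>\<alpha> = transpose z *v a\<close> and \<open>\<beta> = transpose z *v b\<close>, its
  differential is \<open>\<lambda>Y. bilin \<beta> (Y *v \<alpha>)\<close>; isotropy of \<open>\<alpha>\<close> makes the gradients of its real and imaginary
  parts orthogonal of equal nonzero length on the zero set, so the zero set has codimension two and its
  mean curvature is the restricted trace of \<open>\<lambda>Y. bilin \<beta> (Y ** Y *v (Jn *v \<alpha>))\<close>. The full trace is a
  multiple of \<open>bilin \<beta> (Jn *v \<alpha>)\<close>, which vanishes there, and the two normal directions contribute
  nothing. For completeness, the logarithms of the Hermitian forms \<open>z ** ctranspose z\<close> are Lipschitz for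
  the intrinsic distance, so representatives of a Cauchy sequence stay bounded and subconverge in the
  closed group; the limit coset is unique because these forms determine it.\<close>


section \<open>Calculus of \<open>C\<^sup>k\<close> maps\<close>

text \<open>The statement ranges over every slice chart, while metric and speed rest on Hilbert
  choices, so nothing may depend on one convenient chart. A smooth local section turns \<Phi> into a
  function \<open>F\<close> of the coordinates with derivative \<open>D\<close>, and all metric
  notions are expressed by \<open>D\<close>. The quarter arises because a horizontal velocity
  \<open>z ** Y\<close> moves \<Phi> by the conjugate under \<open>z\<close> of
  \<open>- 2 Jn Y\<close>. Minimality needs no explicit normal fields. On a straight line in a slice
  the second derivative of \<open>phi\<close> vanishes, so the differential of \<open>phi\<close>
  sees in the second fundamental form only the quadratic term that was subtracted from the second
  derivative of \<Phi> to make it tangent. The sum over a basis is normal; once the differential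
  kills it, it is also tangent, hence zero. This requires the subspace of an arbitrary slice chart
  to be the whole kernel, although its dimension is not given. For completeness the obstacle is that
  distance is measured inside the zero set: a limit of matrices must be joined to the sequence by
  short curves in the zero set, and segments in a slice chart supply them.\<close>

lemma Ck_on_cong:
  assumes "open W" "\<And>x. x \<in> W \<Longrightarrow> f x = g x"
  shows "Ck_on k W f \<longleftrightarrow> Ck_on k W g"
proof -
  have "Ck_on k W g" if "Ck_on k W f" "\<And>x. x \<in> W \<Longrightarrow> f x = g x" for f g :: "'a \<Rightarrow> 'b"
    using that
  proof (induction k arbitrary: f g)
    case 0
    then show ?case by (metis Ck_on.simps(1) continuous_on_cong)
  next
    case (Suc k)
    have d: "(g has_derivative f') (at x)" if "(f has_derivative f') (at x)" "x \<in> W" for x f'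
      using has_derivative_transform_within_open[OF that(1) assms(1) that(2) Suc.prems(2)] by auto
    have fd: "(f has_derivative frechet_derivative f (at x)) (at x)" if "x \<in> W" for x
      using Suc.prems(1) that assms(1)
      by (metis Ck_on.simps(2) differentiable_on_eq_differentiable_at frechet_derivative_works)
    have eq: "frechet_derivative f (at x) = frechet_derivative g (at x)" if "x \<in> W" for x
      using frechet_derivative_at[OF d[OF fd[OF that] that]] .
    have "g differentiable_on W"
      using d fd by (meson differentiable_at_imp_differentiable_on differentiable_def)
    moreover have "Ck_on k W (\<lambda>x. frechet_derivative g (at x) v)" for v
      by (rule Suc.IH[of "\<lambda>x. frechet_derivative f (at x) v"]) (use Suc.prems eq in auto)
    ultimately show ?case by simp
  qed
  from this[of f g] this[of g f] show ?thesis using assms by auto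
qed

lemma Ck_on_has_derivative:
  assumes "open W" "Ck_on (Suc k) W f" "x \<in> W"
  shows "(f has_derivative frechet_derivative f (at x)) (at x)"
  using assms by (metis Ck_on.simps(2) differentiable_on_eq_differentiable_at frechet_derivative_works)

text \<open>\<open>frechet_derivative\<close> is a choice term; uniqueness of derivatives on an open
  set lets any explicit derivative stand in for it. The inductive closure rules below run on
  this.\<close>

lemma Ck_on_SucI:
  assumes "open W" "\<And>x. x \<in> W \<Longrightarrow> (f has_derivative f' x) (at x)" "\<And>v. Ck_on k W (\<lambda>x. f' x v)"
  shows "Ck_on (Suc k) W f"
proof -
  have "frechet_derivative f (at x) v = f' x v" if "x \<in> W" for x v
    using assms(2)[OF that] frechet_derivative_at by metis
  then have "Ck_on k W (\<lambda>x. frechet_derivative f (at x) v)" for v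
    using Ck_on_cong[OF assms(1), of "\<lambda>x. frechet_derivative f (at x) v" "\<lambda>x. f' x v"] assms(3) by auto
  moreover have "f differentiable_on W"
    using assms(2) by (meson differentiable_at_imp_differentiable_on differentiable_def)
  ultimately show ?thesis by simp
qed

lemma Ck_on_imp_continuous_on: "Ck_on k W f \<Longrightarrow> continuous_on W f"
  by (cases k) (auto intro: differentiable_imp_continuous_on)

lemma Ck_on_Suc_imp: "Ck_on (Suc k) W f \<Longrightarrow> Ck_on k W f"
proof (induction k arbitrary: f)
  case 0
  then show ?case using Ck_on_imp_continuous_on by fastforce
next
  case (Suc k)
  then show ?case by (metis Ck_on.simps(2))
qed

lemma Ck_on_subset: "Ck_on k W f \<Longrightarrow> V \<subseteq> W \<Longrightarrow> Ck_on k V f"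
  by (induction k arbitrary: f)
    (auto intro: continuous_on_subset differentiable_on_subset)

lemma Ck_on_const: "Ck_on k W (\<lambda>x. c)"
  by (induction k arbitrary: c) auto

lemma Ck_on_add:
  assumes "open W" "Ck_on k W f" "Ck_on k W g"
  shows "Ck_on k W (\<lambda>x. f x + g x)"
  using assms(2,3)
proof (induction k arbitrary: f g)
  case 0
  then show ?case by (simp add: continuous_on_add)
next
  case (Suc k)
  show ?case
    by (rule Ck_on_SucI[OF assms(1) has_derivative_add[OF
          Ck_on_has_derivative[OF assms(1) Suc.prems(1)] Ck_on_has_derivative[OF assms(1) Suc.prems(2)]]])
      (use Suc in auto)
qed

lemma Ck_on_linear:
  assumes "open W" "bounded_linear L" "Ck_on k W f"
  shows "Ck_on k W (\<lambda>x. L (f x))"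
  using assms(3)
proof (induction k arbitrary: f)
  case 0
  then show ?case using assms(2) by (auto intro: bounded_linear.continuous_on)
next
  case (Suc k)
  show ?case
    by (rule Ck_on_SucI[OF assms(1) bounded_linear.has_derivative[OF assms(2)
          Ck_on_has_derivative[OF assms(1) Suc.prems]]])
      (use Suc in auto)
qed

lemma Ck_on_bounded_linear:
  assumes "open W" "bounded_linear L"
  shows "Ck_on k W L"
proof (cases k)
  case 0
  then show ?thesis using assms linear_continuous_on by auto
next
  case (Suc j)
  show ?thesis unfolding Suc
    by (rule Ck_on_SucI[OF assms(1), of L "\<lambda>x. L"])
      (use assms bounded_linear_imp_has_derivative Ck_on_const in auto)
qed

lemma Ck_on_ident: "open W \<Longrightarrow> Ck_on k W (\<lambda>x. x)"
  using Ck_on_bounded_linear[OF _ bounded_linear_ident] .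

lemma Ck_on_uminus: "open W \<Longrightarrow> Ck_on k W f \<Longrightarrow> Ck_on k W (\<lambda>x. - f x)"
  using Ck_on_linear[OF _ bounded_linear_minus[OF bounded_linear_ident]] .

lemma Ck_on_diff: "open W \<Longrightarrow> Ck_on k W f \<Longrightarrow> Ck_on k W g \<Longrightarrow> Ck_on k W (\<lambda>x. f x - g x)"
  using Ck_on_add[of W k f "\<lambda>x. - g x"] Ck_on_uminus[of W k g] by simp

lemma Ck_on_bilinear:
  assumes "open W" "bounded_bilinear p" "Ck_on k W f" "Ck_on k W g"
  shows "Ck_on k W (\<lambda>x. p (f x) (g x))"
  using assms(3,4)
proof (induction k arbitrary: f g)
  case 0
  then show ?case using assms(2) by (simp add: bounded_bilinear.continuous_on)
next
  case (Suc k)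
  have s: "Ck_on k W f" "Ck_on k W g"
    using Ck_on_Suc_imp[OF Suc.prems(1)] Ck_on_Suc_imp[OF Suc.prems(2)] .
  show ?case
    by (rule Ck_on_SucI[OF assms(1) bounded_bilinear.FDERIV[OF assms(2)
          Ck_on_has_derivative[OF assms(1) Suc.prems(1)] Ck_on_has_derivative[OF assms(1) Suc.prems(2)]]])
      (use Suc.prems s in \<open>auto intro!: Ck_on_add[OF assms(1)] Suc.IH\<close>)
qed

lemma Ck_on_sum:
  assumes "open W" "\<And>i. i \<in> I \<Longrightarrow> Ck_on k W (f i)"
  shows "Ck_on k W (\<lambda>x. \<Sum>i\<in>I. f i x)"
  using assms(2)
  by (induction I rule: infinite_finite_induct) (auto intro: Ck_on_const Ck_on_add[OF assms(1)])

lemma linear_Basis_expansion: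
  fixes L :: "'a::euclidean_space \<Rightarrow> 'b::real_vector"
  assumes "linear L"
  shows "L v = (\<Sum>b\<in>Basis. (v \<bullet> b) *\<^sub>R L b)"
proof -
  have "L v = L (\<Sum>b\<in>Basis. (v \<bullet> b) *\<^sub>R b)" by (simp add: euclidean_representation)
  also have "\<dots> = (\<Sum>b\<in>Basis. (v \<bullet> b) *\<^sub>R L b)"
    using assms by (simp add: linear_sum linear_cmul)
  finally show ?thesis .
qed

text \<open>The induction hypothesis covers \<open>\<lambda>x. ?g' (f x) b\<close> for a fixed
  direction \<open>b\<close>, whereas the chain rule feeds in the moving direction
  \<open>?f' x v\<close>. Expanding that direction in \<open>Basis\<close> separates the two
  dependences.\<close>

lemma Ck_on_compose:
  fixes f :: "'a::euclidean_space \<Rightarrow> 'b::euclidean_space" and g :: "'b \<Rightarrow> 'c::real_normed_vector"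
  assumes "open W" "open V" "Ck_on k W f" "Ck_on k V g" "f ` W \<subseteq> V"
  shows "Ck_on k W (\<lambda>x. g (f x))"
  using assms(3,4,5)
proof (induction k arbitrary: g)
  case 0
  then show ?case by (auto intro: continuous_on_compose2)
next
  case (Suc k)
  let ?f' = "\<lambda>x. frechet_derivative f (at x)"
  let ?g' = "\<lambda>y. frechet_derivative g (at y)"
  have f: "Ck_on k W f" using Ck_on_Suc_imp[OF Suc.prems(1)] .
  have df: "(f has_derivative ?f' x) (at x)" if "x \<in> W" for x
    using Ck_on_has_derivative[OF assms(1) Suc.prems(1) that] .
  have dg: "(g has_derivative ?g' (f x)) (at (f x))" if "x \<in> W" for x
    using Ck_on_has_derivative[OF assms(2) Suc.prems(2)] Suc.prems(3) that by blast
  have rep: "?g' (f x) (?f' x v) = (\<Sum>b\<in>Basis. (?f' x v \<bullet> b) *\<^sub>R ?g' (f x) b)" if "x \<in> W" for x v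
    by (rule linear_Basis_expansion[OF has_derivative_linear[OF dg[OF that]]])
  show ?case
  proof (rule Ck_on_SucI[OF assms(1)])
    show "((\<lambda>x. g (f x)) has_derivative (\<lambda>v. ?g' (f x) (?f' x v))) (at x)" if "x \<in> W" for x
      using has_derivative_compose[OF df[OF that] dg[OF that]] .
    fix v
    have "Ck_on k W (\<lambda>x. \<Sum>b\<in>Basis. (?f' x v \<bullet> b) *\<^sub>R ?g' (f x) b)"
    proof (intro Ck_on_sum[OF assms(1)] Ck_on_bilinear[OF assms(1) bounded_bilinear_scaleR])
      show "Ck_on k W (\<lambda>x. ?f' x v \<bullet> b)" for b
        using Ck_on_linear[OF assms(1) bounded_linear_inner_left] Suc.prems(1) by auto
      show "Ck_on k W (\<lambda>x. ?g' (f x) b)" for b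
        using Suc.IH[OF f, of "\<lambda>y. ?g' y b"] Suc.prems(2,3) by auto
    qed
    then show "Ck_on k W (\<lambda>x. ?g' (f x) (?f' x v))"
      by (subst Ck_on_cong[OF assms(1)]) (use rep in auto)
  qed
qed

text \<open>A product rule asking only continuity of \<open>h\<close>: as \<open>c\<close> vanishes
  at \<open>x\<close>, the variation of \<open>h\<close> is multiplied by something of first order.
  It yields the derivative of an inverse whose differentiability is not yet known.\<close>

lemma has_derivative_scaleR_vanishing:
  fixes c :: "'a::real_normed_vector \<Rightarrow> real" and h :: "'a \<Rightarrow> 'b::real_normed_vector"
  assumes c: "(c has_derivative c') (at x)" and c0: "c x = 0" and h: "isCont h x"
  shows "((\<lambda>y. c y *\<^sub>R h y) has_derivative (\<lambda>v. c' v *\<^sub>R h x)) (at x)"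
proof -
  have l: "((\<lambda>y. c y *\<^sub>R h x) has_derivative (\<lambda>v. c' v *\<^sub>R h x)) (at x)"
    using has_derivative_scaleR_left[OF c] .
  obtain B where B: "B > 0" "\<And>v. norm (c' v) \<le> norm v * B"
    using has_derivative_bounded_linear[OF c] bounded_linear.pos_bounded by blast
  have "((\<lambda>y. c y *\<^sub>R (h y - h x)) has_derivative (\<lambda>v. 0)) (at x)"
    unfolding has_derivative_at_alt
  proof safe
    show "bounded_linear (\<lambda>v. 0 :: 'b)" by simp
    fix e :: real assume e: "e > 0"
    obtain d1 where d1: "d1 > 0" "\<And>y. norm (y - x) < d1 \<Longrightarrow> norm (c y - c x - c' (y - x)) \<le> 1 * norm (y - x)"
      using c unfolding has_derivative_at_alt by (metis zero_less_one)
    obtain d2 where d2: "d2 > 0" "\<And>y. norm (y - x) < d2 \<Longrightarrow> norm (h y - h x) < e / (1 + B)"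
      using h e B(1) unfolding continuous_at_eps_delta by (metis add_pos_pos dist_norm divide_pos_pos zero_less_one)
    have "norm (c y *\<^sub>R (h y - h x)) \<le> e * norm (y - x)" if "norm (y - x) < min d1 d2" for y
    proof -
      have "norm (c y) \<le> norm (c y - c' (y - x)) + norm (c' (y - x))"
        by (metis diff_add_cancel norm_triangle_ineq)
      also have "\<dots> \<le> (1 + B) * norm (y - x)"
        using d1(2)[of y] B(2)[of "y - x"] c0 that by (simp add: algebra_simps)
      finally have 1: "norm (c y) \<le> (1 + B) * norm (y - x)" .
      have "norm (c y *\<^sub>R (h y - h x)) \<le> ((1 + B) * norm (y - x)) * (e / (1 + B))"
        using mult_mono[OF 1 less_imp_le[OF d2(2)[of y]]] that B(1) by simp
      also have "\<dots> = e * norm (y - x)" using B(1) by (simp add: field_simps)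
      finally show ?thesis .
    qed
    then show "\<exists>d>0. \<forall>y. norm (y - x) < d \<longrightarrow>
        norm (c y *\<^sub>R (h y - h x) - c x *\<^sub>R (h x - h x) - 0) \<le> e * norm (y - x)"
      using d1(1) d2(1) by (intro exI[of _ "min d1 d2"]) auto
  qed
  from has_derivative_add[OF this l] show ?thesis by (simp add: algebra_simps)
qed

text \<open>The solution of a linear system depends on the parameter as smoothly as the coefficients do:
  the derivative of \<open>D(x)\<^sup>-\<^sup>1 v\<close> is polynomial in \<open>D(x)\<^sup>-\<^sup>1\<close> and the derivative of \<open>D\<close>.\<close>

lemma Ck_on_linear_solution:
  fixes D h :: "'a::euclidean_space \<Rightarrow> 'b::euclidean_space \<Rightarrow> 'b"
  assumes W: "open W" and lin: "\<And>x. x \<in> W \<Longrightarrow> linear (D x)" "\<And>x. x \<in> W \<Longrightarrow> linear (h x)"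
    and Dh: "\<And>x v. x \<in> W \<Longrightarrow> D x (h x v) = v" and hD: "\<And>x v. x \<in> W \<Longrightarrow> h x (D x v) = v"
    and D: "\<And>v. Ck_on k W (\<lambda>x. D x v)"
  shows "Ck_on k W (\<lambda>x. h x v)"
proof -
  note expand = linear_Basis_expansion
  \<comment> \<open>The resolvent identity. Both the continuity and the derivative of
    \<open>h\<close> come from it.\<close>
  have diff: "h y v - h x v = - h y (D y (h x v) - v)" if "x \<in> W" "y \<in> W" for x y v
    using linear_diff[OF lin(2)[OF that(2)], of "D y (h x v)" v] hD[OF that(2), of "h x v"] by simp
  have cont: "continuous_on W (\<lambda>x. h x v)" if Dc: "\<And>v. continuous_on W (\<lambda>x. D x v)" for v
  proof (rule continuous_at_imp_continuous_on, rule ballI)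
    fix x assume x: "x \<in> W"
    obtain B where B: "B > 0" "\<And>u. norm (h x u) \<le> B * norm u"
      using linear_bounded_pos[OF lin(2)[OF x]] by blast
    define N where "N = (\<lambda>y. \<Sum>b\<in>Basis. norm (D y b - D x b))"
    have N0: "N x = 0" "\<And>y. N y \<ge> 0" by (auto simp: N_def sum_nonneg)
    have Dx: "isCont (\<lambda>y. D y v) x" for v
      using Dc[of v] x W continuous_on_eq_continuous_at by blast
    have Nc: "isCont N x" unfolding N_def by (intro continuous_intros Dx)
    have Nb: "norm (D y u - D x u) \<le> N y * norm u" if y: "y \<in> W" for y u
    proof -
      have "D y u - D x u = (\<Sum>b\<in>Basis. (u \<bullet> b) *\<^sub>R (D y b - D x b))"
        using expand[OF lin(1)[OF y], of u] expand[OF lin(1)[OF x], of u]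
        by (simp add: sum_subtractf scaleR_diff_right)
      also have "norm \<dots> \<le> (\<Sum>b\<in>Basis. norm u * norm (D y b - D x b))"
        by (rule sum_norm_le) (simp add: Basis_le_norm mult_right_mono)
      finally show ?thesis unfolding N_def by (simp add: sum_distrib_left mult.commute)
    qed
    have "eventually (\<lambda>y. N y < 1 / (2 * B)) (at x)"
      using Nc B(1) N0 unfolding isCont_def by (intro order_tendstoD) auto
    moreover have "eventually (\<lambda>y. y \<in> W) (at x)" using W x by (metis eventually_at_topological)
    ultimately have ev: "eventually (\<lambda>y. norm (h y v - h x v) \<le> 2 * B * norm (D y (h x v) - v)) (at x)"
    proof eventually_elim
      case (elim y)
      \<comment> \<open>A bound uniform in \<open>y\<close> near \<open>x\<close>: with
        \<open>N y < 1 / (2 * B)\<close>, half of \<open>norm (h y u)\<close> is absorbed into the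
        left-hand side.\<close>
      have hb: "norm (h y u) \<le> 2 * B * norm u" for u
      proof -
        have "norm (h y u) = norm (h x (D x (h y u)))" using hD x by simp
        also have "\<dots> \<le> B * norm (D x (h y u))" using B(2) .
        also have "norm (D x (h y u)) \<le> norm u + N y * norm (h y u)"
          using Nb[OF elim(2), of "h y u"] Dh[OF elim(2), of u]
          by (smt (verit) norm_triangle_ineq2 norm_minus_commute)
        also have "N y * norm (h y u) \<le> (1 / (2 * B)) * norm (h y u)"
          using elim(1) by (intro mult_right_mono) auto
        finally have "norm (h y u) \<le> B * (norm u + 1 / (2 * B) * norm (h y u))" using B(1) by simp
        also have "\<dots> = B * norm u + norm (h y u) / 2" using B(1) by (simp add: field_simps)
        finally show ?thesis by simp
      qed
      show ?case using diff[OF x elim(2), of v] hb[of "D y (h x v) - v"] by simp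
    qed
    have "((\<lambda>y. 2 * B * norm (D y (h x v) - v)) \<longlongrightarrow> 2 * B * norm (D x (h x v) - v)) (at x)"
      using Dx[of "h x v"] unfolding isCont_def by (intro tendsto_intros)
    then have "((\<lambda>y. 2 * B * norm (D y (h x v) - v)) \<longlongrightarrow> 0) (at x)" using Dh x by simp
    from Lim_null_comparison[OF ev this] show "isCont (\<lambda>y. h y v) x"
      unfolding isCont_def by (simp add: LIM_zero_iff)
  qed
  show ?thesis using D
  proof (induction k arbitrary: v)
    case 0
    then show ?case using cont by simp
  next
    case (Suc k)
    let ?D' = "\<lambda>x u. frechet_derivative (\<lambda>y. D y u) (at x)"
    have h: "Ck_on k W (\<lambda>x. h x v)" for v using Suc Ck_on_Suc_imp by blast
    have dD: "((\<lambda>y. D y u) has_derivative ?D' x u) (at x)" if "x \<in> W" for x u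
      using Ck_on_has_derivative[OF W Suc.prems that] .
    have "((\<lambda>y. h y v) has_derivative (\<lambda>w. - (\<Sum>b\<in>Basis. (?D' x (h x v) w \<bullet> b) *\<^sub>R h x b))) (at x)"
      if x: "x \<in> W" for x
    proof -
      have hc: "isCont (\<lambda>y. h y b) x" for b
        using Ck_on_imp_continuous_on[OF h] W x continuous_on_eq_continuous_at by blast
      \<comment> \<open>Every coefficient \<open>(D y (h x v) - v) \<bullet> b\<close> is 0 at
        \<open>y = x\<close>, so continuity of \<open>h\<close> suffices to differentiate the
        products.\<close>
      have "((\<lambda>y. - (\<Sum>b\<in>Basis. ((D y (h x v) - v) \<bullet> b) *\<^sub>R h y b)) has_derivative
          (\<lambda>w. - (\<Sum>b\<in>Basis. (?D' x (h x v) w \<bullet> b) *\<^sub>R h x b))) (at x)"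
      proof (intro has_derivative_minus has_derivative_sum has_derivative_scaleR_vanishing hc)
        show "(D x (h x v) - v) \<bullet> b = 0" for b using Dh x by simp
        show "((\<lambda>y. (D y (h x v) - v) \<bullet> b) has_derivative (\<lambda>w. ?D' x (h x v) w \<bullet> b)) (at x)" for b
          using has_derivative_inner_left[OF has_derivative_diff[OF dD[OF x] has_derivative_const]]
          by simp
      qed
      from has_derivative_add[OF has_derivative_const[of "h x v"] this]
      have "((\<lambda>y. h x v - (\<Sum>b\<in>Basis. ((D y (h x v) - v) \<bullet> b) *\<^sub>R h y b)) has_derivative
          (\<lambda>w. - (\<Sum>b\<in>Basis. (?D' x (h x v) w \<bullet> b) *\<^sub>R h x b))) (at x)" by simp
      moreover have "h x v - (\<Sum>b\<in>Basis. ((D y (h x v) - v) \<bullet> b) *\<^sub>R h y b) = h y v" if "y \<in> W" for y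
        using diff[OF x that, of v] expand[OF lin(2)[OF that], of "D y (h x v) - v"]
        by (simp add: algebra_simps)
      ultimately show ?thesis by (rule has_derivative_transform_within_open[OF _ W x])
    qed
    then show ?case
    proof (rule Ck_on_SucI[OF W])
      fix w
      \<comment> \<open>The direction \<open>h x v\<close> moves with \<open>x\<close>; linearity
        reduces it to fixed basis directions, where the smoothness of \<open>D\<close>
        applies.\<close>
      have D'u: "?D' x (h x v) w = (\<Sum>c\<in>Basis. (h x v \<bullet> c) *\<^sub>R ?D' x c w)" if "x \<in> W" for x
      proof -
        have "((\<lambda>y. \<Sum>c\<in>Basis. (h x v \<bullet> c) *\<^sub>R D y c) has_derivative
            (\<lambda>w. \<Sum>c\<in>Basis. (h x v \<bullet> c) *\<^sub>R ?D' x c w)) (at x)"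
          by (intro has_derivative_sum has_derivative_scaleR_right dD that)
        then have "((\<lambda>y. D y (h x v)) has_derivative (\<lambda>w. \<Sum>c\<in>Basis. (h x v \<bullet> c) *\<^sub>R ?D' x c w)) (at x)"
          by (rule has_derivative_transform_within_open[OF _ W that]) (rule expand[OF lin(1), symmetric])
        from frechet_derivative_at[OF this] show ?thesis by (metis (mono_tags))
      qed
      have "Ck_on k W (\<lambda>x. - (\<Sum>b\<in>Basis. ((\<Sum>c\<in>Basis. (h x v \<bullet> c) *\<^sub>R ?D' x c w) \<bullet> b) *\<^sub>R h x b))"
      proof (intro Ck_on_uminus[OF W] Ck_on_sum[OF W] Ck_on_bilinear[OF W bounded_bilinear_scaleR]
          Ck_on_linear[OF W bounded_linear_inner_left] h)
        show "Ck_on k W (\<lambda>x. ?D' x c w)" for c using Suc.prems[of c] by simp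
      qed
      then show "Ck_on k W (\<lambda>x. - (\<Sum>b\<in>Basis. (?D' x (h x v) w \<bullet> b) *\<^sub>R h x b))"
        by (subst Ck_on_cong[OF W]) (use D'u in auto)
    qed
  qed
qed

text \<open>Bootstrapping: the derivative of \<open>g\<close> at \<open>y\<close> is the inverse of
  the derivative of \<open>f\<close> at \<open>g y\<close>. If \<open>g\<close> is of class k,
  \<open>Ck_on_linear_solution\<close> makes this derivative of class k, so \<open>g\<close> is of
  class k + 1, with the same \<open>U'\<close> and \<open>V\<close> for all k.\<close>

lemma smooth_inverse_function:
  fixes f :: "'a::euclidean_space \<Rightarrow> 'a"
  assumes U: "open U" "x0 \<in> U" and f: "\<And>k. Ck_on k U f"
    and inj: "inj (frechet_derivative f (at x0))"
  obtains U' V g where "open U'" "U' \<subseteq> U" "x0 \<in> U'" "open V" "f x0 \<in> V" "homeomorphism U' V f g"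
    "\<And>k. Ck_on k V g"
proof -
  let ?d = "\<lambda>x. frechet_derivative f (at x)"
  have d: "(f has_derivative ?d x) (at x)" if "x \<in> U" for x
    using Ck_on_has_derivative[OF U(1) f that] .
  define f' where "f' = (\<lambda>x. Blinfun (?d x))"
  have f': "blinfun_apply (f' x) = ?d x" if "x \<in> U" for x
    using has_derivative_bounded_linear[OF d[OF that]] by (simp add: f'_def bounded_linear_Blinfun_apply)
  have c: "continuous_on U f'"
  proof (rule continuous_on_blinfun_componentwise)
    fix i :: 'a
    have "continuous_on U (\<lambda>x. ?d x i)" using f[of "Suc 0"] by auto
    then show "continuous_on U (\<lambda>x. blinfun_apply (f' x) i)"
      using f' by (metis (no_types, lifting) continuous_on_cong)
  qed
  have l: "linear (?d x0)" using has_derivative_linear[OF d[OF U(2)]] .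
  then obtain gg where gg: "linear gg" "gg \<circ> ?d x0 = id"
    using inj linear_injective_left_inverse by blast
  define invf where "invf = Blinfun gg"
  have invf: "invf o\<^sub>L f' x0 = id_blinfun"
  proof (rule blinfun_eqI)
    fix i show "blinfun_apply (invf o\<^sub>L f' x0) i = blinfun_apply id_blinfun i"
      using gg f'[OF U(2)]
      by (simp add: invf_def bounded_linear_Blinfun_apply linear_conv_bounded_linear o_def id_def fun_eq_iff)
  qed
  obtain U' V g g' where *: "open U'" "U' \<subseteq> U" "x0 \<in> U'" "open V" "f x0 \<in> V" "homeomorphism U' V f g"
    "\<And>y. y \<in> V \<Longrightarrow> (g has_derivative (g' y)) (at y)"
    "\<And>y. y \<in> V \<Longrightarrow> g' y = inv (blinfun_apply (f'(g y)))"
    "\<And>y. y \<in> V \<Longrightarrow> bij (blinfun_apply (f'(g y)))"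
    using inverse_function_theorem[OF U(1), of f f' x0 invf] d f' c U(2) invf by (metis (no_types, lifting))
  have gV: "g y \<in> U" if "y \<in> V" for y using *(2,6) that unfolding homeomorphism_def by blast
  have b: "bij (?d (g y))" "g' y = inv (?d (g y))" if "y \<in> V" for y
    using *(8,9)[OF that] f'[OF gV[OF that]] by auto
  have "Ck_on k V g" for k
  proof (induction k)
    case 0
    then show ?case using *(6) by (simp add: homeomorphism_def)
  next
    case (Suc k)
    show ?case
    proof (rule Ck_on_SucI[OF *(4) *(7)])
      fix v
      show "Ck_on k V (\<lambda>x. g' x v)"
      proof (rule Ck_on_linear_solution[OF *(4), of "\<lambda>y. ?d (g y)"])
        show "linear (?d (g x))" if "x \<in> V" for x using has_derivative_linear[OF d[OF gV[OF that]]] .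
        show "linear (g' x)" if "x \<in> V" for x using has_derivative_linear[OF *(7)[OF that]] .
        show "?d (g x) (g' x v) = v" "g' x (?d (g x) v) = v" if "x \<in> V" for x v
          using b[OF that] by (auto simp: bij_is_surj surj_f_inv_f bij_is_inj)
        show "Ck_on k V (\<lambda>x. ?d (g x) v)" for v
          using Ck_on_compose[OF *(4) U(1) Suc, of "\<lambda>y. ?d y v"] f[of "Suc k"] gV by auto
      qed
    qed
  qed
  then show ?thesis using that *(1-6) by blast
qed

section \<open>Symmetry of second derivatives\<close>

lemma second_difference_mean_value:
  fixes \<phi> :: "'a::real_normed_vector \<Rightarrow> real"
  assumes h: "h > 0"
    and sq: "\<And>s t. 0 \<le> s \<Longrightarrow> s \<le> h \<Longrightarrow> 0 \<le> t \<Longrightarrow> t \<le> h \<Longrightarrow> x + s *\<^sub>R u + t *\<^sub>R v \<in> W"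
    and D: "\<And>y. y \<in> W \<Longrightarrow> (\<phi> has_derivative D y) (at y)"
    and DD: "\<And>y. y \<in> W \<Longrightarrow> ((\<lambda>z. D z u) has_derivative DD y) (at y)"
  shows "\<exists>s t. 0 < s \<and> s < h \<and> 0 < t \<and> t < h \<and>
    \<phi> (x + h *\<^sub>R u + h *\<^sub>R v) - \<phi> (x + h *\<^sub>R u) - \<phi> (x + h *\<^sub>R v) + \<phi> x
      = h * h * DD (x + s *\<^sub>R u + t *\<^sub>R v) v"
proof -
  have p1: "((\<lambda>s. x + s *\<^sub>R u + t *\<^sub>R v) has_derivative (\<lambda>s. s *\<^sub>R u)) (at s)" for s t
    by (auto intro!: derivative_eq_intros)
  have p2: "((\<lambda>t. x + s *\<^sub>R u + t *\<^sub>R v) has_derivative (\<lambda>t. t *\<^sub>R v)) (at t)" for s t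
    by (auto intro!: derivative_eq_intros)
  have r1: "DERIV (\<lambda>s. \<phi> (x + s *\<^sub>R u + t *\<^sub>R v)) s :> D (x + s *\<^sub>R u + t *\<^sub>R v) u"
    if "0 \<le> s" "s \<le> h" "0 \<le> t" "t \<le> h" for s t
    using has_derivative_compose[OF p1 D[OF sq[OF that]]]
      linear_cmul[OF has_derivative_linear[OF D[OF sq[OF that]]]]
    unfolding has_field_derivative_def by (simp add: mult_commute_abs)
  have r2: "DERIV (\<lambda>t. D (x + s *\<^sub>R u + t *\<^sub>R v) u) t :> DD (x + s *\<^sub>R u + t *\<^sub>R v) v"
    if "0 \<le> s" "s \<le> h" "0 \<le> t" "t \<le> h" for s t
    using has_derivative_compose[OF p2 DD[OF sq[OF that]]]
      linear_cmul[OF has_derivative_linear[OF DD[OF sq[OF that]]]]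
    unfolding has_field_derivative_def by (simp add: mult_commute_abs)
  let ?g = "\<lambda>s. \<phi> (x + s *\<^sub>R u + h *\<^sub>R v) - \<phi> (x + s *\<^sub>R u + 0 *\<^sub>R v)"
  have "\<exists>s>0. s < h \<and> ?g h - ?g 0 = (h - 0) *
      (D (x + s *\<^sub>R u + h *\<^sub>R v) u - D (x + s *\<^sub>R u + 0 *\<^sub>R v) u)"
    by (rule MVT2[OF h]) (intro DERIV_diff r1, use h in auto)
  then obtain s where s: "0 < s" "s < h" "?g h - ?g 0 =
      h * (D (x + s *\<^sub>R u + h *\<^sub>R v) u - D (x + s *\<^sub>R u + 0 *\<^sub>R v) u)"
    by auto
  have "\<exists>t>0. t < h \<and> D (x + s *\<^sub>R u + h *\<^sub>R v) u - D (x + s *\<^sub>R u + 0 *\<^sub>R v) u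
      = (h - 0) * DD (x + s *\<^sub>R u + t *\<^sub>R v) v"
    by (rule MVT2[OF h]) (intro r2, use s in auto)
  then obtain t where t: "0 < t" "t < h" "D (x + s *\<^sub>R u + h *\<^sub>R v) u - D (x + s *\<^sub>R u + 0 *\<^sub>R v) u
      = h * DD (x + s *\<^sub>R u + t *\<^sub>R v) v"
    by auto
  have "?g h - ?g 0 = h * h * DD (x + s *\<^sub>R u + t *\<^sub>R v) v"
    unfolding s(3) t(3) by simp
  then show ?thesis using s(1,2) t(1,2) by (intro exI[of _ s] exI[of _ t]) (simp add: algebra_simps)
qed

text \<open>The second difference over the parallelogram spanned by \<open>h *\<^sub>R u\<close> and
  \<open>h *\<^sub>R v\<close> is symmetric in \<open>u\<close> and \<open>v\<close>. The mean value
  theorem, applied twice in either order, writes it as \<open>h * h\<close> times a value of each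
  mixed derivative near \<open>x\<close>, and continuity forces equality at
  \<open>x\<close>.\<close>

lemma second_derivative_symmetric_real:
  fixes \<phi> :: "'a::real_normed_vector \<Rightarrow> real"
  assumes W: "open W" "x \<in> W"
    and D: "\<And>y. y \<in> W \<Longrightarrow> (\<phi> has_derivative D y) (at y)"
    and Du: "\<And>y. y \<in> W \<Longrightarrow> ((\<lambda>z. D z u) has_derivative Du y) (at y)"
    and Dv: "\<And>y. y \<in> W \<Longrightarrow> ((\<lambda>z. D z v) has_derivative Dv y) (at y)"
    and c: "isCont (\<lambda>y. Du y v) x" "isCont (\<lambda>y. Dv y u) x"
  shows "Du x v = Dv x u"
proof (rule ccontr)
  assume ne: "Du x v \<noteq> Dv x u"
  define e where "e = \<bar>Du x v - Dv x u\<bar> / 2"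
  have e: "e > 0" using ne by (simp add: e_def)
  obtain d1 where d1: "d1 > 0" "\<And>y. norm (y - x) < d1 \<Longrightarrow> \<bar>Du y v - Du x v\<bar> < e"
    using c(1) e unfolding continuous_at_eps_delta by (metis dist_norm real_norm_def)
  obtain d2 where d2: "d2 > 0" "\<And>y. norm (y - x) < d2 \<Longrightarrow> \<bar>Dv y u - Dv x u\<bar> < e"
    using c(2) e unfolding continuous_at_eps_delta by (metis dist_norm real_norm_def)
  obtain d3 where d3: "d3 > 0" "\<And>y. norm (y - x) < d3 \<Longrightarrow> y \<in> W"
    using W by (metis dist_norm open_dist)
  define d where "d = min d1 (min d2 d3)"
  \<comment> \<open>The \<open>+ 1\<close> keeps \<open>n\<close> positive;
    \<open>h = d / (2 * n)\<close> then keeps the whole parallelogram within distance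
    \<open>d\<close> of \<open>x\<close>.\<close>
  define n where "n = norm u + norm v + 1"
  define h where "h = d / (2 * n)"
  have dpos: "d > 0" using d1 d2 d3 by (simp add: d_def)
  have N: "n > 0" by (simp add: n_def add_nonneg_pos)
  have h: "h > 0" using dpos N unfolding h_def by simp
  have small: "norm (x + s *\<^sub>R u + t *\<^sub>R v - x) < d" if "0 \<le> s" "s \<le> h" "0 \<le> t" "t \<le> h" for s t
  proof -
    have "norm (x + s *\<^sub>R u + t *\<^sub>R v - x) \<le> norm (s *\<^sub>R u) + norm (t *\<^sub>R v)"
      by (metis add.assoc add_diff_cancel_left' norm_triangle_ineq)
    also have "\<dots> \<le> h * norm u + h * norm v"
      using that by (intro add_mono) (auto intro: mult_right_mono)
    also have "\<dots> \<le> h * n" using h by (simp add: n_def distrib_left)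
    also have "\<dots> = d / 2"
      using N unfolding h_def by simp
    finally show ?thesis using dpos by simp
  qed
  have inW: "x + s *\<^sub>R u + t *\<^sub>R v \<in> W" if "0 \<le> s" "s \<le> h" "0 \<le> t" "t \<le> h" for s t
    using small[OF that] d3 by (simp add: d_def)
  have inW': "x + s *\<^sub>R v + t *\<^sub>R u \<in> W" if "0 \<le> s" "s \<le> h" "0 \<le> t" "t \<le> h" for s t
    using inW[of t s] that by (simp add: algebra_simps)
  obtain s t where st: "0 < s" "s < h" "0 < t" "t < h" and
    1: "\<phi> (x + h *\<^sub>R u + h *\<^sub>R v) - \<phi> (x + h *\<^sub>R u) - \<phi> (x + h *\<^sub>R v) + \<phi> x
      = h * h * Du (x + s *\<^sub>R u + t *\<^sub>R v) v"
    using second_difference_mean_value[OF h inW D Du] by blast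
  obtain s' t' where st': "0 < s'" "s' < h" "0 < t'" "t' < h" and
    2: "\<phi> (x + h *\<^sub>R v + h *\<^sub>R u) - \<phi> (x + h *\<^sub>R v) - \<phi> (x + h *\<^sub>R u) + \<phi> x
      = h * h * Dv (x + s' *\<^sub>R v + t' *\<^sub>R u) u"
    using second_difference_mean_value[OF h inW' D Dv] by blast
  have sw: "x + h *\<^sub>R v + h *\<^sub>R u = x + h *\<^sub>R u + h *\<^sub>R v" by (simp only: ac_simps)
  have "h * h * Du (x + s *\<^sub>R u + t *\<^sub>R v) v = h * h * Dv (x + s' *\<^sub>R v + t' *\<^sub>R u) u"
    using 1 2[unfolded sw] by linarith
  then have "Du (x + s *\<^sub>R u + t *\<^sub>R v) v = Dv (x + s' *\<^sub>R v + t' *\<^sub>R u) u" using h by simp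
  moreover have "\<bar>Du (x + s *\<^sub>R u + t *\<^sub>R v) v - Du x v\<bar> < e"
    using small[of s t] st by (intro d1(2)) (simp add: d_def)
  moreover have "\<bar>Dv (x + s' *\<^sub>R v + t' *\<^sub>R u) u - Dv x u\<bar> < e"
  proof (rule d2(2))
    have sw': "x + s' *\<^sub>R v + t' *\<^sub>R u = x + t' *\<^sub>R u + s' *\<^sub>R v" by (simp only: ac_simps)
    show "norm (x + s' *\<^sub>R v + t' *\<^sub>R u - x) < d2"
      using small[of t' s'] st' unfolding sw' d_def by linarith
  qed
  ultimately have lt: "\<bar>Du x v - Dv x u\<bar> < 2 * e" by linarith
  have "2 * e = \<bar>Du x v - Dv x u\<bar>"
    unfolding e_def by (metis (mono_tags) field_sum_of_halves mult_2)
  with lt show False by (metis less_irrefl)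
qed

lemma second_derivative_symmetric:
  fixes f :: "'a::euclidean_space \<Rightarrow> 'b::euclidean_space"
  assumes W: "open W" "x \<in> W" and f: "Ck_on (Suc (Suc 0)) W f"
  shows "frechet_derivative (\<lambda>y. frechet_derivative f (at y) u) (at x) v =
    frechet_derivative (\<lambda>y. frechet_derivative f (at y) v) (at x) u"
proof (rule euclidean_eqI)
  fix b :: 'b
  let ?D = "\<lambda>y. frechet_derivative f (at y)"
  let ?DD = "\<lambda>u y. frechet_derivative (\<lambda>y. ?D y u) (at y)"
  have D: "(f has_derivative ?D y) (at y)" if "y \<in> W" for y
    using Ck_on_has_derivative[OF W(1) f that] .
  have fu: "Ck_on (Suc 0) W (\<lambda>y. ?D y u)" for u using f Ck_on.simps(2)[of "Suc 0" W f] by blast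
  have DD: "((\<lambda>y. ?D y u) has_derivative ?DD u y) (at y)" if "y \<in> W" for y u
    using Ck_on_has_derivative[OF W(1) fu that] .
  have c: "isCont (\<lambda>y. ?DD u y v) x" for u v
  proof -
    have "continuous_on W (\<lambda>y. ?DD u y v)" using fu[of u] unfolding Ck_on.simps by blast
    from iffD1[OF continuous_on_eq_continuous_at[OF W(1)] this] W(2) show ?thesis by blast
  qed
  show "?DD u x v \<bullet> b = ?DD v x u \<bullet> b"
  proof (rule second_derivative_symmetric_real[OF W, of "\<lambda>y. f y \<bullet> b" "\<lambda>y w. ?D y w \<bullet> b" u
        "\<lambda>y w. ?DD u y w \<bullet> b" v "\<lambda>y w. ?DD v y w \<bullet> b"])
    show "isCont (\<lambda>y. ?DD u y v \<bullet> b) x" "isCont (\<lambda>y. ?DD v y u \<bullet> b) x"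
      by (intro isCont_inner c continuous_const)+
  qed (intro has_derivative_inner_left D DD; assumption)+
qed

lemma smooth_onE:
  assumes "smooth_on A f" "p \<in> A"
  obtains W F where "open W" "p \<in> W" "\<forall>k. Ck_on k W F" "\<forall>q\<in>A \<inter> W. F q = f q"
proof -
  from assms(1)[unfolded smooth_on_def, rule_format, OF assms(2)]
  obtain W F where "open W \<and> p \<in> W \<and> (\<forall>k. Ck_on k W F) \<and> (\<forall>q\<in>A \<inter> W. F q = f q)"
    by (elim exE)
  then show ?thesis by (intro that[of W F]) simp_all
qed

lemma smooth_onI_open:
  "open W \<Longrightarrow> (\<And>k. Ck_on k W F) \<Longrightarrow> A \<subseteq> W \<Longrightarrow> (\<And>q. q \<in> A \<Longrightarrow> F q = f q) \<Longrightarrow> smooth_on A f"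
  unfolding smooth_on_def by (intro ballI exI[of _ W] exI[of _ F]) auto

section \<open>Complex matrices\<close>

lemma matrix_add_rdistrib: "(A + B) ** C = A ** C + B ** (C :: 'a::semiring_1^'p^'n)"
  by (simp add: matrix_matrix_mult_def vec_eq_iff sum.distrib distrib_right)

lemma matrix_mult_minus_left: "(- A) ** B = - (A ** (B :: 'a::ring_1^'p^'n))"
  by (simp add: matrix_matrix_mult_def vec_eq_iff sum_negf)

lemma matrix_mult_minus_right: "A ** (- B) = - (A ** (B :: 'a::ring_1^'p^'n))"
  by (simp add: matrix_matrix_mult_def vec_eq_iff sum_negf)

lemma matrix_diff_ldistrib: "A ** (B - C) = A ** B - A ** (C :: 'a::ring_1^'p^'n)"
  by (simp add: matrix_matrix_mult_def vec_eq_iff sum_subtractf right_diff_distrib)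

lemma matrix_diff_rdistrib: "(A - B) ** C = A ** C - B ** (C :: 'a::ring_1^'p^'n)"
  by (simp add: matrix_matrix_mult_def vec_eq_iff sum_subtractf left_diff_distrib)

lemmas matrix_ring = matrix_add_ldistrib matrix_add_rdistrib matrix_diff_ldistrib matrix_diff_rdistrib
  matrix_mult_minus_left matrix_mult_minus_right matrix_mul_assoc
  scalar_matrix_assoc[symmetric] matrix_scalar_ac

lemma transpose_add: "transpose (A + B) = transpose A + transpose B"
  by (simp add: transpose_def vec_eq_iff)
lemma transpose_diff: "transpose (A - B) = transpose A - transpose B"
  by (simp add: transpose_def vec_eq_iff)
lemma transpose_minus: "transpose (- A) = - transpose A"
  by (simp add: transpose_def vec_eq_iff)

lemma cnj_mat_mult: "cnj_mat (A ** B) = cnj_mat A ** cnj_mat B"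
  by (simp add: cnj_mat_def matrix_matrix_mult_def vec_eq_iff)
lemma cnj_mat_add: "cnj_mat (A + B) = cnj_mat A + cnj_mat B"
  by (simp add: cnj_mat_def vec_eq_iff)
lemma cnj_mat_diff: "cnj_mat (A - B) = cnj_mat A - cnj_mat B"
  by (simp add: cnj_mat_def vec_eq_iff)
lemma cnj_mat_minus: "cnj_mat (- A) = - cnj_mat A"
  by (simp add: cnj_mat_def vec_eq_iff)
lemma cnj_mat_scaleR: "cnj_mat (r *\<^sub>R A) = r *\<^sub>R cnj_mat A"
  by (simp add: cnj_mat_def vec_eq_iff)
lemma cnj_mat_cnj_mat [simp]: "cnj_mat (cnj_mat A) = A"
  by (simp add: cnj_mat_def vec_eq_iff)
lemma cnj_mat_1 [simp]: "cnj_mat (mat 1) = mat 1"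
  by (simp add: cnj_mat_def vec_eq_iff mat_def)
lemma transpose_cnj_mat: "transpose (cnj_mat A) = cnj_mat (transpose A)"
  by (simp add: cnj_mat_def transpose_def vec_eq_iff)

lemma transpose_0: "transpose 0 = 0"
  by (simp add: transpose_def vec_eq_iff)
lemma cnj_mat_0: "cnj_mat 0 = 0"
  by (simp add: cnj_mat_def vec_eq_iff)

lemmas matrix_conv = transpose_0 cnj_mat_0 transpose_add transpose_diff transpose_minus transpose_scalar matrix_transpose_mul
  cnj_mat_mult cnj_mat_add cnj_mat_diff cnj_mat_minus cnj_mat_scaleR transpose_cnj_mat

lemma bounded_bilinear_matrix_mult:
  "bounded_bilinear ((**) :: complex^'m^'m \<Rightarrow> complex^'m^'m \<Rightarrow> complex^'m^'m)"
  unfolding bilinear_conv_bounded_bilinear[symmetric] bilinear_def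
  by (auto intro!: linearI simp: matrix_ring)

lemma bounded_linear_transpose: "bounded_linear (transpose :: complex^'m^'m \<Rightarrow> complex^'m^'m)"
  unfolding linear_conv_bounded_linear[symmetric] by (auto intro!: linearI simp: matrix_conv)

lemma bounded_linear_cnj_mat: "bounded_linear (cnj_mat :: complex^'m^'m \<Rightarrow> complex^'m^'m)"
  unfolding linear_conv_bounded_linear[symmetric] by (auto intro!: linearI simp: matrix_conv)

lemma bounded_linear_trace: "bounded_linear (trace :: complex^'m^'m \<Rightarrow> complex)"
  unfolding linear_conv_bounded_linear[symmetric]
  by (auto intro!: linearI simp: trace_def sum.distrib scaleR_sum_right)

lemma inner_mat_eq: "A \<bullet> B = Re (trace (A ** ctranspose B))" for A B :: "complex^'m^'m"
  by (simp add: inner_vec_def trace_def matrix_matrix_mult_def ctranspose_def transpose_def cnj_mat_def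
      inner_complex_def)

lemma matrix_inv_eqI:
  fixes A B :: "'a::field^'m^'m"
  assumes "A ** B = mat 1"
  shows "matrix_inv A = B"
proof -
  have BA: "B ** A = mat 1" using assms matrix_left_right_inverse by blast
  have "A ** matrix_inv A = mat 1 \<and> matrix_inv A ** A = mat 1"
    unfolding matrix_inv_def by (rule someI[of _ B]) (use assms BA in simp)
  then show ?thesis using BA by (metis matrix_mul_assoc matrix_mul_lid matrix_mul_rid)
qed

lemma matrix_inv_mult:
  fixes A :: "'a::field^'m^'m"
  assumes "det A \<noteq> 0"
  shows "A ** matrix_inv A = mat 1" "matrix_inv A ** A = mat 1"
proof -
  obtain B where "A ** B = mat 1" using assms invertible_det_nz[of A] invertible_def by blast
  then show "A ** matrix_inv A = mat 1" using matrix_inv_eqI by metis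
  then show "matrix_inv A ** A = mat 1" using matrix_left_right_inverse by blast
qed

lemma matrix_right_cancel:
  fixes M :: "'a::field^'m^'m"
  assumes "det M \<noteq> 0" "A ** M = B ** M"
  shows "A = B"
proof -
  have "A ** (M ** matrix_inv M) = B ** (M ** matrix_inv M)"
    using assms(2) by (simp add: matrix_mul_assoc)
  then show ?thesis using matrix_inv_mult(1)[OF assms(1)] by simp
qed

lemma continuous_on_det: "continuous_on S (det :: complex^'m^'m \<Rightarrow> complex)"
  unfolding det_def by (intro continuous_intros)

lemma Ck_on_matrix_mult:
  fixes f g :: "'a::euclidean_space \<Rightarrow> complex^'m^'m"
  shows "open W \<Longrightarrow> Ck_on k W f \<Longrightarrow> Ck_on k W g \<Longrightarrow> Ck_on k W (\<lambda>x. f x ** g x)"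
  by (rule Ck_on_bilinear[OF _ bounded_bilinear_matrix_mult])

lemma open_det_nonzero: "open {A :: complex^'m^'m. det A \<noteq> 0}"
proof -
  have "open (det -` (- {0 :: complex}) :: (complex^'m^'m) set)"
    by (rule open_vimage) (auto intro: continuous_on_det)
  then show ?thesis by (simp add: vimage_def)
qed

text \<open>Inversion solves the linear system \<open>A ** X = mat 1\<close>, so its smoothness is
  an instance of \<open>Ck_on_linear_solution\<close>.\<close>

lemma Ck_on_matrix_inv: "Ck_on k {A :: complex^'m^'m. det A \<noteq> 0} matrix_inv"
proof -
  have "Ck_on k {A :: complex^'m^'m. det A \<noteq> 0} (\<lambda>A. matrix_inv A ** mat 1)"
  proof (rule Ck_on_linear_solution[OF open_det_nonzero, of "\<lambda>A B. A ** B" "\<lambda>A B. matrix_inv A ** B"])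
    show "Ck_on k {A :: complex^'m^'m. det A \<noteq> 0} (\<lambda>A. A ** v)" for v :: "complex^'m^'m"
      by (intro Ck_on_matrix_mult Ck_on_ident Ck_on_const open_det_nonzero)
    fix A v :: "complex^'m^'m" assume "A \<in> {A. det A \<noteq> 0}"
    then show "A ** (matrix_inv A ** v) = v" "matrix_inv A ** (A ** v) = v"
      using matrix_inv_mult[of A] by (simp_all add: matrix_mul_assoc)
  qed (auto intro!: linearI simp: matrix_ring)
  then show ?thesis by simp
qed

section \<open>The Cayley transform\<close>

text \<open>A rational substitute for the exponential map: it sends the Lie algebra into the group,
  and its identities follow by multiplying with \<open>mat 1 - m\<close>. Its derivative at 0 is
  twice the identity, which explains the halves inserted wherever a curve with given velocity is
  built.\<close>

definition cayley :: "complex^'m^'m \<Rightarrow> complex^'m^'m" where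
  "cayley m = matrix_inv (mat 1 - m) ** (mat 1 + m)"

definition cayley_dom :: "(complex^'m^'m) set" where
  "cayley_dom = {m. det (mat 1 - m) \<noteq> 0}"

lemma open_cayley_dom: "open (cayley_dom :: (complex^'m^'m) set)"
proof -
  have "open ((\<lambda>m :: complex^'m^'m. mat 1 - m) -` {A. det A \<noteq> 0})"
    by (rule open_vimage[OF open_det_nonzero]) (intro continuous_intros)
  then show ?thesis by (simp add: vimage_def cayley_dom_def)
qed

lemma zero_in_cayley_dom: "0 \<in> cayley_dom" by (simp add: cayley_dom_def)

lemma cayley_0: "cayley 0 = mat 1"
  by (simp add: cayley_def matrix_inv_eqI)

lemma Ck_on_cayley: "Ck_on k (cayley_dom :: (complex^'m^'m) set) cayley"
proof -
  have 1: "Ck_on k (cayley_dom :: (complex^'m^'m) set) (\<lambda>m. mat 1 - m)"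
    by (intro Ck_on_diff Ck_on_const Ck_on_ident open_cayley_dom)
  have "Ck_on k (cayley_dom :: (complex^'m^'m) set) (\<lambda>m. matrix_inv (mat 1 - m))"
    by (rule Ck_on_compose[OF open_cayley_dom open_det_nonzero 1 Ck_on_matrix_inv])
      (auto simp: cayley_dom_def)
  then show ?thesis
    unfolding cayley_def
    by (intro Ck_on_matrix_mult Ck_on_add Ck_on_const Ck_on_ident open_cayley_dom)
qed

lemma cayley_mult:
  assumes "m \<in> cayley_dom"
  shows "(mat 1 - m) ** cayley m = mat 1 + m" "cayley m ** (mat 1 - m) = mat 1 + m"
proof -
  have d: "det (mat 1 - m) \<noteq> 0" using assms by (simp add: cayley_dom_def)
  show "(mat 1 - m) ** cayley m = mat 1 + m"
    unfolding cayley_def using matrix_inv_mult(1)[OF d] by (simp add: matrix_mul_assoc)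
  have "(mat 1 + m) ** (mat 1 - m) = (mat 1 - m) ** (mat 1 + m)" by (simp add: matrix_ring)
  then have "cayley m ** (mat 1 - m) = matrix_inv (mat 1 - m) ** (mat 1 - m) ** (mat 1 + m)"
    unfolding cayley_def by (metis matrix_mul_assoc)
  then show "cayley m ** (mat 1 - m) = mat 1 + m" using matrix_inv_mult(2)[OF d] by simp
qed

text \<open>Obtained by differentiating \<open>(mat 1 - m) ** cayley m = mat 1 + m\<close> at
  0.\<close>

lemma cayley_has_derivative: "(cayley has_derivative (\<lambda>m. 2 *\<^sub>R m)) (at (0 :: complex^'m^'m))"
proof -
  let ?c' = "frechet_derivative cayley (at (0 :: complex^'m^'m))"
  have c: "(cayley has_derivative ?c') (at 0)"
    by (rule Ck_on_has_derivative[OF open_cayley_dom Ck_on_cayley zero_in_cayley_dom])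
  have "((\<lambda>m :: complex^'m^'m. (mat 1 - m) ** cayley m) has_derivative
      (\<lambda>h. (mat 1 - 0) ** ?c' h + (0 - h) ** cayley 0)) (at 0)"
    by (intro bounded_bilinear.FDERIV[OF bounded_bilinear_matrix_mult] has_derivative_diff
        has_derivative_const has_derivative_ident c)
  then have "((\<lambda>m :: complex^'m^'m. mat 1 + m) has_derivative
      (\<lambda>h. (mat 1 - 0) ** ?c' h + (0 - h) ** cayley 0)) (at 0)"
    by (rule has_derivative_transform_within_open[OF _ open_cayley_dom zero_in_cayley_dom])
      (rule cayley_mult)
  moreover have "((\<lambda>m :: complex^'m^'m. mat 1 + m) has_derivative (\<lambda>h. 0 + h)) (at 0)"
    by (intro has_derivative_add has_derivative_const has_derivative_ident)
  ultimately have eq: "(\<lambda>h. (mat 1 - 0) ** ?c' h + (0 - h) ** cayley 0) = (\<lambda>h :: complex^'m^'m. 0 + h)"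
    by (rule has_derivative_unique)
  have "?c' h = 2 *\<^sub>R h" for h
    using fun_cong[OF eq, of h] by (simp add: cayley_0 matrix_mult_minus_left scaleR_2 diff_eq_eq)
  then have "?c' = (\<lambda>m. 2 *\<^sub>R m)" by (rule ext)
  with c show ?thesis by simp
qed

section \<open>The group and its Lie algebra\<close>

lemma sum_Plus_UNIV: "(\<Sum>i\<in>UNIV. f i) = (\<Sum>k\<in>UNIV. f (Inl k)) + (\<Sum>k\<in>UNIV. f (Inr k))"
  for f :: "'n::finite + 'n \<Rightarrow> 'a::comm_monoid_add"
  using sum.Plus[of "UNIV :: 'n set" "UNIV :: 'n set" f] by simp

lemma blocks_mult: "blocks P Q R S ** blocks P' Q' R' S' =
    blocks (P ** P' + Q ** R') (P ** Q' + Q ** S') (R ** P' + S ** R') (R ** Q' + S ** S')"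
  by (simp add: vec_eq_iff blocks_def matrix_matrix_mult_def sum_Plus_UNIV split: sum.split)

lemma transpose_blocks: "transpose (blocks P Q R S) =
    blocks (transpose P) (transpose R) (transpose Q) (transpose S)"
  by (simp add: vec_eq_iff blocks_def transpose_def split: sum.split)

lemma cnj_mat_blocks: "cnj_mat (blocks P Q R S) = blocks (cnj_mat P) (cnj_mat Q) (cnj_mat R) (cnj_mat S)"
  by (simp add: vec_eq_iff blocks_def cnj_mat_def split: sum.split)

lemma blocks_1: "blocks (mat 1) 0 0 (mat 1) = mat 1"
  by (auto simp: vec_eq_iff blocks_def mat_def split: sum.split)

lemma blocks_minus: "- blocks P Q R S = blocks (- P) (- Q) (- R) (- S)"
  by (simp add: vec_eq_iff blocks_def split: sum.split)

lemma blocks_eq_iff: "blocks P Q R S = blocks P' Q' R' S' \<longleftrightarrow> P = P' \<and> Q = Q' \<and> R = R' \<and> S = S'"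
proof
  assume "blocks P Q R S = blocks P' Q' R' S'"
  then have e: "blocks P Q R S $ i $ j = blocks P' Q' R' S' $ i $ j" for i j by simp
  show "P = P' \<and> Q = Q' \<and> R = R' \<and> S = S'"
    using e[of "Inl _" "Inl _"] e[of "Inl _" "Inr _"] e[of "Inr _" "Inl _"] e[of "Inr _" "Inr _"]
    by (simp add: vec_eq_iff blocks_def)
qed simp

lemma blocks_cases:
  fixes M :: "('n::finite) cmat2"
  obtains P Q R S where "M = blocks P Q R S"
proof
  show "M = blocks (\<chi> i j. M $ Inl i $ Inl j) (\<chi> i j. M $ Inl i $ Inr j)
      (\<chi> i j. M $ Inr i $ Inl j) (\<chi> i j. M $ Inr i $ Inr j)"
    by (simp add: vec_eq_iff blocks_def split: sum.split)
qed

lemma Jn_Jn: "Jn ** Jn = - (mat 1 :: ('n::finite) cmat2)"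
  by (simp add: Jn_def blocks_mult blocks_1[symmetric] blocks_minus matrix_ring)

lemma Jn_Jn': "A ** Jn ** Jn = - (A :: ('n::finite) cmat2)"
  using arg_cong[OF Jn_Jn, of "\<lambda>X. A ** X"] by (simp add: matrix_mul_assoc matrix_mult_minus_right)

lemma transpose_Jn: "transpose Jn = - (Jn :: ('n::finite) cmat2)"
  by (simp add: Jn_def transpose_blocks blocks_minus matrix_conv)

lemma cnj_mat_Jn: "cnj_mat Jn = (Jn :: ('n::finite) cmat2)"
  by (simp add: Jn_def cnj_mat_blocks matrix_conv)

text \<open>Given orthogonality, the third defining equation becomes real linear in
  \<open>z\<close>, which suits products, transposes and differentiation.\<close>

lemma SO_star_iff: "z \<in> SO_star \<longleftrightarrow>
    z ** transpose z = mat 1 \<and> det z = 1 \<and> cnj_mat z ** Jn = Jn ** z"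
proof -
  have "cnj_mat z ** Jn ** transpose z = Jn \<longleftrightarrow> cnj_mat z ** Jn = Jn ** z" if zz: "z ** transpose z = mat 1"
  proof
    have zz': "transpose z ** z = mat 1" using zz matrix_left_right_inverse by blast
    assume "cnj_mat z ** Jn ** transpose z = Jn"
    then have "cnj_mat z ** Jn ** (transpose z ** z) = Jn ** z" by (simp add: matrix_mul_assoc)
    then show "cnj_mat z ** Jn = Jn ** z" using zz' by simp
  next
    assume "cnj_mat z ** Jn = Jn ** z"
    then have "cnj_mat z ** Jn ** transpose z = Jn ** (z ** transpose z)" by (simp add: matrix_mul_assoc)
    then show "cnj_mat z ** Jn ** transpose z = Jn" using zz by simp
  qed
  then show ?thesis unfolding SO_star_def by auto
qed

text \<open>The forms with a leading factor \<open>A\<close> serve to rewrite inside products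
  associated to the left, the normal form produced by \<open>matrix_ring\<close>.\<close>

lemma SO_starD:
  assumes "z \<in> SO_star"
  shows "z ** transpose z = mat 1" "transpose z ** z = mat 1" "det z = 1" "cnj_mat z ** Jn = Jn ** z"
    "A ** z ** transpose z = A" "A ** transpose z ** z = A" "matrix_inv z = transpose z"
    "cnj_mat z = - (Jn ** z ** Jn)"
    "transpose (cnj_mat z) = - (Jn ** transpose z ** Jn)"
    "A ** cnj_mat z ** Jn = A ** Jn ** z"
proof -
  show 1: "z ** transpose z = mat 1" "det z = 1" and 2: "cnj_mat z ** Jn = Jn ** z"
    using assms SO_star_iff by blast+
  then show 3: "transpose z ** z = mat 1" using matrix_left_right_inverse by blast
  show "A ** z ** transpose z = A" using 1(1) by (metis matrix_mul_assoc matrix_mul_rid)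
  show "A ** transpose z ** z = A" using 3 by (metis matrix_mul_assoc matrix_mul_rid)
  show "matrix_inv z = transpose z" using matrix_inv_eqI[OF 1(1)] .
  have "- (Jn ** z ** Jn) = - (cnj_mat z ** Jn ** Jn)" using 2 by simp
  then show 4: "cnj_mat z = - (Jn ** z ** Jn)" by (simp add: Jn_Jn')
  show "transpose (cnj_mat z) = - (Jn ** transpose z ** Jn)"
    unfolding 4 by (simp add: matrix_conv transpose_Jn matrix_ring)
  show "A ** cnj_mat z ** Jn = A ** Jn ** z" using 2 by (metis matrix_mul_assoc)
qed

lemma SO_star_mult:
  assumes z: "z \<in> SO_star" and w: "w \<in> SO_star"
  shows "z ** w \<in> SO_star"
proof -
  have "cnj_mat (z ** w) ** Jn = Jn ** (z ** w)"
    by (simp add: cnj_mat_mult matrix_mul_assoc SO_starD(10)[OF w] SO_starD(4)[OF z])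
  then show ?thesis
    by (simp add: SO_star_iff[of "z ** w"] matrix_transpose_mul det_mul matrix_mul_assoc
        SO_starD(1,3,5)[OF z] SO_starD(1,3,5)[OF w])
qed

lemma transpose_SO_star:
  assumes "z \<in> SO_star"
  shows "transpose z \<in> SO_star"
proof -
  have "transpose (cnj_mat z) ** Jn = Jn ** transpose z"
    using SO_starD(9)[OF assms] by (simp add: Jn_Jn' matrix_mult_minus_left)
  then show ?thesis
    by (simp add: SO_star_iff[of "transpose z"] SO_starD(2,3)[OF assms] transpose_cnj_mat)
qed

lemma one_SO_star: "mat 1 \<in> SO_star"
  by (simp add: SO_star_iff)

text \<open>The Lie algebra of \<open>SO_star\<close>. The next two sets are its Cartan
  decomposition: \<open>k_alg\<close> is the real part, the Lie algebra of the embedded unitary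
  group, and \<open>p_alg\<close> the purely imaginary part.\<close>

definition so_alg :: "('n::finite) cmat2 set" where
  "so_alg = {X. transpose X = - X \<and> cnj_mat X ** Jn = Jn ** X}"

definition k_alg :: "('n::finite) cmat2 set" where
  "k_alg = {X. transpose X = - X \<and> cnj_mat X = X \<and> X ** Jn = Jn ** X}"

definition p_alg :: "('n::finite) cmat2 set" where
  "p_alg = {X. transpose X = - X \<and> cnj_mat X = - X \<and> X ** Jn = - (Jn ** X)}"

lemma subspace_p_alg: "subspace p_alg"
  unfolding subspace_def p_alg_def
  by (auto simp: matrix_conv matrix_ring)

lemma p_alg_so_alg: "Y \<in> p_alg \<Longrightarrow> Y \<in> so_alg"
  by (simp add: p_alg_def so_alg_def matrix_ring)

lemma k_alg_so_alg: "Y \<in> k_alg \<Longrightarrow> Y \<in> so_alg"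
  by (simp add: k_alg_def so_alg_def)

lemma so_alg_cnj:
  assumes "X \<in> so_alg"
  shows "cnj_mat X = - (Jn ** X ** Jn)" "X ** Jn = Jn ** cnj_mat X"
proof -
  have 1: "cnj_mat X ** Jn = Jn ** X" using assms by (simp add: so_alg_def)
  then show 2: "cnj_mat X = - (Jn ** X ** Jn)" by (metis Jn_Jn' minus_minus)
  show "X ** Jn = Jn ** cnj_mat X" unfolding 2 by (simp add: matrix_ring Jn_Jn matrix_mult_minus_left)
qed

lemma so_alg_p_part:
  assumes "X \<in> so_alg"
  shows "X - cnj_mat X \<in> p_alg"
proof -
  have "transpose X = - X" "cnj_mat X ** Jn = Jn ** X" using assms by (auto simp: so_alg_def)
  then show ?thesis
    using so_alg_cnj(2)[OF assms] by (simp add: p_alg_def matrix_conv matrix_ring)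
qed

lemma so_alg_k_part:
  assumes "X \<in> so_alg"
  shows "X + cnj_mat X \<in> k_alg"
proof -
  have "transpose X = - X" "cnj_mat X ** Jn = Jn ** X" using assms by (auto simp: so_alg_def)
  then show ?thesis
    using so_alg_cnj(2)[OF assms] by (simp add: k_alg_def matrix_conv matrix_ring add.commute)
qed

text \<open>Transposition turns \<open>X\<close> into \<open>- X\<close> and so exchanges numerator
  and denominator of the transform. This gives orthogonality, and determinant 1 because
  \<open>mat 1 + X\<close> is the transpose of \<open>mat 1 - X\<close>.\<close>

lemma cayley_SO_star:
  assumes X: "X \<in> so_alg" and d: "X \<in> cayley_dom"
  shows "cayley X \<in> SO_star"
proof -
  let ?I = "mat 1 :: 'a cmat2"
  have t: "transpose X = - X" and J: "cnj_mat X ** Jn = Jn ** X" using X by (auto simp: so_alg_def)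
  have dm: "det (?I - X) \<noteq> 0" using d by (simp add: cayley_dom_def)
  have dp: "det (?I + X) = det (?I - X)"
    using det_transpose[of "?I - X"] t by (simp add: matrix_conv)
  note c = cayley_mult[OF d]
  have det: "det (cayley X) = 1"
    using arg_cong[OF c(1), of det] dm dp by (simp add: det_mul)
  have tc: "transpose (cayley X) ** (?I + X) = ?I - X"
    using arg_cong[OF c(1), of transpose] t by (simp add: matrix_conv)
  have "transpose (cayley X) ** cayley X ** (?I - X) = transpose (cayley X) ** (?I + X)"
    using c(2) by (simp add: matrix_mul_assoc[symmetric])
  then have "transpose (cayley X) ** cayley X ** (?I - X) = ?I ** (?I - X)" using tc by simp
  then have o: "transpose (cayley X) ** cayley X = ?I" by (rule matrix_right_cancel[OF dm])
  then have orth: "cayley X ** transpose (cayley X) = ?I" using matrix_left_right_inverse by blast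
  have J': "A ** cnj_mat X ** Jn = A ** Jn ** X" for A :: "'a cmat2"
    using arg_cong[OF J, of "\<lambda>M. A ** M"] by (simp add: matrix_mul_assoc)
  have "cnj_mat (cayley X) ** Jn ** (?I - X) = cnj_mat (cayley X ** (?I - X)) ** Jn"
    using J' by (simp add: matrix_conv matrix_ring)
  also have "\<dots> = Jn ** (cayley X ** (?I - X))"
    unfolding c(2) using J by (simp add: matrix_conv matrix_ring)
  finally have "cnj_mat (cayley X) ** Jn ** (?I - X) = Jn ** cayley X ** (?I - X)"
    by (simp add: matrix_mul_assoc)
  then have "cnj_mat (cayley X) ** Jn = Jn ** cayley X" by (rule matrix_right_cancel[OF dm])
  then show ?thesis using orth det by (simp add: SO_star_iff)
qed

lemma cnj_mat_cayley:
  assumes "cnj_mat X = X" and d: "X \<in> cayley_dom"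
  shows "cnj_mat (cayley X) = cayley X"
proof -
  have dm: "det (mat 1 - X) \<noteq> 0" using d by (simp add: cayley_dom_def)
  have "cnj_mat (cayley X ** (mat 1 - X)) = cayley X ** (mat 1 - X)"
    unfolding cayley_mult(2)[OF d] using assms(1) by (simp add: matrix_conv)
  then have "cnj_mat (cayley X) ** (mat 1 - X) = cayley X ** (mat 1 - X)"
    using assms(1) by (simp add: cnj_mat_mult cnj_mat_diff)
  then show ?thesis by (rule matrix_right_cancel[OF dm])
qed

section \<open>Cosets and complex structures\<close>

text \<open>For orthogonal \<open>z\<close> this is the conjugate of \<open>Jn\<close> by
  \<open>z\<close>. The stabiliser of \<open>Jn\<close> in \<open>SO_star\<close> is the embedded
  unitary group, so the value determines the coset.\<close>

definition cstr :: "('n::finite) cmat2 \<Rightarrow> 'n cmat2" where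
  "cstr z = z ** Jn ** transpose z"

text \<open>A real element commutes with \<open>Jn\<close> by the third group equation, which forces
  the blocks \<open>P, Q, - Q, P\<close>. Orthogonality is then unitarity of
  \<open>P + \<i> Q\<close>, split into real and imaginary parts.\<close>

lemma real_SO_star_Un_embed:
  assumes k: "k \<in> SO_star" "cnj_mat k = k"
  obtains u where "u \<in> unitary_mats" "k = Un_embed u"
proof -
  obtain P Q R S where b: "k = blocks P Q R S" using blocks_cases by blast
  have "k ** Jn = Jn ** k" using SO_starD(4)[OF k(1)] k(2) by simp
  moreover have "k ** Jn = blocks (- Q) P (- S) R" "Jn ** k = blocks R S (- P) (- Q)"
    unfolding b Jn_def blocks_mult by (simp_all add: matrix_ring)
  ultimately have "blocks (- Q) P (- S) R = blocks R S (- P) (- Q)" by metis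
  then have PS: "S = P" "R = - Q" unfolding blocks_eq_iff by (metis (no_types), metis (no_types))
  have r: "cnj_mat P = P" "cnj_mat Q = Q" using k(2) unfolding b cnj_mat_blocks blocks_eq_iff by auto
  have re: "of_real (Re (P $ i $ j)) = P $ i $ j" "of_real (Re (Q $ i $ j)) = Q $ i $ j" for i j
    using r by (simp_all add: cnj_mat_def vec_eq_iff complex_eq_iff)
  define u where "u = (\<chi> i j. Complex (Re (P $ i $ j)) (Re (Q $ i $ j)))"
  have ku: "k = Un_embed u"
    unfolding b PS Un_embed_def Let_def blocks_eq_iff u_def by (simp add: vec_eq_iff re)
  have "k ** transpose k = mat 1" using SO_starD(1)[OF k(1)] .
  then have 1: "P ** transpose P + Q ** transpose Q = mat 1" "P ** transpose Q = Q ** transpose P"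
  proof -
    have "k ** transpose k = blocks (P ** transpose P + Q ** transpose Q)
        (Q ** transpose P - P ** transpose Q) (P ** transpose Q - Q ** transpose P)
        (Q ** transpose Q + P ** transpose P)"
      unfolding b PS transpose_blocks blocks_mult by (simp add: matrix_ring matrix_conv)
    with \<open>k ** transpose k = mat 1\<close> have "P ** transpose P + Q ** transpose Q = mat 1 \<and>
        P ** transpose Q - Q ** transpose P = 0"
      unfolding blocks_1[symmetric] by (metis blocks_eq_iff)
    then show "P ** transpose P + Q ** transpose Q = mat 1" "P ** transpose Q = Q ** transpose P"
      by simp_all
  qed
  have "u \<in> unitary_mats"
  proof -
    have "(u ** ctranspose u) $ i $ j = mat 1 $ i $ j" for i j
    proof -
      have a: "(\<Sum>l\<in>UNIV. Re (P $ i $ l) * Re (P $ j $ l) + Re (Q $ i $ l) * Re (Q $ j $ l)) = (if i = j then 1 else 0)"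
      proof -
        have "complex_of_real (\<Sum>l\<in>UNIV. Re (P $ i $ l) * Re (P $ j $ l) + Re (Q $ i $ l) * Re (Q $ j $ l)) =
            (P ** transpose P + Q ** transpose Q) $ i $ j"
          by (simp add: matrix_matrix_mult_def transpose_def sum.distrib re)
        also have "\<dots> = complex_of_real (if i = j then 1 else 0)" unfolding 1(1) by (simp add: mat_def)
        finally show ?thesis by (simp only: of_real_eq_iff)
      qed
      have b: "(\<Sum>l\<in>UNIV. Re (Q $ i $ l) * Re (P $ j $ l) - Re (P $ i $ l) * Re (Q $ j $ l)) = 0"
      proof -
        have "complex_of_real (\<Sum>l\<in>UNIV. Re (Q $ i $ l) * Re (P $ j $ l) - Re (P $ i $ l) * Re (Q $ j $ l)) =
            (Q ** transpose P - P ** transpose Q) $ i $ j"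
          by (simp add: matrix_matrix_mult_def transpose_def sum_subtractf re)
        also have "\<dots> = complex_of_real 0" unfolding 1(2) by simp
        finally show ?thesis by (simp only: of_real_eq_iff)
      qed
      have "(u ** ctranspose u) $ i $ j = Complex
          (\<Sum>l\<in>UNIV. Re (P $ i $ l) * Re (P $ j $ l) + Re (Q $ i $ l) * Re (Q $ j $ l))
          (\<Sum>l\<in>UNIV. Re (Q $ i $ l) * Re (P $ j $ l) - Re (P $ i $ l) * Re (Q $ j $ l))"
        by (simp add: matrix_matrix_mult_def ctranspose_def transpose_def cnj_mat_def u_def complex_eq_iff)
      then show ?thesis unfolding a b by (simp add: mat_def complex_eq_iff)
    qed
    then show ?thesis by (simp add: unitary_mats_def vec_eq_iff)
  qed
  with ku show ?thesis using that by blast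
qed

lemma Un_embed_props:
  assumes "u \<in> unitary_mats"
  shows "cnj_mat (Un_embed u) = Un_embed u" "Un_embed u ** Jn = Jn ** Un_embed u"
    "Un_embed u ** transpose (Un_embed u) = mat 1"
proof -
  define x :: "complex^'a^'a" where "x = (\<chi> i j. complex_of_real (Re (u $ i $ j)))"
  define y :: "complex^'a^'a" where "y = (\<chi> i j. complex_of_real (Im (u $ i $ j)))"
  have emb: "Un_embed u = blocks x y (- y) x"
    by (simp add: Un_embed_def x_def y_def Let_def)
  have cx: "cnj_mat x = x" "cnj_mat y = y" by (simp_all add: cnj_mat_def x_def y_def vec_eq_iff)
  show "cnj_mat (Un_embed u) = Un_embed u"
    by (simp add: emb cnj_mat_blocks cx matrix_conv)
  show "Un_embed u ** Jn = Jn ** Un_embed u"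
    by (simp add: emb Jn_def blocks_mult matrix_ring)
  have k: "(\<Sum>l\<in>UNIV. u $ i $ l * cnj (u $ j $ l)) = (if i = j then 1 else 0)" for i j
    using assms unfolding unitary_mats_def
    by (auto simp: vec_eq_iff matrix_matrix_mult_def ctranspose_def cnj_mat_def transpose_def mat_def)
  have re: "(\<Sum>l\<in>UNIV. Re (u $ i $ l) * Re (u $ j $ l) + Im (u $ i $ l) * Im (u $ j $ l))
      = (if i = j then 1 else 0)" for i j
    using arg_cong[OF k[of i j], of Re] by (auto split: if_splits)
  have im: "(\<Sum>l\<in>UNIV. Im (u $ i $ l) * Re (u $ j $ l) - Re (u $ i $ l) * Im (u $ j $ l)) = 0"
    for i j
    using arg_cong[OF k[of i j], of Im] by (auto split: if_splits)
  have 1: "x ** transpose x + y ** transpose y = mat 1"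
    using arg_cong[OF re, of complex_of_real]
    by (auto simp: vec_eq_iff matrix_matrix_mult_def x_def y_def transpose_def mat_def sum.distrib)
  have 2: "y ** transpose x = x ** transpose y"
    using arg_cong[OF im, of complex_of_real]
    by (auto simp: vec_eq_iff matrix_matrix_mult_def x_def y_def transpose_def mat_def sum_subtractf)
  show "Un_embed u ** transpose (Un_embed u) = mat 1"
    using 1 2 by (simp add: emb transpose_blocks blocks_mult matrix_ring matrix_conv blocks_1[symmetric] add.commute)
qed

lemma one_unitary: "mat 1 \<in> unitary_mats"
  by (simp add: unitary_mats_def ctranspose_def)

lemma Un_embed_1: "Un_embed (mat 1) = mat 1"
  by (auto simp: vec_eq_iff Un_embed_def Let_def blocks_def mat_def split: sum.split)

lemma Un_embed_mult: "Un_embed (u ** v) = Un_embed u ** Un_embed v"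
proof -
  have "(\<chi> i j. complex_of_real (Re ((u ** v) $ i $ j))) =
      (\<chi> i j. complex_of_real (Re (u $ i $ j))) ** (\<chi> i j. complex_of_real (Re (v $ i $ j))) -
      (\<chi> i j. complex_of_real (Im (u $ i $ j))) ** (\<chi> i j. complex_of_real (Im (v $ i $ j)))"
    by (simp add: vec_eq_iff matrix_matrix_mult_def sum_subtractf)
  moreover have "(\<chi> i j. complex_of_real (Im ((u ** v) $ i $ j))) =
      (\<chi> i j. complex_of_real (Re (u $ i $ j))) ** (\<chi> i j. complex_of_real (Im (v $ i $ j))) +
      (\<chi> i j. complex_of_real (Im (u $ i $ j))) ** (\<chi> i j. complex_of_real (Re (v $ i $ j)))"
    by (simp add: vec_eq_iff matrix_matrix_mult_def sum.distrib)
  ultimately show ?thesis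
    unfolding Un_embed_def Let_def blocks_mult
    by (simp add: blocks_eq_iff matrix_ring add.commute)
qed

lemma unitary_mult: "u \<in> unitary_mats \<Longrightarrow> v \<in> unitary_mats \<Longrightarrow> u ** v \<in> unitary_mats"
  unfolding unitary_mats_def ctranspose_def
  by (simp add: matrix_conv matrix_mul_assoc)
    (metis matrix_mul_assoc matrix_mul_rid)

lemma unitary_inverse:
  assumes "u \<in> unitary_mats"
  obtains v where "v \<in> unitary_mats" "u ** v = mat 1"
proof -
  have 1: "u ** ctranspose u = mat 1" using assms by (simp add: unitary_mats_def)
  then have "ctranspose u ** u = mat 1" using matrix_left_right_inverse by blast
  then have "ctranspose u \<in> unitary_mats"
    by (simp add: unitary_mats_def ctranspose_def transpose_cnj_mat)
  with 1 show ?thesis using that by blast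
qed

lemma coset_Un_embed:
  assumes "u \<in> unitary_mats"
  shows "coset (z ** Un_embed u) = coset z"
proof -
  obtain v where v: "v \<in> unitary_mats" "u ** v = mat 1" using unitary_inverse[OF assms] .
  show ?thesis unfolding coset_def
  proof (intro equalityI image_subsetI)
    fix k :: "complex^'a^'a" assume k: "k \<in> unitary_mats"
    show "z ** Un_embed u ** Un_embed k \<in> (\<lambda>k. z ** Un_embed k) ` unitary_mats"
      using unitary_mult[OF assms k] by (metis Un_embed_mult image_eqI matrix_mul_assoc)
    have "z ** Un_embed k = z ** Un_embed u ** Un_embed (v ** k)"
      using v(2) by (metis Un_embed_mult matrix_mul_assoc matrix_mul_lid)
    then show "z ** Un_embed k \<in> (\<lambda>k. z ** Un_embed u ** Un_embed k) ` unitary_mats"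
      using unitary_mult[OF v(1) k] by blast
  qed
qed

lemma self_in_coset: "z \<in> coset z"
  unfolding coset_def using one_unitary Un_embed_1 by (metis image_eqI matrix_mul_rid)

text \<open>The complex structures agree exactly when \<open>transpose z ** w\<close> commutes with
  \<open>Jn\<close>, and for elements of \<open>SO_star\<close> commuting with \<open>Jn\<close>
  amounts to being real.\<close>

lemma coset_eq_iff:
  assumes z: "z \<in> SO_star" and w: "w \<in> SO_star"
  shows "coset z = coset w \<longleftrightarrow> cstr z = cstr w"
proof
  assume "coset z = coset w"
  then obtain u where u: "u \<in> unitary_mats" "w = z ** Un_embed u"
    using self_in_coset[of w] unfolding coset_def by auto
  show "cstr z = cstr w"
    unfolding cstr_def u(2) matrix_transpose_mul matrix_mul_assoc
    by (metis Un_embed_props(2,3)[OF u(1)] matrix_mul_assoc matrix_mul_rid)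
next
  assume e: "cstr z = cstr w"
  define k where "k = transpose z ** w"
  have k: "k \<in> SO_star" unfolding k_def using SO_star_mult transpose_SO_star z w by blast
  have zk: "w = z ** k" unfolding k_def by (simp add: matrix_mul_assoc SO_starD(1)[OF z])
  have "transpose z ** cstr z ** w = transpose z ** cstr w ** w" using e by simp
  then have "Jn ** k = k ** Jn"
    unfolding cstr_def k_def
    by (simp add: matrix_mul_assoc SO_starD(2,6)[OF z] SO_starD(2,6)[OF w])
  then have "cnj_mat k = k" using SO_starD(8)[OF k] by (simp add: Jn_Jn')
  then obtain u where u: "u \<in> unitary_mats" "k = Un_embed u" using real_SO_star_Un_embed[OF k] by blast
  show "coset z = coset w" unfolding zk u(2) using coset_Un_embed[OF u(1)] by simp
qed

section \<open>Tangent spaces\<close>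

lemma has_vector_derivative_chain:
  assumes "(c has_vector_derivative v) (at t)" "(F has_derivative F') (at (c t))"
  shows "((\<lambda>t. F (c t)) has_vector_derivative F' v) (at t)"
proof -
  have "((\<lambda>t. F (c t)) has_derivative (\<lambda>h. F' (h *\<^sub>R v))) (at t)"
    using has_derivative_compose[OF assms(1)[unfolded has_vector_derivative_def] assms(2)] .
  then show ?thesis
    unfolding has_vector_derivative_def
    using linear_cmul[OF has_derivative_linear[OF assms(2)]] by simp
qed

lemma has_vector_derivative_linear_map:
  "(c has_vector_derivative v) F \<Longrightarrow> bounded_linear L \<Longrightarrow> ((\<lambda>t. L (c t)) has_vector_derivative L v) F"
  by (rule bounded_linear.has_vector_derivative)

lemma has_vector_derivative_matrix_mult:
  fixes f g :: "real \<Rightarrow> complex^'m^'m"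
  assumes "(f has_vector_derivative f') (at t)" "(g has_vector_derivative g') (at t)"
  shows "((\<lambda>t. f t ** g t) has_vector_derivative (f t ** g' + f' ** g t)) (at t)"
  by (rule bounded_bilinear.has_vector_derivative[OF bounded_bilinear_matrix_mult assms])

lemma has_vector_derivative_eq_locally:
  assumes "(f has_vector_derivative a) (at t)" "(g has_vector_derivative b) (at t)"
    "open T" "t \<in> T" "\<And>s. s \<in> T \<Longrightarrow> f s = g s"
  shows "a = b"
proof -
  have "(g has_vector_derivative a) (at t)"
    using has_vector_derivative_transform_within_open[OF assms(1,3,4,5)] .
  then show ?thesis using assms(2) vector_derivative_at by blast
qed

text \<open>Inner products of the curve with vectors orthogonal to \<open>L\<close> are locally
  zero, so the velocity lies in the double complement, which is \<open>L\<close>.\<close>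

lemma has_vector_derivative_in_subspace:
  fixes c :: "real \<Rightarrow> 'a::euclidean_space"
  assumes L: "subspace L" and c: "(c has_vector_derivative v) (at t)"
    and T: "open T" "t \<in> T" "\<And>s. s \<in> T \<Longrightarrow> c s \<in> L"
  shows "v \<in> L"
proof -
  have "orthogonal u v" if u: "u \<in> orthogonal_comp L" for u
  proof -
    have 1: "((\<lambda>s. c s \<bullet> u) has_vector_derivative v \<bullet> u) (at t)"
      by (rule has_vector_derivative_linear_map[OF c bounded_linear_inner_left])
    have "v \<bullet> u = 0"
    proof (rule has_vector_derivative_eq_locally[OF 1 has_vector_derivative_const T(1,2)])
      fix s assume "s \<in> T"
      then show "c s \<bullet> u = 0" using u T(3) unfolding orthogonal_comp_def orthogonal_def by blast
    qed
    then show ?thesis by (simp add: orthogonal_def inner_commute)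
  qed
  then have "v \<in> orthogonal_comp (orthogonal_comp L)" unfolding orthogonal_comp_def[of "orthogonal_comp L"] by blast
  then show ?thesis using orthogonal_comp_self[OF L] by simp
qed

lemma curve_through_cayley:
  fixes z X :: "complex^'m^'m"
  assumes "\<And>t. t *\<^sub>R X \<in> cayley_dom \<Longrightarrow> z ** cayley (t *\<^sub>R X) \<in> S"
  shows "curve_through S (\<lambda>t. z ** cayley (t *\<^sub>R X)) z (2 *\<^sub>R (z ** X))"
proof -
  have "open ((\<lambda>t :: real. t *\<^sub>R X) -` cayley_dom)"
    by (rule open_vimage[OF open_cayley_dom]) (intro continuous_intros)
  moreover have "0 \<in> (\<lambda>t :: real. t *\<^sub>R X) -` cayley_dom" using zero_in_cayley_dom by simp
  ultimately obtain e where e: "e > 0" "ball 0 e \<subseteq> (\<lambda>t :: real. t *\<^sub>R X) -` cayley_dom"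
    using openE by blast
  have dom: "t *\<^sub>R X \<in> cayley_dom" if "t \<in> {-e<..<e}" for t
    using e(2) that by (auto simp: dist_real_def subset_iff)
  have o: "open {-e<..<e}" by simp
  have Ck: "Ck_on k {-e<..<e} (\<lambda>t. z ** cayley (t *\<^sub>R X))" for k
    by (intro Ck_on_matrix_mult Ck_on_const Ck_on_compose[OF o open_cayley_dom _ Ck_on_cayley]
        Ck_on_bounded_linear bounded_linear_scaleR_left o) (use dom in auto)
  have "smooth_on {-e<..<e} (\<lambda>t. z ** cayley (t *\<^sub>R X))"
    by (rule smooth_onI_open[OF o Ck]) auto
  moreover have "(\<lambda>t. z ** cayley (t *\<^sub>R X)) ` {-e<..<e} \<subseteq> S"
    using assms dom by blast
  moreover have "((\<lambda>t. z ** cayley (t *\<^sub>R X)) has_vector_derivative (2 *\<^sub>R (z ** X))) (at 0)"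
  proof -
    have "((\<lambda>t. t *\<^sub>R X) has_vector_derivative X) (at 0)"
      by (auto intro!: derivative_eq_intros simp: has_vector_derivative_def)
    then have "((\<lambda>t. cayley (t *\<^sub>R X)) has_vector_derivative 2 *\<^sub>R X) (at 0)"
      by (rule has_vector_derivative_chain) (simp add: cayley_has_derivative)
    from has_vector_derivative_matrix_mult[OF has_vector_derivative_const this, of z]
    show ?thesis by (simp add: matrix_ring)
  qed
  ultimately show ?thesis using e(1) by (auto simp: curve_through_def cayley_0)
qed

lemma so_alg_scaleR: "X \<in> so_alg \<Longrightarrow> r *\<^sub>R X \<in> so_alg"
  by (auto simp: so_alg_def matrix_conv matrix_ring)

lemma k_alg_scaleR: "X \<in> k_alg \<Longrightarrow> r *\<^sub>R X \<in> k_alg"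
  by (auto simp: k_alg_def matrix_conv matrix_ring)

lemma p_alg_scaleR: "X \<in> p_alg \<Longrightarrow> r *\<^sub>R X \<in> p_alg"
  using subspace_p_alg by (rule subspace_scale)

lemma curve_through_SO_star:
  assumes "z \<in> SO_star" "X \<in> so_alg"
  shows "curve_through SO_star (\<lambda>t. z ** cayley (t *\<^sub>R X)) z (2 *\<^sub>R (z ** X))"
  by (rule curve_through_cayley)
    (use assms SO_star_mult cayley_SO_star so_alg_scaleR in blast)

lemma curve_through_coset:
  assumes "X \<in> k_alg"
  shows "curve_through (coset z) (\<lambda>t. z ** cayley (t *\<^sub>R X)) z (2 *\<^sub>R (z ** X))"
proof (rule curve_through_cayley)
  fix t :: real assume d: "t *\<^sub>R X \<in> cayley_dom"
  have k: "t *\<^sub>R X \<in> k_alg" using assms k_alg_scaleR by blast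
  obtain u where "u \<in> unitary_mats" "cayley (t *\<^sub>R X) = Un_embed u"
    using real_SO_star_Un_embed[of "cayley (t *\<^sub>R X)"] cayley_SO_star[OF k_alg_so_alg[OF k] d]
      cnj_mat_cayley[OF _ d] k unfolding k_alg_def by blast
  then show "z ** cayley (t *\<^sub>R X) \<in> coset z" by (simp add: coset_def)
qed

lemma curve_SO_star_derivative:
  assumes c: "(c has_vector_derivative v) (at t0)" and T: "open T" "t0 \<in> T"
    and S: "\<And>t. t \<in> T \<Longrightarrow> c t \<in> SO_star"
  shows "transpose (c t0) ** v \<in> so_alg"
proof -
  let ?z = "c t0"
  have z: "?z \<in> SO_star" using S T by blast
  have tc: "((\<lambda>t. transpose (c t)) has_vector_derivative transpose v) (at t0)"
    by (rule has_vector_derivative_linear_map[OF c bounded_linear_transpose])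
  have cc: "((\<lambda>t. cnj_mat (c t)) has_vector_derivative cnj_mat v) (at t0)"
    by (rule has_vector_derivative_linear_map[OF c bounded_linear_cnj_mat])
  have 1: "transpose ?z ** v + transpose v ** ?z = 0"
    by (rule has_vector_derivative_eq_locally[OF has_vector_derivative_matrix_mult[OF tc c]
          has_vector_derivative_const[of "mat 1"] T])
      (use SO_starD(2) S in blast)
  have 2: "cnj_mat v ** Jn = Jn ** v"
  proof -
    have "cnj_mat ?z ** 0 + cnj_mat v ** Jn = Jn ** v + 0 ** ?z"
      by (rule has_vector_derivative_eq_locally[OF
            has_vector_derivative_matrix_mult[OF cc has_vector_derivative_const]
            has_vector_derivative_matrix_mult[OF has_vector_derivative_const c] T])
        (use SO_starD(4) S in blast)
    then show ?thesis by simp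
  qed
  have t: "cnj_mat (transpose ?z) ** Jn = Jn ** transpose ?z"
    using SO_starD(4)[OF transpose_SO_star[OF z]] .
  have "cnj_mat (transpose ?z ** v) ** Jn = cnj_mat (transpose ?z) ** (cnj_mat v ** Jn)"
    by (simp add: cnj_mat_mult matrix_mul_assoc)
  also have "\<dots> = Jn ** (transpose ?z ** v)"
    unfolding 2 using t by (simp add: matrix_mul_assoc)
  finally show ?thesis using 1
    unfolding so_alg_def by (simp add: matrix_conv eq_neg_iff_add_eq_0 add.commute)
qed

lemma tangent_space_SO_star:
  assumes z: "z \<in> SO_star"
  shows "tangent_space SO_star z = (\<lambda>X. z ** X) ` so_alg"
proof (intro equalityI subsetI)
  fix v assume "v \<in> tangent_space SO_star z"
  then obtain c e where c: "e > 0" "c ` {-e<..<e} \<subseteq> SO_star" "c 0 = z"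
      "(c has_vector_derivative v) (at 0)"
    unfolding tangent_space_def curve_through_def by blast
  have "transpose (c 0) ** v \<in> so_alg"
    by (rule curve_SO_star_derivative[OF c(4), of "{-e<..<e}"]) (use c in auto)
  moreover have "v = z ** (transpose z ** v)"
    by (simp add: matrix_mul_assoc SO_starD(1)[OF z])
  ultimately show "v \<in> (\<lambda>X. z ** X) ` so_alg" using c(3) by blast
next
  fix v assume "v \<in> (\<lambda>X. z ** X) ` so_alg"
  then obtain X where X: "X \<in> so_alg" "v = z ** X" by blast
  have "curve_through SO_star (\<lambda>t. z ** cayley (t *\<^sub>R ((1/2) *\<^sub>R X))) z (2 *\<^sub>R (z ** ((1/2) *\<^sub>R X)))"
    by (rule curve_through_SO_star[OF z so_alg_scaleR[OF X(1)]])
  then show "v \<in> tangent_space SO_star z"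
    unfolding tangent_space_def X(2) by (auto simp: matrix_ring)
qed

lemma GL_metric_SO_star:
  assumes "z \<in> SO_star"
  shows "GL_metric z (z ** X) (z ** Y) = X \<bullet> Y"
  unfolding GL_metric_def inner_mat_eq
  by (simp add: SO_starD(7)[OF assms] matrix_mul_assoc SO_starD(2)[OF assms])

lemma inner_cnj_mat: "cnj_mat A \<bullet> cnj_mat B = A \<bullet> B"
  by (simp add: inner_vec_def inner_complex_def cnj_mat_def)

lemma inner_imaginary_real:
  assumes "cnj_mat A = - A" "cnj_mat B = B"
  shows "A \<bullet> B = 0"
  using inner_cnj_mat[of A B] assms by simp

text \<open>The fibre through \<open>z\<close> consists of \<open>z\<close> times real matrices, and
  so do the velocities of its curves. Enough vertical vectors for the opposite direction come from
  \<open>curve_through_coset\<close>.\<close>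

lemma tangent_space_coset_real:
  assumes z: "z \<in> SO_star" and V: "V \<in> tangent_space (coset z) z"
  shows "cnj_mat (transpose z ** V) = transpose z ** V"
proof -
  obtain c e where c: "e > 0" "c ` {-e<..<e} \<subseteq> coset z" "c 0 = z"
      "(c has_vector_derivative V) (at 0)"
    using V unfolding tangent_space_def curve_through_def by blast
  have 1: "((\<lambda>t. transpose z ** c t) has_vector_derivative (transpose z ** V + 0 ** c 0)) (at 0)"
    by (rule has_vector_derivative_matrix_mult[OF has_vector_derivative_const c(4)])
  have 2: "((\<lambda>t. cnj_mat (transpose z ** c t)) has_vector_derivative
      cnj_mat (transpose z ** V + 0 ** c 0)) (at 0)"
    by (rule has_vector_derivative_linear_map[OF 1 bounded_linear_cnj_mat])
  have "cnj_mat (transpose z ** V + 0 ** c 0) = transpose z ** V + 0 ** c 0"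
  proof (rule has_vector_derivative_eq_locally[OF 2 1, of "{-e<..<e}"])
    fix s assume "s \<in> {-e<..<e}"
    then have "c s \<in> coset z" using c(2) by blast
    then obtain u where u: "u \<in> unitary_mats" "c s = z ** Un_embed u" unfolding coset_def by blast
    have "transpose z ** c s = Un_embed u"
      unfolding u(2) by (simp add: matrix_mul_assoc SO_starD(2)[OF z])
    then show "cnj_mat (transpose z ** c s) = transpose z ** c s" using Un_embed_props(1)[OF u(1)] by simp
  qed (use c in auto)
  then show ?thesis by simp
qed

text \<open>Real and purely imaginary matrices are orthogonal for the real inner product, and left
  translation reduces the metric to that product.\<close>

lemma horizontal_space_eq:
  assumes z: "z \<in> SO_star"
  shows "horizontal_space z = (\<lambda>X. z ** X) ` p_alg"
proof (intro equalityI subsetI)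
  fix v assume "v \<in> (\<lambda>X. z ** X) ` p_alg"
  then obtain Y where Y: "Y \<in> p_alg" "v = z ** Y" by blast
  have "GL_metric z v V = 0" if V: "V \<in> tangent_space (coset z) z" for V
  proof -
    have "GL_metric z (z ** Y) (z ** (transpose z ** V)) = Y \<bullet> (transpose z ** V)"
      by (rule GL_metric_SO_star[OF z])
    also have "\<dots> = 0"
      by (rule inner_imaginary_real) (use Y tangent_space_coset_real[OF z V] in \<open>auto simp: p_alg_def\<close>)
    finally show ?thesis unfolding Y(2) by (simp add: matrix_mul_assoc SO_starD(1)[OF z])
  qed
  then show "v \<in> horizontal_space z"
    unfolding horizontal_space_def tangent_space_SO_star[OF z] using Y p_alg_so_alg by blast
next
  fix v assume v: "v \<in> horizontal_space z"
  then obtain X where X: "X \<in> so_alg" "v = z ** X"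
    unfolding horizontal_space_def tangent_space_SO_star[OF z] by blast
  \<comment> \<open>\<open>K\<close> is twice the real part of \<open>X\<close>, and
    \<open>z ** K\<close> is vertical. Conjugation preserves the inner product, so
    \<open>X \<bullet> K = 0\<close> gives \<open>cnj_mat X \<bullet> K = 0\<close>, and the two add
    up to \<open>K \<bullet> K = 0\<close>.\<close>
  define K where "K = X + cnj_mat X"
  have K: "K \<in> k_alg" unfolding K_def by (rule so_alg_k_part[OF X(1)])
  have "2 *\<^sub>R (z ** K) \<in> tangent_space (coset z) z"
    using curve_through_coset[OF K] unfolding tangent_space_def by blast
  then have "GL_metric z v (2 *\<^sub>R (z ** K)) = 0" using v unfolding horizontal_space_def by blast
  then have "GL_metric z (z ** X) (z ** (2 *\<^sub>R K)) = 0" unfolding X(2) by (simp add: matrix_ring)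
  then have XK: "X \<bullet> K = 0" unfolding GL_metric_SO_star[OF z] by simp
  have "cnj_mat X \<bullet> K = X \<bullet> K" using inner_cnj_mat[of X K] K by (simp add: k_alg_def)
  then have "K \<bullet> K = 0" using XK unfolding K_def by (simp add: inner_add_left)
  then have "cnj_mat X = - X" unfolding K_def by (simp add: eq_neg_iff_add_eq_0 add.commute)
  then have "X = (1/2) *\<^sub>R (X - cnj_mat X)" by (simp add: scaleR_2[symmetric])
  then have "X \<in> p_alg" using p_alg_scaleR so_alg_p_part[OF X(1)] by metis
  then show "v \<in> (\<lambda>X. z ** X) ` p_alg" using X(2) by blast
qed

lemma SOU_model_eq: "SOU_model = p_alg"
  unfolding SOU_model_def horizontal_space_eq[OF one_SO_star] by simp

text \<open>The tangent space at \<Phi> of the orbit of complex structures: its equations are the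
  derivatives of skewness, of the reality condition and of
  \<open>\<Phi> ** \<Phi> = - mat 1\<close>. At \<open>cstr z\<close> it is \<open>p_alg\<close>
  conjugated by \<open>z\<close>.\<close>

definition ctang :: "('n::finite) cmat2 \<Rightarrow> 'n cmat2 set" where
  "ctang \<Phi> = {A. transpose A = - A \<and> cnj_mat A = - (Jn ** A ** Jn) \<and> A ** \<Phi> = - (\<Phi> ** A)}"

lemma ctang_p_alg:
  assumes z: "z \<in> SO_star" and A: "A \<in> ctang (cstr z)"
  shows "transpose z ** A ** z \<in> p_alg"
proof -
  have 1: "transpose A = - A" "cnj_mat A = - (Jn ** A ** Jn)" "A ** cstr z = - (cstr z ** A)"
    using A by (auto simp: ctang_def)
  have J: "transpose z ** A ** z ** Jn = - (Jn ** (transpose z ** A ** z))"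
  proof -
    have "transpose z ** (A ** cstr z) ** z = transpose z ** (- (cstr z ** A)) ** z" using 1(3) by simp
    then show ?thesis
      unfolding cstr_def by (simp add: matrix_ring SO_starD(2,6)[OF z])
  qed
  have "cnj_mat (transpose z ** A ** z) = Jn ** transpose z ** Jn ** - (Jn ** A ** Jn) ** Jn ** z ** Jn"
    using SO_starD(8)[OF z] SO_starD(8)[OF transpose_SO_star[OF z]] 1(2)
    by (simp add: cnj_mat_mult matrix_ring)
  also have "\<dots> = - (Jn ** (transpose z ** A ** z) ** Jn)"
    by (simp add: matrix_ring Jn_Jn')
  also have "\<dots> = transpose z ** A ** z ** Jn ** Jn" using J by (simp add: matrix_ring)
  also have "\<dots> = - (transpose z ** A ** z)" by (rule Jn_Jn')
  finally show ?thesis using J 1(1) by (simp add: p_alg_def matrix_conv matrix_ring)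
qed

lemma p_alg_ctang:
  assumes z: "z \<in> SO_star" and Y: "Y \<in> p_alg"
  shows "z ** Y ** transpose z \<in> ctang (cstr z)"
proof -
  have 1: "transpose Y = - Y" "cnj_mat Y = - Y" "Y ** Jn = - (Jn ** Y)" using Y by (auto simp: p_alg_def)
  have c: "z ** Y ** transpose z ** cstr z = - (cstr z ** (z ** Y ** transpose z))"
  proof -
    have "z ** Y ** transpose z ** cstr z = z ** (Y ** Jn) ** transpose z"
      unfolding cstr_def by (simp add: matrix_mul_assoc SO_starD(6)[OF z])
    also have "\<dots> = - (cstr z ** (z ** Y ** transpose z))"
      unfolding cstr_def 1(3) by (simp add: matrix_ring SO_starD(6)[OF z])
    finally show ?thesis .
  qed
  have "cnj_mat (z ** Y ** transpose z) = Jn ** z ** Jn ** (- Y) ** Jn ** transpose z ** Jn"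
    using SO_starD(8)[OF z] SO_starD(8)[OF transpose_SO_star[OF z]] 1(2)
    by (simp add: cnj_mat_mult matrix_ring)
  also have "\<dots> = - (Jn ** z ** (Jn ** Y) ** Jn ** transpose z ** Jn)" by (simp add: matrix_ring)
  also have "Jn ** Y = - (Y ** Jn)" using 1(3) by simp
  also have "- (Jn ** z ** - (Y ** Jn) ** Jn ** transpose z ** Jn) = - (Jn ** (z ** Y ** transpose z) ** Jn)"
    by (simp add: matrix_ring Jn_Jn')
  finally show ?thesis using c 1(1) by (simp add: ctang_def matrix_conv matrix_ring)
qed

lemma ctang_conj:
  assumes z: "z \<in> SO_star"
  shows "A = z ** (transpose z ** A ** z) ** transpose z"
  by (simp add: matrix_mul_assoc SO_starD(1)[OF z] SO_starD(5)[OF z])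

lemma subspace_ctang: "subspace (ctang \<Phi>)"
  unfolding subspace_def ctang_def by (auto simp: matrix_conv matrix_ring)

text \<open>Left multiplication by \<open>Jn\<close> is the complex structure of
  \<open>p_alg\<close>. It translates between a horizontal velocity and the resulting velocity of
  \<Phi>.\<close>

lemma Jn_p_alg: "Y \<in> p_alg \<Longrightarrow> Jn ** Y \<in> p_alg"
proof -
  assume "Y \<in> p_alg"
  then have 1: "transpose Y = - Y" "cnj_mat Y = - Y" and 2: "Y ** Jn = - (Jn ** Y)" by (auto simp: p_alg_def)
  have "Jn ** Y ** Jn = Jn ** (Y ** Jn)" by (simp add: matrix_mul_assoc)
  also have "\<dots> = - (Jn ** (Jn ** Y))" unfolding 2 by (simp add: matrix_ring)
  finally show "Jn ** Y \<in> p_alg"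
    using 1 2 by (simp add: p_alg_def matrix_conv matrix_ring transpose_Jn cnj_mat_Jn)
qed

text \<open>A skew and purely imaginary matrix is Hermitian, so no conjugation remains in the trace
  form.\<close>

lemma Re_trace_p_alg:
  assumes "Y \<in> p_alg"
  shows "Re (trace (X ** Y)) = X \<bullet> Y"
proof -
  have "ctranspose Y = Y" using assms by (simp add: p_alg_def ctranspose_def matrix_conv)
  then show ?thesis by (simp add: inner_mat_eq)
qed

lemma Re_trace_ctang:
  assumes z: "z \<in> SO_star" and A: "A \<in> ctang (cstr z)"
  shows "Re (trace (B ** A)) = (transpose z ** B ** z) \<bullet> (transpose z ** A ** z)"
proof -
  have "trace (transpose z ** B ** z ** (transpose z ** A ** z)) = trace ((transpose z ** B) ** A ** z)"
    by (simp add: matrix_mul_assoc SO_starD(5)[OF z])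
  also have "\<dots> = trace (z ** transpose z ** B ** A)"
    using trace_mul_sym[of "transpose z ** B ** A" z] by (simp add: matrix_mul_assoc)
  finally show ?thesis
    using Re_trace_p_alg[OF ctang_p_alg[OF z A], of "transpose z ** B ** z"] by (simp add: SO_starD(1)[OF z])
qed

text \<open>Writing \<open>X\<close> for \<open>transpose (c t0) ** v\<close>, the derivative is the
  conjugated commutator of \<open>X\<close> with \<open>Jn\<close>, and \<open>so_alg_cnj\<close>
  shows that only the imaginary part of \<open>X\<close> enters. For \<open>X\<close> in
  \<open>p_alg\<close> the middle factor is \<open>- 2 Jn X\<close>, the source of the quarter in
  the metric.\<close>

lemma cstr_has_vector_derivative:
  assumes c: "(c has_vector_derivative v) (at t0)" and z: "c t0 \<in> SO_star"
    and X: "transpose (c t0) ** v \<in> so_alg"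
  shows "((\<lambda>t. cstr (c t)) has_vector_derivative
    c t0 ** (- (Jn ** (transpose (c t0) ** v - cnj_mat (transpose (c t0) ** v)))) ** transpose (c t0)) (at t0)"
proof -
  define X' where "X' = transpose (c t0) ** v"
  have v: "v = c t0 ** X'" unfolding X'_def by (simp add: matrix_mul_assoc SO_starD(1)[OF z])
  have tc: "((\<lambda>t. transpose (c t)) has_vector_derivative transpose v) (at t0)"
    by (rule has_vector_derivative_linear_map[OF c bounded_linear_transpose])
  have d: "((\<lambda>t. c t ** Jn ** transpose (c t)) has_vector_derivative
      (c t0 ** Jn ** transpose v + (c t0 ** 0 + v ** Jn) ** transpose (c t0))) (at t0)"
    by (intro has_vector_derivative_matrix_mult c tc has_vector_derivative_const)
  have t: "transpose X' = - X'" using X unfolding X'_def so_alg_def by simp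
  have J: "X' ** Jn = Jn ** cnj_mat X'" using so_alg_cnj(2)[OF X] unfolding X'_def .
  have "c t0 ** Jn ** transpose v + (c t0 ** 0 + v ** Jn) ** transpose (c t0) =
     c t0 ** (X' ** Jn - Jn ** X') ** transpose (c t0)"
    unfolding v by (simp add: matrix_conv t matrix_ring)
  also have "\<dots> = c t0 ** (- (Jn ** (X' - cnj_mat X'))) ** transpose (c t0)"
    unfolding J by (simp add: matrix_ring)
  finally show ?thesis using d unfolding cstr_def X'_def[symmetric] by simp
qed

section \<open>Charts of the symmetric space\<close>

definition coset_cstr :: "('n::finite) cmat2 set \<Rightarrow> 'n cmat2" where
  "coset_cstr p = cstr (SOME z. z \<in> SO_star \<and> p = coset z)"

lemma coset_cstr_coset:
  assumes "z \<in> SO_star"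
  shows "coset_cstr (coset z) = cstr z"
proof -
  define w where "w = (SOME w. w \<in> SO_star \<and> coset z = coset w)"
  have "w \<in> SO_star \<and> coset z = coset w"
    unfolding w_def by (rule someI[of _ z]) (use assms in simp)
  then show ?thesis unfolding coset_cstr_def w_def[symmetric] using coset_eq_iff[OF assms] by metis
qed

text \<open>\<open>S\<close> is smooth on an open set of all matrices, so ordinary Frechet
  derivatives apply, while the section equations are imposed only on the model space
  \<open>p_alg\<close>.\<close>

definition local_section :: "('n::finite) cmat2 set set \<Rightarrow> ('n cmat2 set \<Rightarrow> 'n cmat2) \<Rightarrow>
    'n cmat2 set \<Rightarrow> ('n cmat2 \<Rightarrow> 'n cmat2) \<Rightarrow> bool" where
  "local_section U x W S \<longleftrightarrow> open W \<and> (\<forall>k. Ck_on k W S) \<and>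
     (\<forall>r\<in>p_alg \<inter> W. S r \<in> SO_star \<and> coset (S r) \<in> U \<and> x (coset (S r)) = r)"

lemma local_sectionD:
  assumes "local_section U x W S"
  shows "open W" "Ck_on k W S"
    "r \<in> p_alg \<Longrightarrow> r \<in> W \<Longrightarrow> S r \<in> SO_star"
    "r \<in> p_alg \<Longrightarrow> r \<in> W \<Longrightarrow> coset (S r) \<in> U"
    "r \<in> p_alg \<Longrightarrow> r \<in> W \<Longrightarrow> x (coset (S r)) = r"
  using assms unfolding local_section_def by auto

lemma SOU_atlasD:
  fixes U :: "('n::finite) cmat2 set set"
  assumes "(U, x) \<in> SOU_atlas"
  shows "U \<subseteq> SOU" "inj_on x U" "openin (top_of_set SO_star) {z \<in> SO_star. coset z \<in> U}"
    "openin (top_of_set p_alg) (x ` U)" "smooth_on {z \<in> SO_star. coset z \<in> U} (x \<circ> coset)"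
    "p \<in> U \<Longrightarrow> x p \<in> p_alg"
proof -
  show 1: "U \<subseteq> SOU" "inj_on x U" "openin (top_of_set SO_star) {z \<in> SO_star. coset z \<in> U}"
    "openin (top_of_set p_alg) (x ` U)" "smooth_on {z \<in> SO_star. coset z \<in> U} (x \<circ> coset)"
    using assms unfolding SOU_atlas_def SOU_model_eq by auto
  show "p \<in> U \<Longrightarrow> x p \<in> p_alg" using openin_imp_subset[OF 1(4)] by blast
qed

lemma local_section_exists:
  assumes A: "(U, x) \<in> SOU_atlas" and q: "q \<in> x ` U"
  obtains W S where "q \<in> W" "local_section U x W S"
proof -
  have "\<forall>q\<in>x ` U. \<exists>V s. q \<in> V \<and> V \<subseteq> x ` U \<and> openin (top_of_set p_alg) V \<and> smooth_on V s \<and>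
      (\<forall>r\<in>V. s r \<in> SO_star \<and> coset (s r) \<in> U \<and> x (coset (s r)) = r)"
    using A unfolding SOU_atlas_def SOU_model_eq by simp
  from bspec[OF this q]
  obtain V s where V: "q \<in> V" "V \<subseteq> x ` U" "openin (top_of_set p_alg) V" "smooth_on V s"
    "\<forall>r\<in>V. s r \<in> SO_star \<and> coset (s r) \<in> U \<and> x (coset (s r)) = r"
    by (elim exE conjE) (rule that)
  obtain W F where W: "open W" "q \<in> W" "\<forall>k. Ck_on k W F" "\<forall>r\<in>V \<inter> W. F r = s r"
    by (rule smooth_onE[OF V(4,1)])
  obtain T where T: "open T" "V = p_alg \<inter> T" using V(3) by (auto simp: openin_open)
  have "local_section U x (W \<inter> T) F"
    unfolding local_section_def
  proof (intro conjI allI ballI)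
    show "open (W \<inter> T)" using W T by blast
    show "Ck_on k (W \<inter> T) F" for k using Ck_on_subset[of k W F "W \<inter> T"] W(3) by blast
    fix r assume "r \<in> p_alg \<inter> (W \<inter> T)"
    then have "r \<in> V" "F r = s r" using T(2) W(4) by auto
    then show "F r \<in> SO_star" "coset (F r) \<in> U" "x (coset (F r)) = r" using V(5) by auto
  qed
  then show ?thesis using that[of "W \<inter> T" F] W(2) V(1) T(2) by blast
qed

text \<open>Besides extending the chart smoothly to matrices near \<open>z\<close>, the
  neighbourhood is shrunk until all its group elements project into \<open>U\<close>.\<close>

lemma chart_lift_exists:
  assumes A: "(U, x) \<in> SOU_atlas" and z: "z \<in> SO_star" "coset z \<in> U"
  obtains W H where "open W" "z \<in> W" "\<forall>k. Ck_on k W H"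
    "\<forall>w\<in>SO_star \<inter> W. coset w \<in> U \<and> H w = x (coset w)"
proof -
  let ?Z = "{z \<in> SO_star. coset z \<in> U}"
  have z': "z \<in> ?Z" using z by simp
  obtain W H where W: "open W" "z \<in> W" "\<forall>k. Ck_on k W H" "\<forall>w\<in>?Z \<inter> W. H w = (x \<circ> coset) w"
    by (rule smooth_onE[OF SOU_atlasD(5)[OF A] z'])
  obtain T where T: "open T" "?Z = SO_star \<inter> T"
    using SOU_atlasD(3)[OF A] by (auto simp: openin_open)
  show ?thesis
  proof (rule that[of "W \<inter> T" H])
    show "open (W \<inter> T)" using W T by blast
    show "z \<in> W \<inter> T" using W(2) z' T(2) by blast
    show "\<forall>k. Ck_on k (W \<inter> T) H" using Ck_on_subset W(3) by blast
    show "\<forall>w\<in>SO_star \<inter> (W \<inter> T). coset w \<in> U \<and> H w = x (coset w)"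
    proof
      fix w assume "w \<in> SO_star \<inter> (W \<inter> T)"
      then have "w \<in> ?Z \<inter> W" using T(2) by blast
      then show "coset w \<in> U \<and> H w = x (coset w)" using W(4) by simp
    qed
  qed
qed

text \<open>The last conclusion says that vertical velocities are invisible in the chart. It holds
  because the extension \<open>H\<close> has the same derivative along every curve with velocity
  \<open>v\<close>, so \<open>c\<close> may be exchanged for a Cayley curve inside one fibre, along
  which \<open>H\<close> is constant.\<close>

lemma chart_curve_derivative:
  assumes A: "(U, x) \<in> SOU_atlas"
    and c: "(c has_vector_derivative v) (at t0)" and T: "open T" "t0 \<in> T"
    and S: "\<And>t. t \<in> T \<Longrightarrow> c t \<in> SO_star" and U: "coset (c t0) \<in> U"
  obtains T' d where "open T'" "t0 \<in> T'" "T' \<subseteq> T" "\<forall>t\<in>T'. coset (c t) \<in> U" "d \<in> p_alg"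
    "((\<lambda>t. x (coset (c t))) has_vector_derivative d) (at t0)"
    "transpose (c t0) ** v \<in> k_alg \<longrightarrow> d = 0"
proof -
  let ?z = "c t0"
  have z: "?z \<in> SO_star" using S T by blast
  obtain W H where W: "open W" "?z \<in> W" "\<forall>k. Ck_on k W H"
    and H: "\<forall>w\<in>SO_star \<inter> W. coset w \<in> U \<and> H w = x (coset w)"
    by (rule chart_lift_exists[OF A z U])
  have dH: "(H has_derivative frechet_derivative H (at ?z)) (at ?z)"
    using Ck_on_has_derivative[OF W(1) _ W(2)] W(3) by blast
  have near: "\<exists>T'. open T' \<and> s0 \<in> T' \<and> T' \<subseteq> R \<and> (\<forall>t\<in>T'. w t \<in> W)"
    if w: "(w has_vector_derivative u) (at s0)" "open R" "s0 \<in> R" "w s0 \<in> W" for w u s0 R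
  proof -
    have "isCont w s0" using has_vector_derivative_continuous[OF w(1)] .
    then obtain B where "open B" "s0 \<in> B" "\<forall>t\<in>B. w t \<in> W"
      using W(1) w(4) continuous_at_open by metis
    then show ?thesis using w(2,3) by (intro exI[of _ "B \<inter> R"]) auto
  qed
  obtain T' where T': "open T'" "t0 \<in> T'" "T' \<subseteq> T" "\<forall>t\<in>T'. c t \<in> W"
    using near[OF c T W(2)] by blast
  define d where "d = frechet_derivative H (at ?z) v"
  have "((\<lambda>t. H (c t)) has_vector_derivative d) (at t0)"
    unfolding d_def by (rule has_vector_derivative_chain[OF c dH])
  then have D: "((\<lambda>t. x (coset (c t))) has_vector_derivative d) (at t0)"
    by (rule has_vector_derivative_transform_within_open[OF _ T'(1,2)]) (use H T' S in blast)
  have inU: "\<forall>t\<in>T'. coset (c t) \<in> U" using H T' S by blast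
  have "d \<in> p_alg"
    by (rule has_vector_derivative_in_subspace[OF subspace_p_alg D T'(1,2)])
      (use inU SOU_atlasD(6)[OF A] in blast)
  moreover have "d = 0" if k: "transpose ?z ** v \<in> k_alg"
  proof -
    define K where "K = (1/2) *\<^sub>R (transpose ?z ** v)"
    have K: "K \<in> k_alg" unfolding K_def by (rule k_alg_scaleR[OF k])
    have v: "2 *\<^sub>R (?z ** K) = v" unfolding K_def by (simp add: matrix_ring SO_starD(1)[OF z])
    let ?w = "\<lambda>t. ?z ** cayley (t *\<^sub>R K)"
    have cw: "curve_through (coset ?z) ?w ?z v"
      using curve_through_coset[OF K, of ?z] unfolding v .
    have cs: "curve_through SO_star ?w ?z v"
      using curve_through_SO_star[OF z k_alg_so_alg[OF K]] unfolding v .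
    obtain e1 where e1: "e1 > 0" "?w ` {-e1<..<e1} \<subseteq> coset ?z"
      using cw unfolding curve_through_def by blast
    obtain e2 where e2: "e2 > 0" "?w ` {-e2<..<e2} \<subseteq> SO_star"
      using cs unfolding curve_through_def by blast
    have dw: "(?w has_vector_derivative v) (at 0)" and w0: "?w 0 = ?z"
      using cw unfolding curve_through_def by blast+
    let ?R = "{-e1<..<e1} \<inter> {-e2<..<e2}"
    have R: "open ?R" "0 \<in> ?R" using e1(1) e2(1) by auto
    have "?w 0 \<in> W" using w0 W(2) by simp
    then obtain B where B: "open B" "0 \<in> B" "B \<subseteq> ?R" "\<forall>t\<in>B. ?w t \<in> W"
      using near[OF dw R] by blast
    have 1: "((\<lambda>t. H (?w t)) has_vector_derivative d) (at 0)"
      unfolding d_def by (rule has_vector_derivative_chain[OF dw]) (use dH w0 in simp)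
    show "d = 0"
    proof (rule has_vector_derivative_eq_locally[OF 1 has_vector_derivative_const B(1,2)])
      fix s assume s: "s \<in> B"
      then have w: "?w s \<in> SO_star" "?w s \<in> coset ?z" "?w s \<in> W"
        using B e1(2) e2(2) by blast+
      then obtain u where "u \<in> unitary_mats" "?w s = ?z ** Un_embed u" unfolding coset_def by blast
      then have "coset (?w s) = coset ?z" using coset_Un_embed by metis
      then show "H (?w s) = x (coset ?z)" using H w by (metis IntI)
    qed
  qed
  ultimately show ?thesis using that[OF T'(1-3) inU _ D] by blast
qed

lemma Ck_on_cstr:
  assumes "open W" "Ck_on k W S"
  shows "Ck_on k W (\<lambda>r. cstr (S r))"
  unfolding cstr_def
  by (intro Ck_on_matrix_mult Ck_on_const Ck_on_linear[OF _ bounded_linear_transpose] assms)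

locale sou_section =
  fixes U :: "('n::finite) cmat2 set set" and x W S
  assumes atlas: "(U, x) \<in> SOU_atlas" and sec: "local_section U x W S"
begin

text \<open>On \<open>p_alg\<close> the values do not depend on the choice of the section, so along
  \<open>p_alg\<close> the derivative \<open>D\<close> is the differential of the embedding of the
  quotient into matrices.\<close>

definition "F = (\<lambda>r. cstr (S r))"
definition "D r = frechet_derivative F (at r)"

lemma open_W: "open W" using local_sectionD(1)[OF sec] .

lemma Ck_F: "Ck_on k W F"
  unfolding F_def by (rule Ck_on_cstr[OF open_W local_sectionD(2)[OF sec]])

lemma F_has_derivative: "r \<in> W \<Longrightarrow> (F has_derivative D r) (at r)"
  unfolding D_def by (rule Ck_on_has_derivative[OF open_W Ck_F])

lemma linear_D: "r \<in> W \<Longrightarrow> linear (D r)"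
  by (rule has_derivative_linear[OF F_has_derivative])

lemma line_near:
  assumes "r \<in> W" "r \<in> p_alg" "v \<in> p_alg"
  obtains T where "open T" "(0::real) \<in> T" "\<forall>t\<in>T. r + t *\<^sub>R v \<in> W \<and> r + t *\<^sub>R v \<in> p_alg"
proof -
  have "open ((\<lambda>t::real. r + t *\<^sub>R v) -` W)"
    by (rule open_vimage[OF open_W]) (intro continuous_intros)
  moreover have "r + t *\<^sub>R v \<in> p_alg" for t
    using assms by (intro subspace_add[OF subspace_p_alg] p_alg_scaleR)
  ultimately show ?thesis
    using that[of "(\<lambda>t::real. r + t *\<^sub>R v) -` W"] assms(1) by simp
qed

lemma line_derivative: "((\<lambda>t. r + t *\<^sub>R v) has_vector_derivative v) (at t)"
  by (auto intro!: derivative_eq_intros simp: has_vector_derivative_def)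

lemma section_line:
  assumes r: "r \<in> W" "r \<in> p_alg" "v \<in> p_alg"
  obtains T X where "open T" "(0::real) \<in> T" "\<forall>t\<in>T. S (r + t *\<^sub>R v) \<in> SO_star"
    "((\<lambda>t. S (r + t *\<^sub>R v)) has_vector_derivative S r ** X) (at 0)" "X \<in> so_alg"
    "D r v = S r ** (- (Jn ** (X - cnj_mat X))) ** transpose (S r)"
proof -
  obtain T where T: "open T" "(0::real) \<in> T" "\<forall>t\<in>T. r + t *\<^sub>R v \<in> W \<and> r + t *\<^sub>R v \<in> p_alg"
    by (rule line_near[OF r])
  let ?c = "\<lambda>t. S (r + t *\<^sub>R v)"
  have cS: "?c t \<in> SO_star" if "t \<in> T" for t using local_sectionD(3)[OF sec] T(3) that by blast
  have z: "S r \<in> SO_star" using local_sectionD(3)[OF sec] r by blast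
  define u where "u = frechet_derivative S (at r) v"
  have dS: "(S has_derivative frechet_derivative S (at r)) (at (r + 0 *\<^sub>R v))"
    using Ck_on_has_derivative[OF open_W local_sectionD(2)[OF sec] r(1)] by simp
  have dc: "(?c has_vector_derivative u) (at 0)"
    unfolding u_def by (rule has_vector_derivative_chain[OF line_derivative dS])
  define X where "X = transpose (S r) ** u"
  have u: "u = S r ** X" unfolding X_def by (simp add: matrix_mul_assoc SO_starD(1)[OF z])
  have X: "X \<in> so_alg"
    using curve_SO_star_derivative[OF dc T(1,2) cS] unfolding X_def by simp
  have 1: "((\<lambda>t. cstr (?c t)) has_vector_derivative
      S r ** (- (Jn ** (X - cnj_mat X))) ** transpose (S r)) (at 0)"
    using cstr_has_vector_derivative[OF dc] z X unfolding X_def by simp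
  have 2: "((\<lambda>t. F (r + t *\<^sub>R v)) has_vector_derivative D r v) (at 0)"
    by (rule has_vector_derivative_chain[OF line_derivative]) (use F_has_derivative r in simp)
  have "D r v = S r ** (- (Jn ** (X - cnj_mat X))) ** transpose (S r)"
    by (rule has_vector_derivative_eq_locally[OF 2 1, of UNIV]) (simp_all add: F_def)
  then show ?thesis using that[OF T(1,2) _ _ X] cS dc u by metis
qed

lemma D_ctang:
  assumes r: "r \<in> W" "r \<in> p_alg" "v \<in> p_alg"
  shows "D r v \<in> ctang (F r)"
proof -
  have z: "S r \<in> SO_star" using local_sectionD(3)[OF sec] r by blast
  obtain X where X: "X \<in> so_alg" "D r v = S r ** (- (Jn ** (X - cnj_mat X))) ** transpose (S r)"
    by (rule section_line[OF r])
  have "- (Jn ** (X - cnj_mat X)) \<in> p_alg"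
    using Jn_p_alg[OF so_alg_p_part[OF X(1)]] subspace_neg[OF subspace_p_alg] by blast
  then show ?thesis unfolding X(2) F_def by (rule p_alg_ctang[OF z])
qed

text \<open>If \<open>D r v\<close> vanishes, the lifted line has a real, hence vertical, velocity,
  and its chart velocity is 0. But the chart recovers the line \<open>r + t *\<^sub>R v\<close>,
  whose velocity is \<open>v\<close>.\<close>

lemma D_eq_0:
  assumes r: "r \<in> W" "r \<in> p_alg" "v \<in> p_alg" and 0: "D r v = 0"
  shows "v = 0"
proof -
  have z: "S r \<in> SO_star" "coset (S r) \<in> U" using local_sectionD(3,4)[OF sec] r by blast+
  obtain T X where T: "open T" "(0::real) \<in> T" "\<forall>t\<in>T. S (r + t *\<^sub>R v) \<in> SO_star"
    and c: "((\<lambda>t. S (r + t *\<^sub>R v)) has_vector_derivative S r ** X) (at 0)" and X: "X \<in> so_alg"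
    and Dr: "D r v = S r ** (- (Jn ** (X - cnj_mat X))) ** transpose (S r)"
    by (rule section_line[OF r])
  have "transpose (S r) ** (S r ** (- (Jn ** (X - cnj_mat X))) ** transpose (S r)) ** S r = 0"
    using Dr 0 by simp
  then have "Jn ** (X - cnj_mat X) = 0"
    by (simp add: matrix_ring SO_starD(2,6)[OF z(1)])
  then have "Jn ** (Jn ** (X - cnj_mat X)) = 0" by simp
  then have "cnj_mat X = X" unfolding matrix_mul_assoc Jn_Jn by (simp add: matrix_ring)
  then have k: "X \<in> k_alg" using X so_alg_cnj(2)[OF X] unfolding so_alg_def k_alg_def by simp
  have S0: "S (r + 0 *\<^sub>R v) = S r" by simp
  obtain T' d where T': "open T'" "0 \<in> T'" "T' \<subseteq> T"
    and d: "((\<lambda>t. x (coset (S (r + t *\<^sub>R v)))) has_vector_derivative d) (at 0)"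
    and d0: "transpose (S (r + 0 *\<^sub>R v)) ** (S r ** X) \<in> k_alg \<longrightarrow> d = 0"
    by (rule chart_curve_derivative[OF atlas c T(1,2)]) (use T(3) z(2) in auto)
  have "d = 0" using d0 k by (simp add: matrix_mul_assoc SO_starD(2)[OF z(1)])
  moreover obtain T2 where T2: "open T2" "(0::real) \<in> T2" "\<forall>t\<in>T2. r + t *\<^sub>R v \<in> W \<and> r + t *\<^sub>R v \<in> p_alg"
    by (rule line_near[OF r])
  have "d = v"
    by (rule has_vector_derivative_eq_locally[OF d line_derivative T2(1,2)])
      (use T2(3) local_sectionD(5)[OF sec] in blast)
  ultimately show ?thesis by simp
qed

lemma D_inj:
  assumes r: "r \<in> W" "r \<in> p_alg" and "v \<in> p_alg" "w \<in> p_alg" "D r v = D r w"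
  shows "v = w"
proof -
  have "D r (v - w) = 0" using assms(5) by (simp add: linear_diff[OF linear_D[OF r(1)]])
  then have "v - w = 0" by (rule D_eq_0[OF r subspace_diff[OF subspace_p_alg assms(3,4)]])
  then show ?thesis by simp
qed

lemma coset_eq_section:
  assumes "p \<in> U" "x p \<in> W"
  shows "p = coset (S (x p))"
proof -
  have "x p \<in> p_alg" using SOU_atlasD(6)[OF atlas] assms by blast
  then show ?thesis
    using assms local_sectionD(4,5)[OF sec] SOU_atlasD(2)[OF atlas] by (metis inj_onD)
qed

lemma coset_cstr_eq_F:
  assumes "p \<in> U" "x p \<in> W"
  shows "coset_cstr p = F (x p)"
proof -
  have "x p \<in> p_alg" using SOU_atlasD(6)[OF atlas] assms by blast
  then show ?thesis
    using coset_eq_section[OF assms] coset_cstr_coset[OF local_sectionD(3)[OF sec]] assms(2)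
    unfolding F_def by metis
qed

text \<open>The velocity of the complex structure belongs to the curve itself and not to the chart;
  chart velocities are compared through it.\<close>

lemma curve_coset_cstr_derivative:
  assumes T: "open T" "t0 \<in> T" "\<And>t. t \<in> T \<Longrightarrow> p t \<in> U"
    and d: "((\<lambda>t. x (p t)) has_vector_derivative d) (at t0)" and W: "x (p t0) \<in> W"
  shows "d \<in> p_alg" "((\<lambda>t. coset_cstr (p t)) has_vector_derivative D (x (p t0)) d) (at t0)"
proof -
  show "d \<in> p_alg"
    by (rule has_vector_derivative_in_subspace[OF subspace_p_alg d T(1,2)])
      (use T(3) SOU_atlasD(6)[OF atlas] in blast)
  have "isCont (\<lambda>t. x (p t)) t0" using has_vector_derivative_continuous[OF d] .
  from iffD1[OF continuous_at_open this, rule_format, of W]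
  obtain B where B: "open B" "t0 \<in> B" "\<forall>t\<in>B. x (p t) \<in> W" using open_W W by blast
  have 1: "((\<lambda>t. F (x (p t))) has_vector_derivative D (x (p t0)) d) (at t0)"
    by (rule has_vector_derivative_chain[OF d F_has_derivative[OF W]])
  show "((\<lambda>t. coset_cstr (p t)) has_vector_derivative D (x (p t0)) d) (at t0)"
    by (rule has_vector_derivative_transform_within_open[OF 1, of "B \<inter> T"])
      (use B T coset_cstr_eq_F in auto)
qed

text \<open>The Cayley curve is run with \<open>(1/2) *\<^sub>R Y\<close> to have velocity
  \<open>z ** Y\<close>. The chart velocity \<open>d\<close> is identified only by its image under
  \<open>D\<close>, which determines it because \<open>D\<close> is injective on
  \<open>p_alg\<close>.\<close>

lemma lift_curve:
  assumes z: "z \<in> SO_star" "coset z \<in> U" "x (coset z) \<in> W" and Y: "Y \<in> p_alg"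
  obtains c d where "curve_through SO_star c z (z ** Y)" "d \<in> p_alg"
    "((\<lambda>t. x (coset (c t))) has_vector_derivative d) (at 0)"
    "D (x (coset z)) d = z ** (- (2 *\<^sub>R (Jn ** Y))) ** transpose z"
proof -
  let ?c = "\<lambda>t. z ** cayley (t *\<^sub>R ((1/2) *\<^sub>R Y))"
  have "curve_through SO_star ?c z (2 *\<^sub>R (z ** ((1/2) *\<^sub>R Y)))"
    by (rule curve_through_SO_star[OF z(1) p_alg_so_alg[OF p_alg_scaleR[OF Y]]])
  then have cc: "curve_through SO_star ?c z (z ** Y)" by (simp add: matrix_ring)
  then obtain e where e: "e > 0" "?c ` {-e<..<e} \<subseteq> SO_star" and c0: "?c 0 = z"
    and dc: "(?c has_vector_derivative (z ** Y)) (at 0)"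
    unfolding curve_through_def by blast
  have T: "open {-e<..<e}" "0 \<in> {-e<..<e}" using e by auto
  have Uc: "coset (?c 0) \<in> U" using c0 z by simp
  have inS: "?c t \<in> SO_star" if "t \<in> {-e<..<e}" for t using e(2) that by blast
  obtain T' d where T': "open T'" "0 \<in> T'" "T' \<subseteq> {-e<..<e}" "\<forall>t\<in>T'. coset (?c t) \<in> U"
    and d: "d \<in> p_alg" "((\<lambda>t. x (coset (?c t))) has_vector_derivative d) (at 0)"
    by (rule chart_curve_derivative[OF atlas dc T inS Uc])
  have W0: "x (coset (?c 0)) \<in> W" using z c0 by simp
  have 1: "((\<lambda>t. coset_cstr (coset (?c t))) has_vector_derivative D (x (coset z)) d) (at 0)"
    using curve_coset_cstr_derivative(2)[OF T'(1,2) _ d(2) W0] T'(4) c0 by simp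
  have X: "transpose (?c 0) ** (z ** Y) = Y"
    unfolding c0 by (simp add: matrix_mul_assoc SO_starD(2)[OF z(1)])
  have cY: "Y - cnj_mat Y = 2 *\<^sub>R Y" using Y by (simp add: p_alg_def scaleR_2)
  have 2: "((\<lambda>t. cstr (?c t)) has_vector_derivative
      ?c 0 ** (- (Jn ** (Y - cnj_mat Y))) ** transpose (?c 0)) (at 0)"
    using cstr_has_vector_derivative[OF dc] unfolding X using inS[OF T(2)] p_alg_so_alg[OF Y] by blast
  have "D (x (coset z)) d = ?c 0 ** (- (Jn ** (Y - cnj_mat Y))) ** transpose (?c 0)"
    by (rule has_vector_derivative_eq_locally[OF 1 2 T]) (use inS coset_cstr_coset in blast)
  then have "D (x (coset z)) d = z ** (- (2 *\<^sub>R (Jn ** Y))) ** transpose z"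
    unfolding c0 cY by (simp add: matrix_ring)
  then show ?thesis using that[OF cc d] by blast
qed

lemma D_surj:
  assumes r: "r \<in> W" "r \<in> p_alg" and A: "A \<in> ctang (F r)"
  obtains v where "v \<in> p_alg" "D r v = A"
proof -
  have z: "S r \<in> SO_star" "coset (S r) \<in> U" "x (coset (S r)) = r"
    using local_sectionD(3-5)[OF sec] r by blast+
  define B where "B = transpose (S r) ** A ** S r"
  have B: "B \<in> p_alg" using ctang_p_alg[OF z(1)] A unfolding B_def F_def by blast
  \<comment> \<open>The inverse of \<open>Y \<mapsto> - 2 Jn Y\<close>, as \<open>Jn\<close> squares
    to minus the identity.\<close>
  define Y where "Y = (1/2) *\<^sub>R (Jn ** B)"
  have Y: "Y \<in> p_alg" unfolding Y_def by (rule p_alg_scaleR[OF Jn_p_alg[OF B]])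
  have "- (2 *\<^sub>R (Jn ** Y)) = B" unfolding Y_def by (simp add: matrix_ring Jn_Jn)
  moreover obtain c d where "d \<in> p_alg" "D (x (coset (S r))) d = S r ** (- (2 *\<^sub>R (Jn ** Y))) ** transpose (S r)"
    by (rule lift_curve[OF z(1,2) _ Y]) (use z r in auto)
  ultimately show ?thesis
    using that[of d] ctang_conj[OF z(1), of A] z(3) unfolding B_def by metis
qed

text \<open>The defining description has a unique solution because, for every curve through
  \<open>z\<close> with velocity \<open>z ** Y\<close> and chart velocity \<open>v\<close>, the last
  equation holds; it fixes \<open>Y\<close> in terms of \<open>v\<close>.\<close>

lemma horizontal_lift_eq:
  assumes z: "z \<in> SO_star" "coset z \<in> U" "x (coset z) \<in> W" and v: "v \<in> p_alg"
  obtains Y where "Y \<in> p_alg" "horizontal_lift x z v = z ** Y"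
    "D (x (coset z)) v = z ** (- (2 *\<^sub>R (Jn ** Y))) ** transpose z"
proof -
  let ?r = "x (coset z)"
  have r: "?r \<in> p_alg" using SOU_atlasD(6)[OF atlas] z by blast
  have Fr: "F ?r = cstr z" using coset_cstr_eq_F[OF z(2,3)] coset_cstr_coset[OF z(1)] by simp
  have DvA: "D ?r v \<in> ctang (cstr z)" using D_ctang[OF z(3) r v] Fr by simp
  define B where "B = transpose z ** D ?r v ** z"
  have B: "B \<in> p_alg" using ctang_p_alg[OF z(1) DvA] unfolding B_def .
  define Y where "Y = (1/2) *\<^sub>R (Jn ** B)"
  have Y: "Y \<in> p_alg" unfolding Y_def by (rule p_alg_scaleR[OF Jn_p_alg[OF B]])
  have "- (2 *\<^sub>R (Jn ** Y)) = B" unfolding Y_def by (simp add: matrix_ring Jn_Jn)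
  then have DY: "D ?r v = z ** (- (2 *\<^sub>R (Jn ** Y))) ** transpose z"
    using ctang_conj[OF z(1), of "D ?r v"] unfolding B_def by simp
  let ?P = "\<lambda>X. X \<in> horizontal_space z \<and>
      (\<exists>c. curve_through SO_star c z X \<and> ((x \<circ> coset \<circ> c) has_vector_derivative v) (at 0))"
  have ex: "?P (z ** Y)"
  proof -
    obtain c d where c: "curve_through SO_star c z (z ** Y)" "d \<in> p_alg"
      "((\<lambda>t. x (coset (c t))) has_vector_derivative d) (at 0)"
      "D ?r d = z ** (- (2 *\<^sub>R (Jn ** Y))) ** transpose z"
      by (rule lift_curve[OF z Y])
    have "d = v" by (rule D_inj[OF z(3) r c(2) v]) (use c(4) DY in simp)
    then show ?thesis using c(1,3) Y horizontal_space_eq[OF z(1)] by (auto simp: o_def)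
  qed
  have uniq: "X = z ** Y" if X: "?P X" for X
  proof -
    obtain Y' where Y': "Y' \<in> p_alg" "X = z ** Y'" using X horizontal_space_eq[OF z(1)] by blast
    obtain c where c: "curve_through SO_star c z X" "((\<lambda>t. x (coset (c t))) has_vector_derivative v) (at 0)"
      using X by (auto simp: o_def)
    obtain e where e: "e > 0" "c ` {-e<..<e} \<subseteq> SO_star" and c0: "c 0 = z"
      and dc: "(c has_vector_derivative X) (at 0)"
      using c(1) unfolding curve_through_def by blast
    have T: "open {-e<..<e}" "0 \<in> {-e<..<e}" using e by auto
    have inS: "c t \<in> SO_star" if "t \<in> {-e<..<e}" for t using e(2) that by blast
    have U0: "coset (c 0) \<in> U" using c0 z by simp
    obtain T' where T': "open T'" "0 \<in> T'" "T' \<subseteq> {-e<..<e}" "\<forall>t\<in>T'. coset (c t) \<in> U"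
      by (rule chart_curve_derivative[OF atlas dc T inS U0])
    have W0: "x (coset (c 0)) \<in> W" using z c0 by simp
    have 1: "((\<lambda>t. coset_cstr (coset (c t))) has_vector_derivative D ?r v) (at 0)"
      using curve_coset_cstr_derivative(2)[OF T'(1,2) _ c(2) W0] T'(4) c0 by simp
    have X': "transpose (c 0) ** X = Y'"
      unfolding c0 Y'(2) by (simp add: matrix_mul_assoc SO_starD(2)[OF z(1)])
    have 2: "((\<lambda>t. cstr (c t)) has_vector_derivative
        c 0 ** (- (Jn ** (Y' - cnj_mat Y'))) ** transpose (c 0)) (at 0)"
      using cstr_has_vector_derivative[OF dc] unfolding X' using inS[OF T(2)] p_alg_so_alg[OF Y'(1)] by blast
    have "D ?r v = c 0 ** (- (Jn ** (Y' - cnj_mat Y'))) ** transpose (c 0)"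
      by (rule has_vector_derivative_eq_locally[OF 1 2 T]) (use inS coset_cstr_coset in blast)
    moreover have "Y' - cnj_mat Y' = 2 *\<^sub>R Y'" using Y'(1) by (simp add: p_alg_def scaleR_2)
    ultimately have "D ?r v = z ** (- (2 *\<^sub>R (Jn ** Y'))) ** transpose z"
      unfolding c0 by (simp add: matrix_ring)
    then have "transpose z ** (z ** (- (2 *\<^sub>R (Jn ** Y'))) ** transpose z) ** z =
      transpose z ** (z ** (- (2 *\<^sub>R (Jn ** Y))) ** transpose z) ** z" using DY by simp
    then have "Jn ** Y' = Jn ** Y" by (simp add: matrix_ring SO_starD(2,6)[OF z(1)])
    then have "Jn ** (Jn ** Y') = Jn ** (Jn ** Y)" by simp
    then have "Y' = Y" unfolding matrix_mul_assoc Jn_Jn by (simp add: matrix_ring)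
    then show ?thesis using Y'(2) by simp
  qed
  have "horizontal_lift x z v = z ** Y"
    unfolding horizontal_lift_def
  proof (rule the_equality)
    show "?P (z ** Y)" by (rule ex)
    show "X = z ** Y" if "?P X" for X by (rule uniq[OF that])
  qed
  then show ?thesis using that[OF Y _ DY] by blast
qed

text \<open>Each horizontal lift appears doubled in \<open>D\<close>, whence the factor 4, and the
  two factors \<open>Jn\<close> cancel through \<open>Jn ** Y ** Jn = Y\<close>. The result no
  longer mentions the chosen representative.\<close>

lemma SOU_metric_eq:
  assumes r: "r \<in> W" "r \<in> p_alg" and v: "v \<in> p_alg" "w \<in> p_alg"
  shows "SOU_metric (U, x) r v w = Re (trace (D r v ** D r w)) / 4"
proof -
  define z where "z = (SOME z. z \<in> SO_star \<and> coset z \<in> U \<and> x (coset z) = r)"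
  have z: "z \<in> SO_star" "coset z \<in> U" "x (coset z) = r"
  proof -
    have "\<exists>z. z \<in> SO_star \<and> coset z \<in> U \<and> x (coset z) = r"
      using local_sectionD(3-5)[OF sec] r by blast
    from someI_ex[OF this] show "z \<in> SO_star" "coset z \<in> U" "x (coset z) = r" unfolding z_def by auto
  qed
  have zW: "x (coset z) \<in> W" using z r by simp
  obtain Y where Y: "Y \<in> p_alg" "horizontal_lift x z v = z ** Y"
    "D (x (coset z)) v = z ** (- (2 *\<^sub>R (Jn ** Y))) ** transpose z"
    by (rule horizontal_lift_eq[OF z(1,2) zW v(1)])
  obtain Y' where Y': "Y' \<in> p_alg" "horizontal_lift x z w = z ** Y'"
    "D (x (coset z)) w = z ** (- (2 *\<^sub>R (Jn ** Y'))) ** transpose z"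
    by (rule horizontal_lift_eq[OF z(1,2) zW v(2)])
  have "SOU_metric (U, x) r v w = GL_metric z (z ** Y) (z ** Y')"
    unfolding SOU_metric_def Y(2)[symmetric] Y'(2)[symmetric] z_def[symmetric] by (simp add: z_def Let_def)
  then have 1: "SOU_metric (U, x) r v w = Y \<bullet> Y'" using GL_metric_SO_star[OF z(1)] by simp
  have YJ: "Jn ** Y ** Jn = Y"
  proof -
    have "Jn ** Y = - (Y ** Jn)" using Y(1) by (simp add: p_alg_def)
    then show ?thesis by (simp add: matrix_ring Jn_Jn')
  qed
  have "D r v ** D r w = 4 *\<^sub>R (z ** (Jn ** Y ** Jn) ** Y' ** transpose z)"
    using Y(3) Y'(3) z(3) by (simp add: matrix_ring SO_starD(6)[OF z(1)])
  also have "\<dots> = 4 *\<^sub>R (z ** (Y ** Y') ** transpose z)" unfolding YJ by (simp add: matrix_mul_assoc)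
  finally have "trace (D r v ** D r w) = 4 *\<^sub>R trace (z ** (Y ** Y') ** transpose z)"
    using linear_cmul[OF bounded_linear.linear[OF bounded_linear_trace]] by metis
  also have "trace (z ** (Y ** Y') ** transpose z) = trace (Y ** Y')"
    using trace_mul_sym[of "z ** (Y ** Y')" "transpose z"] by (simp add: matrix_mul_assoc SO_starD(2)[OF z(1)])
  finally show ?thesis using Re_trace_p_alg[OF Y'(1), of Y] 1 by simp
qed

text \<open>The trace form is indefinite on general matrices; conjugation by \<open>S r\<close>
  brings tangent vectors into \<open>p_alg\<close>, where it is the Euclidean inner product.\<close>

lemma SOU_metric_pos:
  assumes r: "r \<in> W" "r \<in> p_alg" and v: "v \<in> p_alg"
  shows "SOU_metric (U, x) r v v \<ge> 0" "SOU_metric (U, x) r v v = 0 \<Longrightarrow> v = 0"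
proof -
  have z: "S r \<in> SO_star" using local_sectionD(3)[OF sec] r by blast
  let ?A = "transpose (S r) ** D r v ** S r"
  have e: "SOU_metric (U, x) r v v = (?A \<bullet> ?A) / 4"
    using SOU_metric_eq[OF r v v] Re_trace_ctang[OF z, of "D r v" "D r v"] D_ctang[OF r v]
    unfolding F_def by simp
  show "SOU_metric (U, x) r v v \<ge> 0" unfolding e by simp
  assume "SOU_metric (U, x) r v v = 0"
  then have "?A = 0" unfolding e by simp
  then have "D r v = 0" using ctang_conj[OF z, of "D r v"] by simp
  then show "v = 0" using D_eq_0[OF r v] by blast
qed

end

text \<open>Keeps \<open>transpose z *v a\<close> in this form, in which the translated vectors
  appear throughout.\<close>

declare transpose_matrix_vector [simp del]

section \<open>The gradient of \<open>phi\<close>\<close>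

lemma bilin_commute: "bilin u v = bilin v u"
  by (simp add: bilin_def mult.commute)

lemma bilin_add: "bilin (u + u') v = bilin u v + bilin u' v" "bilin u (v + v') = bilin u v + bilin u v'"
  by (simp_all add: bilin_def sum.distrib algebra_simps)

lemma bilin_diff: "bilin (u - u') v = bilin u v - bilin u' v" "bilin u (v - v') = bilin u v - bilin u v'"
  by (simp_all add: bilin_def sum_subtractf algebra_simps)

lemma bilin_minus: "bilin (- u) v = - bilin u v" "bilin u (- v) = - bilin u v"
  by (simp_all add: bilin_def sum_negf)

lemma bilin_scale: "bilin (c *s u) v = c * bilin u v" "bilin u (c *s v) = c * bilin u v"
  by (simp_all add: bilin_def sum_distrib_left mult_ac)

lemma bilin_scaleR: "bilin (r *\<^sub>R u) v = r *\<^sub>R bilin u v" "bilin u (r *\<^sub>R v) = r *\<^sub>R bilin u v"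
  by (simp_all add: bilin_def scaleR_sum_right)

lemma bilin_0: "bilin 0 v = 0" "bilin u 0 = 0"
  by (simp_all add: bilin_def)

lemma bilin_mult_transpose: "bilin u (M *v v) = bilin (transpose M *v u) v"
proof -
  have "bilin u (M *v v) = (\<Sum>i\<in>UNIV. \<Sum>j\<in>UNIV. u $ i * (M $ i $ j * v $ j))"
    by (simp add: bilin_def matrix_vector_mult_def sum_distrib_left)
  also have "\<dots> = (\<Sum>j\<in>UNIV. \<Sum>i\<in>UNIV. u $ i * (M $ i $ j * v $ j))" by (rule sum.swap)
  also have "\<dots> = bilin (transpose M *v u) v"
    by (simp add: bilin_def matrix_vector_mult_def transpose_def sum_distrib_left sum_distrib_right mult_ac)
  finally show ?thesis .
qed

lemma matrix_vector_mult_minus: "(- A) *v x = - (A *v (x :: 'a::ring_1^'n))"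
  by (simp add: matrix_vector_mult_def vec_eq_iff sum_negf)

lemma scaleR_matrix_vector_mult: "(k *\<^sub>R A) *v v = k *\<^sub>R (A *v (v :: complex^'n))"
  by (simp add: matrix_vector_mult_def vec_eq_iff scaleR_sum_right)

lemma bilin_skew:
  assumes "transpose M = - M"
  shows "bilin u (M *v v) = - bilin (M *v u) v" "bilin u (M *v u) = 0"
proof -
  show *: "bilin u (M *v v) = - bilin (M *v u) v" for u v
    using bilin_mult_transpose[of u M v] assms by (simp add: matrix_vector_mult_minus bilin_minus)
  have "bilin u (M *v u) = - bilin u (M *v u)" using *[of u u] bilin_commute[of u "M *v u"] by simp
  then have "2 * bilin u (M *v u) = 0" unfolding mult_2 eq_neg_iff_add_eq_0 .
  then show "bilin u (M *v u) = 0" by simp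
qed

lemma bilin_SO_star:
  assumes "z \<in> SO_star"
  shows "bilin (transpose z *v u) (transpose z *v v) = bilin u v"
  using bilin_mult_transpose[of u z "transpose z *v v"] SO_starD(1)[OF assms]
  by (simp add: matrix_vector_mul_assoc)

lemma trace_outer: "trace (outer a b ** M) = bilin b (M *v a)"
proof -
  have "trace (outer a b ** M) = (\<Sum>i\<in>UNIV. \<Sum>k\<in>UNIV. a $ i * b $ k * M $ k $ i)"
    by (simp add: trace_def outer_def matrix_matrix_mult_def)
  also have "\<dots> = (\<Sum>k\<in>UNIV. \<Sum>i\<in>UNIV. a $ i * b $ k * M $ k $ i)" by (rule sum.swap)
  also have "\<dots> = bilin b (M *v a)"
    by (simp add: bilin_def matrix_vector_mult_def sum_distrib_left mult_ac)
  finally show ?thesis .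
qed

lemma outer_mult_vector: "outer a b *v w = bilin b w *s a"
  by (simp add: outer_def matrix_vector_mult_def bilin_def vec_eq_iff sum_distrib_left mult_ac)

lemma transpose_outer: "transpose (outer a b) = outer b a"
  by (simp add: outer_def transpose_def vec_eq_iff mult.commute)

text \<open>\<open>pc_part\<close> is the orthogonal projection onto the complexification of \<open>p_alg\<close> with respect to
  the complex trace form, and \<open>p_part\<close> the real orthogonal projection onto \<open>p_alg\<close> itself.\<close>

definition pc_part :: "('n::finite) cmat2 \<Rightarrow> 'n cmat2" where
  "pc_part M = (1/4) *\<^sub>R (M - transpose M + Jn ** M ** Jn - Jn ** transpose M ** Jn)"

definition p_part :: "('n::finite) cmat2 \<Rightarrow> 'n cmat2" where
  "p_part M = (1/2) *\<^sub>R (pc_part M - cnj_mat (pc_part M))"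

lemma pc_part_props: "transpose (pc_part M) = - pc_part M" "pc_part M ** Jn = - (Jn ** pc_part M)"
proof -
  show "transpose (pc_part M) = - pc_part M"
    unfolding pc_part_def by (simp add: matrix_conv transpose_Jn matrix_ring algebra_simps)
  show "pc_part M ** Jn = - (Jn ** pc_part M)"
    unfolding pc_part_def by (simp add: matrix_ring Jn_Jn' Jn_Jn algebra_simps)
qed

lemma p_part_p_alg: "p_part M \<in> p_alg"
proof -
  note 1 = pc_part_props[of M]
  have "cnj_mat (pc_part M) ** Jn = - (Jn ** cnj_mat (pc_part M))"
    using arg_cong[OF 1(2), of cnj_mat] by (simp add: matrix_conv cnj_mat_Jn)
  then show ?thesis
    unfolding p_part_def using 1 by (simp add: p_alg_def matrix_conv matrix_ring algebra_simps)
qed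

lemma inner_transpose: "transpose A \<bullet> B = A \<bullet> transpose B" for A B :: "complex^'m^'m"
  unfolding inner_vec_def transpose_def by (simp add: inner_vec_def) (rule sum.swap)

lemma inner_cnj_mat': "cnj_mat A \<bullet> B = A \<bullet> cnj_mat B"
  by (simp add: inner_vec_def inner_complex_def cnj_mat_def)

lemma inner_matrix_mult:
  fixes A B C :: "complex^'m^'m"
  shows "(C ** A) \<bullet> B = A \<bullet> (ctranspose C ** B)" "(A ** C) \<bullet> B = A \<bullet> (B ** ctranspose C)"
proof -
  have c: "ctranspose (X ** Y) = ctranspose Y ** ctranspose X" "ctranspose (ctranspose X) = X"
    for X Y :: "complex^'m^'m"
    by (simp_all add: ctranspose_def matrix_conv)
  show "(C ** A) \<bullet> B = A \<bullet> (ctranspose C ** B)"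
    unfolding inner_mat_eq c using trace_mul_sym[of C "A ** ctranspose B"] by (simp add: matrix_mul_assoc)
  show "(A ** C) \<bullet> B = A \<bullet> (B ** ctranspose C)"
    unfolding inner_mat_eq c by (simp add: matrix_mul_assoc)
qed

text \<open>Each operation averaged in \<open>p_part\<close> (transposition, multiplication by
  \<open>Jn\<close> on both sides, complex conjugation) is self-adjoint and acts on
  \<open>p_alg\<close> as a sign.\<close>

lemma inner_p_part:
  assumes Y: "Y \<in> p_alg"
  shows "p_part M \<bullet> Y = M \<bullet> Y"
proof -
  have 1: "transpose Y = - Y" "cnj_mat Y = - Y" and J: "Y ** Jn = - (Jn ** Y)" using Y by (auto simp: p_alg_def)
  have cJ: "ctranspose Jn = - Jn" by (simp add: ctranspose_def cnj_mat_Jn transpose_Jn)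
  have JJ: "(Jn ** X ** Jn) \<bullet> Y = X \<bullet> Y" for X
  proof -
    have "(Jn ** X ** Jn) \<bullet> Y = X \<bullet> (Jn ** (Y ** Jn))"
      unfolding inner_matrix_mult(2)[of "Jn ** X"] inner_matrix_mult(1)[of Jn X] cJ by (simp add: matrix_ring)
    also have "Jn ** (Y ** Jn) = Y" unfolding J by (simp add: matrix_ring Jn_Jn)
    finally show ?thesis .
  qed
  have pc: "pc_part M \<bullet> Y = M \<bullet> Y"
    unfolding pc_part_def by (simp add: inner_add_left inner_diff_left JJ inner_transpose 1)
  show ?thesis
    unfolding p_part_def by (simp add: inner_diff_left inner_cnj_mat' 1 pc)
qed

lemma Re_bilin_p_alg:
  assumes "Y \<in> p_alg"
  shows "Re (bilin \<beta> (Y *v \<alpha>)) = p_part (outer \<alpha> \<beta>) \<bullet> Y"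
  using Re_trace_p_alg[OF assms, of "outer \<alpha> \<beta>"] inner_p_part[OF assms] trace_outer by metis

text \<open>The imaginary part of a number is the real part of \<open>- \<i>\<close> times it; the
  factor is absorbed into \<alpha>.\<close>

lemma Im_bilin_p_alg:
  assumes "Y \<in> p_alg"
  shows "Im (bilin \<beta> (Y *v \<alpha>)) = p_part (outer (- \<i> *s \<alpha>) \<beta>) \<bullet> Y"
proof -
  have "Y *v (- \<i> *s \<alpha>) = - \<i> *s (Y *v \<alpha>)" by (rule vec.scale)
  then show ?thesis
    using Re_bilin_p_alg[OF assms, of \<beta> "- \<i> *s \<alpha>"] by (simp only: bilin_scale) simp
qed

text \<open>The complex bilinear counterpart of \<open>inner_p_part\<close>. It applies also to
  matrices that are not purely imaginary, such as the complex gradient itself.\<close>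

lemma trace_pc_part:
  assumes S: "transpose S = - S" "S ** Jn = - (Jn ** S)"
  shows "trace (pc_part (outer \<alpha> \<beta>) ** S) = bilin \<beta> (S *v \<alpha>)"
proof -
  have t: "trace (outer \<beta> \<alpha> ** S) = - bilin \<beta> (S *v \<alpha>)"
    unfolding trace_outer using bilin_skew(1)[OF S(1)] bilin_commute by metis
  have JJ: "trace (Jn ** X ** Jn ** S) = trace (X ** S)" for X
  proof -
    have "trace (Jn ** X ** Jn ** S) = trace (X ** (Jn ** (S ** Jn)))"
      using trace_mul_sym[of Jn "X ** Jn ** S"] by (simp add: matrix_mul_assoc)
    also have "Jn ** (S ** Jn) = S" unfolding S(2) by (simp add: matrix_ring Jn_Jn)
    finally show ?thesis .
  qed
  have "trace (pc_part (outer \<alpha> \<beta>) ** S) = (1/4) *\<^sub>R trace ((outer \<alpha> \<beta> - outer \<beta> \<alpha>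
      + Jn ** outer \<alpha> \<beta> ** Jn - Jn ** outer \<beta> \<alpha> ** Jn) ** S)"
    unfolding pc_part_def transpose_outer
    using linear_cmul[OF bounded_linear.linear[OF bounded_linear_trace]] scalar_matrix_assoc by metis
  also have "\<dots> = bilin \<beta> (S *v \<alpha>)"
    by (simp add: matrix_add_rdistrib matrix_diff_rdistrib trace_add trace_sub JJ t) (simp add: trace_outer)
  finally show ?thesis .
qed

lemma pc_part_outer_mult_vector:
  "4 *\<^sub>R (pc_part (outer \<alpha> \<beta>) *v w) = bilin \<beta> w *s \<alpha> - bilin \<alpha> w *s \<beta>
    + bilin \<beta> (Jn *v w) *s (Jn *v \<alpha>) - bilin \<alpha> (Jn *v w) *s (Jn *v \<beta>)"
proof -
  have J: "(Jn ** outer u v ** Jn) *v w = bilin v (Jn *v w) *s (Jn *v u)" for u v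
    by (simp add: matrix_vector_mul_assoc[symmetric] outer_mult_vector vec.scale)
  have "4 *\<^sub>R pc_part (outer \<alpha> \<beta>) = outer \<alpha> \<beta> - outer \<beta> \<alpha> + Jn ** outer \<alpha> \<beta> ** Jn - Jn ** outer \<beta> \<alpha> ** Jn"
    unfolding pc_part_def transpose_outer by simp
  then have "(4 *\<^sub>R pc_part (outer \<alpha> \<beta>)) *v w = bilin \<beta> w *s \<alpha> - bilin \<alpha> w *s \<beta>
    + bilin \<beta> (Jn *v w) *s (Jn *v \<alpha>) - bilin \<alpha> (Jn *v w) *s (Jn *v \<beta>)"
    by (simp add: matrix_vector_mult_diff_rdistrib matrix_vector_mult_add_rdistrib outer_mult_vector J)
  then show ?thesis
    by (simp add: vec_eq_iff matrix_vector_mult_def scaleR_sum_right)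
qed

lemma bilin_Jn: "bilin u (Jn *v v) = - bilin (Jn *v u) v" "bilin u (Jn *v u) = 0"
  using bilin_skew[OF transpose_Jn] .

lemma Jn_Jn_vector: "Jn *v (Jn *v u) = - u"
  by (simp add: matrix_vector_mul_assoc Jn_Jn matrix_vector_mult_minus)

text \<open>Meant for the vectors of the theorem moved to the base point by
  \<open>transpose z\<close>; \<open>Jab\<close> then says that \<open>phi\<close> vanishes at the
  point.\<close>

locale isotropic_pair =
  fixes \<alpha> \<beta> :: "('n::finite) cvec2"
  assumes aa: "bilin \<alpha> \<alpha> = 0" and ab: "bilin \<alpha> \<beta> = 0" and Jab: "bilin (Jn *v \<alpha>) \<beta> = 0"
    and bb: "bilin \<beta> \<beta> \<noteq> 0" and a0: "\<alpha> \<noteq> 0"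
begin

text \<open>The complex gradient of \<open>\<lambda>Y. bilin \<beta> (Y *v \<alpha>)\<close>.
  \<open>G1\<close> and \<open>G2\<close> are the real gradients of its real and imaginary parts,
  with \<open>\<Gamma> = G1 + \<i> G2\<close>.\<close>

definition "\<Gamma> = pc_part (outer \<alpha> \<beta>)"
definition "G1 = p_part (outer \<alpha> \<beta>)"
definition "G2 = p_part (outer (- \<i> *s \<alpha>) \<beta>)"

lemma Gamma_beta: "\<Gamma> *v \<beta> = (bilin \<beta> \<beta> / 4) *s \<alpha>"
proof -
  have "bilin \<alpha> (Jn *v \<beta>) = 0" using Jab bilin_Jn(1)[of \<alpha> \<beta>] by simp
  then have "4 *\<^sub>R (\<Gamma> *v \<beta>) = bilin \<beta> \<beta> *s \<alpha>"
    using ab unfolding \<Gamma>_def pc_part_outer_mult_vector by (simp add: bilin_Jn(2))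
  then show ?thesis by (simp add: vec_eq_iff scaleR_conv_of_real[where 'a=complex] field_simps)
qed

lemma Gamma_J_alpha: "\<Gamma> *v (Jn *v \<alpha>) = 0"
proof -
  have "bilin \<beta> (Jn *v \<alpha>) = 0" using Jab bilin_commute by metis
  moreover have "bilin \<beta> \<alpha> = 0" using ab bilin_commute by metis
  ultimately have "4 *\<^sub>R (\<Gamma> *v (Jn *v \<alpha>)) = 0"
    using aa unfolding \<Gamma>_def pc_part_outer_mult_vector
    by (simp add: bilin_Jn(2) Jn_Jn_vector bilin_minus)
  then show ?thesis by simp
qed

lemma Gamma_props: "transpose \<Gamma> = - \<Gamma>" "\<Gamma> ** Jn = - (Jn ** \<Gamma>)"
  unfolding \<Gamma>_def by (rule pc_part_props)+

lemma Gamma_nonzero: "\<Gamma> \<noteq> 0"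
proof
  assume "\<Gamma> = 0"
  then have "(bilin \<beta> \<beta> / 4) *s \<alpha> = 0" using Gamma_beta by simp
  then show False using bb a0 by (simp add: vec.scale_eq_0_iff)
qed

text \<open>The complex gradient is isotropic. The trace of its square is the function evaluated at
  \<Gamma>; moving \<Gamma> onto \<beta> leaves a multiple of
  \<open>bilin \<alpha> \<alpha>\<close>. Skewness turns the trace into minus this sum, whose real
  and imaginary parts give the equal lengths and the orthogonality in
  \<open>G_inner\<close>.\<close>

lemma Gamma_entries: "(\<Sum>i\<in>UNIV. \<Sum>j\<in>UNIV. \<Gamma> $ i $ j * \<Gamma> $ i $ j) = 0"
proof -
  have "trace (\<Gamma> ** \<Gamma>) = bilin \<beta> (\<Gamma> *v \<alpha>)"
    using trace_pc_part[OF Gamma_props, of \<alpha> \<beta>] unfolding \<Gamma>_def[symmetric] .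
  also have "\<dots> = - bilin (\<Gamma> *v \<beta>) \<alpha>" by (rule bilin_skew(1)[OF Gamma_props(1)])
  also have "\<dots> = 0" unfolding Gamma_beta bilin_scale aa by simp
  finally have "(\<Sum>i\<in>UNIV. \<Sum>j\<in>UNIV. \<Gamma> $ i $ j * \<Gamma> $ j $ i) = 0"
    by (simp add: trace_def matrix_matrix_mult_def)
  moreover have "\<Gamma> $ i $ j * \<Gamma> $ j $ i = - (\<Gamma> $ i $ j * \<Gamma> $ i $ j)" for i j
  proof -
    have "\<Gamma> $ j $ i = - \<Gamma> $ i $ j"
      using arg_cong[OF Gamma_props(1), of "\<lambda>M. M $ i $ j"] by (simp add: transpose_def)
    then show ?thesis by (simp only: mult_minus_right)
  qed
  ultimately have "- (\<Sum>i\<in>UNIV. \<Sum>j\<in>UNIV. \<Gamma> $ i $ j * \<Gamma> $ i $ j) = 0"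
    by (simp only: sum_negf)
  then show ?thesis by simp
qed

lemma G1_entry: "G1 $ i $ j = \<i> * Im (\<Gamma> $ i $ j)"
  unfolding G1_def p_part_def \<Gamma>_def[symmetric] by (simp add: cnj_mat_def complex_eq_iff)

lemma G2_entry: "G2 $ i $ j = - \<i> * Re (\<Gamma> $ i $ j)"
proof -
  have "pc_part (outer (- \<i> *s \<alpha>) \<beta>) $ i $ j = - \<i> * \<Gamma> $ i $ j"
    unfolding \<Gamma>_def pc_part_def outer_def
    by (simp add: transpose_def matrix_matrix_mult_def sum_distrib_left sum_distrib_right sum_negf
        scaleR_conv_of_real[where 'a=complex] algebra_simps)
  then show ?thesis unfolding G2_def p_part_def by (simp add: cnj_mat_def complex_eq_iff)
qed

lemma G_p_alg: "G1 \<in> p_alg" "G2 \<in> p_alg"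
  unfolding G1_def G2_def by (rule p_part_p_alg)+

lemma G_inner: "G1 \<bullet> G2 = 0" "G1 \<bullet> G1 = G2 \<bullet> G2" "G1 \<bullet> G1 > 0"
proof -
  have e: "G1 \<bullet> G1 = (\<Sum>i\<in>UNIV. \<Sum>j\<in>UNIV. (Im (\<Gamma> $ i $ j))\<^sup>2)"
    "G2 \<bullet> G2 = (\<Sum>i\<in>UNIV. \<Sum>j\<in>UNIV. (Re (\<Gamma> $ i $ j))\<^sup>2)"
    "G1 \<bullet> G2 = - (\<Sum>i\<in>UNIV. \<Sum>j\<in>UNIV. Im (\<Gamma> $ i $ j) * Re (\<Gamma> $ i $ j))"
    by (simp_all add: inner_vec_def inner_complex_def G1_entry G2_entry power2_eq_square sum_negf)
  have "(\<Sum>i\<in>UNIV. \<Sum>j\<in>UNIV. (Re (\<Gamma> $ i $ j))\<^sup>2) - (\<Sum>i\<in>UNIV. \<Sum>j\<in>UNIV. (Im (\<Gamma> $ i $ j))\<^sup>2) = 0"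
    using arg_cong[OF Gamma_entries, of Re] by (simp add: sum_subtractf power2_eq_square)
  then show eq: "G1 \<bullet> G1 = G2 \<bullet> G2" unfolding e by simp
  have "2 * (\<Sum>i\<in>UNIV. \<Sum>j\<in>UNIV. Im (\<Gamma> $ i $ j) * Re (\<Gamma> $ i $ j)) = 0"
    using arg_cong[OF Gamma_entries, of Im] by (simp add: sum_distrib_left mult_ac flip: mult_2)
  then show "G1 \<bullet> G2 = 0" unfolding e by simp
  have "G1 \<bullet> G1 \<noteq> 0"
  proof
    assume "G1 \<bullet> G1 = 0"
    then have "G1 = 0" "G2 = 0" using eq by auto
    then have "Im (\<Gamma> $ i $ j) = 0" "Re (\<Gamma> $ i $ j) = 0" for i j
      using G1_entry[of i j] G2_entry[of i j] by simp_all
    then have "\<Gamma> = 0" by (simp add: vec_eq_iff complex_eq_iff)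
    then show False using Gamma_nonzero by simp
  qed
  then show "G1 \<bullet> G1 > 0" by simp
qed

lemma bilin_eq_G:
  assumes "Y \<in> p_alg"
  shows "bilin \<beta> (Y *v \<alpha>) = Complex (G1 \<bullet> Y) (G2 \<bullet> Y)"
  using Re_bilin_p_alg[OF assms, of \<beta> \<alpha>] Im_bilin_p_alg[OF assms, of \<beta> \<alpha>]
  by (simp add: G1_def G2_def complex_eq_iff)

lemma G_squares: "G1 ** G1 + G2 ** G2 = - ((1/2) *\<^sub>R (\<Gamma> ** cnj_mat \<Gamma> + cnj_mat \<Gamma> ** \<Gamma>))"
proof -
  have "G1 $ i $ k * G1 $ k $ j + G2 $ i $ k * G2 $ k $ j =
    - ((1/2) *\<^sub>R (\<Gamma> $ i $ k * cnj (\<Gamma> $ k $ j) + cnj (\<Gamma> $ i $ k) * \<Gamma> $ k $ j))" for i j k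
    unfolding G1_entry G2_entry by (simp add: complex_eq_iff algebra_simps)
  then show ?thesis
    by (simp add: vec_eq_iff matrix_matrix_mult_def cnj_mat_def sum.distrib[symmetric] scaleR_sum_right
        sum_negf[symmetric])
qed

text \<open>Up to a factor the sum of squares is the symmetrised product of \<Gamma> and its
  conjugate. In one order \<Gamma> annihilates \<open>Jn *v \<alpha>\<close>; in the other it
  carries \<beta> to a multiple of \<alpha>, and what remains is the form of the skew matrix
  \<open>?C ** Jn\<close> at \<alpha>.\<close>

lemma normal_contribution: "bilin \<beta> ((G1 ** G1 + G2 ** G2) *v (Jn *v \<alpha>)) = 0"
proof -
  let ?w = "Jn *v \<alpha>" and ?C = "cnj_mat \<Gamma>"
  have C: "transpose ?C = - ?C" using Gamma_props(1) by (simp add: matrix_conv)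
  have CJ: "transpose (?C ** Jn) = - (?C ** Jn)"
  proof -
    have "cnj_mat (\<Gamma> ** Jn) = cnj_mat (- (Jn ** \<Gamma>))" using Gamma_props(2) by simp
    then have "?C ** Jn = - (Jn ** ?C)" by (simp add: matrix_conv cnj_mat_Jn)
    then show ?thesis using C by (simp add: matrix_conv transpose_Jn matrix_ring)
  qed
  have "bilin \<beta> ((\<Gamma> ** ?C) *v ?w) = - bilin (\<Gamma> *v \<beta>) (?C *v ?w)"
    unfolding matrix_vector_mul_assoc[symmetric] by (rule bilin_skew(1)[OF Gamma_props(1)])
  also have "\<dots> = - (bilin \<beta> \<beta> / 4) * bilin \<alpha> ((?C ** Jn) *v \<alpha>)"
    unfolding Gamma_beta bilin_scale by (simp add: matrix_vector_mul_assoc)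
  also have "\<dots> = 0" using bilin_skew(2)[OF CJ] by simp
  finally have 1: "bilin \<beta> ((\<Gamma> ** ?C) *v ?w) = 0" .
  have 2: "(?C ** \<Gamma>) *v ?w = 0"
    unfolding matrix_vector_mul_assoc[symmetric] Gamma_J_alpha by simp
  have s: "(- ((1/2) *\<^sub>R M)) *v v = - ((1/2) *\<^sub>R (M *v v))" for M and v :: "'n cvec2"
    by (simp add: matrix_vector_mult_def vec_eq_iff sum_negf scaleR_sum_right)
  show ?thesis
    unfolding G_squares s matrix_vector_mult_add_rdistrib 2
    by (simp add: bilin_minus bilin_scaleR 1)
qed

end

text \<open>Expanding in the basis reproduces the orthogonal projection \<open>p_part\<close>, so
  the sum does not depend on the basis and can be computed by projecting matrix units.\<close>

lemma casimir:
  assumes C: "finite C" "span C = p_alg" and on: "\<forall>Y\<in>C. \<forall>Y'\<in>C. Y \<bullet> Y' = (if Y = Y' then 1 else 0)"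
  shows "\<exists>c. (\<Sum>Y\<in>C. Y ** Y) = c *\<^sub>R (mat 1 :: ('n::finite) cmat2)"
proof -
  have expand: "(\<Sum>Y\<in>C. (M \<bullet> Y) *\<^sub>R Y) = p_part M" for M :: "'n cmat2"
  proof -
    let ?R = "p_part M - (\<Sum>Y\<in>C. (M \<bullet> Y) *\<^sub>R Y)"
    have CY: "Y \<in> p_alg" if "Y \<in> C" for Y using C(2) that span_base by blast
    have R: "?R \<in> p_alg"
      by (intro subspace_diff[OF subspace_p_alg] p_part_p_alg subspace_sum[OF subspace_p_alg] p_alg_scaleR CY)
    have "?R \<bullet> Z = 0" if Z: "Z \<in> C" for Z
    proof -
      have "(\<Sum>Y\<in>C. (M \<bullet> Y) *\<^sub>R Y) \<bullet> Z = (\<Sum>Y\<in>C. if Y = Z then M \<bullet> Y else 0)"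
        unfolding inner_sum_left by (rule sum.cong) (use on Z in auto)
      also have "\<dots> = M \<bullet> Z" using C(1) Z by simp
      finally show ?thesis using inner_p_part[OF CY[OF Z]] by (simp add: inner_diff_left)
    qed
    then have "orthogonal ?R Z" if "Z \<in> span C" for Z
      using orthogonal_to_span[OF that, of ?R] by (simp add: orthogonal_def)
    then have "?R \<bullet> ?R = 0" using R C(2) unfolding orthogonal_def by blast
    then show ?thesis by simp
  qed
  \<comment> \<open>Matrix units times \<open>\<i>\<close>, since entries of \<open>p_alg\<close>
    are imaginary: the inner product with \<open>Y\<close> picks out the imaginary part of one
    entry.\<close>
  define E :: "'n + 'n \<Rightarrow> 'n + 'n \<Rightarrow> 'n cmat2" where
    "E = (\<lambda>j m. \<chi> i k. if i = j \<and> k = m then \<i> else 0)"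
  have EY: "\<i> * complex_of_real (E j m \<bullet> Y) = Y $ j $ m" if "Y \<in> C" for Y j m
  proof -
    have "Y \<in> p_alg" using C(2) that span_base by blast
    then have "cnj (Y $ j $ m) = - Y $ j $ m"
      unfolding p_alg_def by (auto simp: cnj_mat_def vec_eq_iff)
    then have "Re (Y $ j $ m) = 0" by (simp add: complex_eq_iff)
    moreover have "E j m \<bullet> Y = (\<Sum>i\<in>UNIV. \<Sum>k\<in>UNIV. if i = j \<and> k = m then Im (Y $ i $ k) else 0)"
      unfolding inner_vec_def E_def by (intro sum.cong refl) (auto simp: inner_complex_def)
    moreover have "\<dots> = (\<Sum>i\<in>UNIV. if i = j then Im (Y $ i $ m) else 0)"
      by (rule sum.cong) (auto simp: sum.delta)
    ultimately show ?thesis by (simp add: complex_eq_iff)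
  qed
  have "(\<Sum>Y\<in>C. Y ** Y) $ i $ m = (\<Sum>j\<in>UNIV. \<i> * p_part (E j m) $ i $ j)" for i m
  proof -
    have "(\<Sum>Y\<in>C. Y ** Y) $ i $ m = (\<Sum>Y\<in>C. \<Sum>j\<in>UNIV. Y $ i $ j * Y $ j $ m)"
      by (simp add: matrix_matrix_mult_def)
    also have "\<dots> = (\<Sum>j\<in>UNIV. \<Sum>Y\<in>C. Y $ i $ j * Y $ j $ m)" by (rule sum.swap)
    also have "\<dots> = (\<Sum>j\<in>UNIV. \<i> * (\<Sum>Y\<in>C. (E j m \<bullet> Y) *\<^sub>R Y) $ i $ j)"
    proof (rule sum.cong[OF refl])
      fix j
      have "Y $ i $ j * Y $ j $ m = \<i> * ((E j m \<bullet> Y) *\<^sub>R Y) $ i $ j" if "Y \<in> C" for Y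
      proof -
        have "Y $ i $ j * Y $ j $ m = Y $ i $ j * (\<i> * complex_of_real (E j m \<bullet> Y))"
          unfolding EY[OF that] ..
        then show ?thesis by (simp add: scaleR_conv_of_real[where 'a=complex] mult_ac)
      qed
      then show "(\<Sum>Y\<in>C. Y $ i $ j * Y $ j $ m) = \<i> * (\<Sum>Y\<in>C. (E j m \<bullet> Y) *\<^sub>R Y) $ i $ j"
        by (simp add: sum_distrib_left)
    qed
    finally show ?thesis unfolding expand .
  qed
  moreover have "\<i> * p_part (E j m) $ i $ j = - (1/4) * ((if i = j \<and> j = m then 1 else 0)
      - (if i = m then 1 else 0) + Jn $ i $ j * Jn $ m $ j - Jn $ i $ m * Jn $ j $ j)" for i j m
  proof -
    have J: "cnj (Jn $ i $ j :: complex) = Jn $ i $ j" for i j :: "'n + 'n"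
      using arg_cong[OF cnj_mat_Jn, of "\<lambda>M. M $ i $ j"] by (simp add: cnj_mat_def)
    have s: "(\<Sum>k\<in>UNIV. (\<Sum>l\<in>UNIV. Jn $ i $ l * E u v $ l $ k) * Jn $ k $ j') = \<i> * (Jn $ i $ u * Jn $ v $ j')"
      for u v j'
    proof -
      have 1: "(\<Sum>l\<in>UNIV. Jn $ i $ l * E u v $ l $ k) = (if k = v then \<i> * Jn $ i $ u else 0)" for k
      proof -
        have "(\<Sum>l\<in>UNIV. Jn $ i $ l * E u v $ l $ k) = (\<Sum>l\<in>UNIV. if l = u then (if k = v then \<i> * Jn $ i $ u else 0) else 0)"
          by (rule sum.cong) (auto simp: E_def)
        then show ?thesis by simp
      qed
      have "(\<Sum>k\<in>UNIV. (\<Sum>l\<in>UNIV. Jn $ i $ l * E u v $ l $ k) * Jn $ k $ j') =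
          (\<Sum>k\<in>UNIV. if k = v then \<i> * (Jn $ i $ u * Jn $ v $ j') else 0)"
        unfolding 1 by (rule sum.cong) auto
      then show ?thesis by simp
    qed
    have t: "transpose (E j m) = E m j"
      unfolding E_def transpose_def by (simp add: vec_eq_iff conj_commute)
    define T :: complex where "T = (if i = j \<and> j = m then 1 else 0) - (if i = m then 1 else 0)
      + Jn $ i $ j * Jn $ m $ j - Jn $ i $ m * Jn $ j $ j"
    have e: "E j m $ i $ j = \<i> * (if i = j \<and> j = m then 1 else 0)"
      "E m j $ i $ j = \<i> * (if i = m then 1 else 0)"
      "(Jn ** E j m ** Jn) $ i $ j = \<i> * (Jn $ i $ j * Jn $ m $ j)"
      "(Jn ** E m j ** Jn) $ i $ j = \<i> * (Jn $ i $ m * Jn $ j $ j)"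
      by (simp add: E_def, simp add: E_def, simp_all add: matrix_matrix_mult_def s)
    have "pc_part (E j m) $ i $ j = (1/4) *\<^sub>R (E j m $ i $ j - E m j $ i $ j
        + (Jn ** E j m ** Jn) $ i $ j - (Jn ** E m j ** Jn) $ i $ j)"
      unfolding pc_part_def t by simp
    also have "\<dots> = (1/4) *\<^sub>R (\<i> * T)"
      unfolding e T_def by (simp only: right_diff_distrib distrib_left)
    finally have pc: "pc_part (E j m) $ i $ j = (1/4) *\<^sub>R (\<i> * T)" .
    have cT: "cnj T = T"
      unfolding T_def by (simp only: complex_cnj_diff complex_cnj_add complex_cnj_mult J if_distrib[of cnj]
          complex_cnj_one complex_cnj_zero)
    have "p_part (E j m) $ i $ j = (1/2) *\<^sub>R (pc_part (E j m) $ i $ j - cnj (pc_part (E j m) $ i $ j))"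
      unfolding p_part_def by (simp only: vector_scaleR_component vector_minus_component cnj_mat_def vec_lambda_beta)
    also have "\<dots> = (1/4) *\<^sub>R (\<i> * T)"
      unfolding pc using cT by (simp add: complex_eq_iff)
    finally have "\<i> * p_part (E j m) $ i $ j = - (1/4) * T"
      by (simp add: complex_eq_iff)
    then show ?thesis unfolding T_def .
  qed
  ultimately have entry: "(\<Sum>Y\<in>C. Y ** Y) $ i $ m = (\<Sum>j\<in>UNIV. - (1/4) * ((if i = j \<and> j = m then 1 else 0)
      - (if i = m then 1 else 0) + Jn $ i $ j * Jn $ m $ j - Jn $ i $ m * Jn $ j $ j))" for i m by simp
  have tr: "Jn $ j $ j = (0 :: complex)" for j :: "'n + 'n"
    by (simp add: Jn_def blocks_def split: sum.split)
  have JJ: "(\<Sum>j\<in>UNIV. Jn $ i $ j * Jn $ m $ j) = (if i = m then 1 else (0 :: complex))" for i m :: "'n + 'n"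
  proof -
    have "Jn ** transpose Jn = (mat 1 :: 'n cmat2)" by (simp add: transpose_Jn matrix_ring Jn_Jn)
    from arg_cong[OF this, of "\<lambda>M. M $ i $ m"] show ?thesis
      by (simp add: matrix_matrix_mult_def transpose_def mat_def)
  qed
  have d: "(\<Sum>j\<in>UNIV. if i = j \<and> j = m then 1 else 0) = (if i = m then 1 else (0 :: complex))" for i m :: "'n + 'n"
  proof -
    have "(\<Sum>j\<in>UNIV. if i = j \<and> j = m then 1 else 0) =
        (\<Sum>j\<in>UNIV. if j = i then (if i = m then 1 else 0) else (0 :: complex))"
      by (rule sum.cong) auto
    then show ?thesis by simp
  qed
  \<comment> \<open>Summed over \<open>j\<close>, the first and third terms give the identity once
    each, the second subtracts it \<open>CARD('n + 'n)\<close> times, and the last vanishes because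
    \<open>Jn\<close> has zero diagonal.\<close>
  have "(\<Sum>Y\<in>C. Y ** Y) = (- (1/4) * (2 - real CARD('n + 'n))) *\<^sub>R mat 1"
    unfolding vec_eq_iff entry
    by (simp add: sum_distrib_left[symmetric] sum_subtractf sum.distrib tr JJ d mat_def scaleR_conv_of_real[where 'a=complex]
        sum_negf sum_divide_distrib[symmetric])
  then show ?thesis by blast
qed

context isotropic_pair
begin

text \<open>Extending the orthonormal basis by the two normalised gradients, the full sum is a multiple
  of \<open>bilin \<beta> (Jn *v \<alpha>)\<close>, hence zero.\<close>

lemma tangential_sum:
  assumes B: "finite B" "span B = {Y \<in> p_alg. bilin \<beta> (Y *v \<alpha>) = 0}"
    and on: "\<forall>Y\<in>B. \<forall>Y'\<in>B. Y \<bullet> Y' = (if Y = Y' then 1 else 0)"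
  shows "(\<Sum>Y\<in>B. bilin \<beta> ((Y ** Y) *v (Jn *v \<alpha>))) = 0"
proof -
  define g where "g = sqrt (G1 \<bullet> G1)"
  have g: "g > 0" "g * g = G1 \<bullet> G1" "g * g = G2 \<bullet> G2" using G_inner unfolding g_def by auto
  define N1 where "N1 = (1/g) *\<^sub>R G1"
  define N2 where "N2 = (1/g) *\<^sub>R G2"
  have N: "N1 \<bullet> N1 = 1" "N2 \<bullet> N2 = 1" "N1 \<bullet> N2 = 0" "N2 \<bullet> N1 = 0"
    unfolding N1_def N2_def using g G_inner(1) by (auto simp: inner_commute[of G2 G1])
  have Bp: "Y \<in> p_alg" "bilin \<beta> (Y *v \<alpha>) = 0" if "Y \<in> B" for Y
    using B(2) span_base[OF that] by blast+
  have NB: "N1 \<bullet> Y = 0" "N2 \<bullet> Y = 0" "Y \<bullet> N1 = 0" "Y \<bullet> N2 = 0" if "Y \<in> B" for Y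
    using bilin_eq_G[OF Bp(1)[OF that]] Bp(2)[OF that]
    by (simp_all add: N1_def N2_def complex_eq_iff inner_commute)
  have nB: "N1 \<notin> B" "N2 \<notin> insert N1 B" using NB N by fastforce+
  let ?C = "insert N2 (insert N1 B)"
  have "span ?C = p_alg"
  proof
    have "?C \<subseteq> p_alg" using Bp G_p_alg p_alg_scaleR unfolding N1_def N2_def by blast
    then show "span ?C \<subseteq> p_alg" using span_minimal subspace_p_alg by blast
    show "p_alg \<subseteq> span ?C"
    proof
      fix Y :: "'n cmat2" assume Y: "Y \<in> p_alg"
      let ?Z = "Y - (N1 \<bullet> Y) *\<^sub>R N1 - (N2 \<bullet> Y) *\<^sub>R N2"
      have Z: "?Z \<in> p_alg"
        unfolding N1_def N2_def
        by (intro subspace_diff[OF subspace_p_alg] Y p_alg_scaleR G_p_alg)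
      have "N1 \<bullet> ?Z = 0" "N2 \<bullet> ?Z = 0" using N by (simp_all add: inner_diff_right)
      then have "G1 \<bullet> ?Z = 0" "G2 \<bullet> ?Z = 0" using g(1) unfolding N1_def N2_def by simp_all
      then have "?Z \<in> span B" using bilin_eq_G[OF Z] Z B(2) by (simp add: complex_eq_iff)
      then have 1: "?Z \<in> span ?C" using span_mono[of B ?C] by blast
      have "?Z + (N1 \<bullet> Y) *\<^sub>R N1 + (N2 \<bullet> Y) *\<^sub>R N2 \<in> span ?C"
        by (intro span_add 1 span_scale span_base) auto
      then show "Y \<in> span ?C" by simp
    qed
  qed
  moreover have "\<forall>Y\<in>?C. \<forall>Y'\<in>?C. Y \<bullet> Y' = (if Y = Y' then 1 else 0)"
    using on N NB nB by auto
  ultimately obtain c where c: "(\<Sum>Y\<in>?C. Y ** Y) = c *\<^sub>R mat 1"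
    using casimir[of ?C] B(1) by blast
  let ?w = "Jn *v \<alpha>"
  have lin: "bilin \<beta> ((\<Sum>Y\<in>A. Y ** Y) *v ?w) = (\<Sum>Y\<in>A. bilin \<beta> ((Y ** Y) *v ?w))" if "finite A" for A
    using that by (induction A rule: finite_induct) (simp_all add: matrix_vector_mult_add_rdistrib bilin_add bilin_0)
  have "bilin \<beta> ?w = 0" using Jab bilin_commute by metis
  moreover have "(c *\<^sub>R mat 1) *v ?w = c *\<^sub>R ?w"
    by (simp add: scaleR_matrix_vector_mult)
  ultimately have "bilin \<beta> ((\<Sum>Y\<in>?C. Y ** Y) *v ?w) = 0" unfolding c by (simp add: bilin_scaleR)
  moreover have "(\<Sum>Y\<in>?C. Y ** Y) = (\<Sum>Y\<in>B. Y ** Y) + (1/(g*g)) *\<^sub>R (G1 ** G1 + G2 ** G2)"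
    using nB B(1) unfolding N1_def N2_def by (simp add: matrix_ring algebra_simps)
  moreover have "((1/(g*g)) *\<^sub>R (G1 ** G1 + G2 ** G2)) *v ?w = (1/(g*g)) *\<^sub>R ((G1 ** G1 + G2 ** G2) *v ?w)"
    by (rule scaleR_matrix_vector_mult)
  ultimately have "bilin \<beta> ((\<Sum>Y\<in>B. Y ** Y) *v ?w) = 0"
    using normal_contribution by (simp add: matrix_vector_mult_add_rdistrib bilin_add bilin_scaleR)
  then show ?thesis unfolding lin[OF B(1)] .
qed

end

section \<open>Charts given by linear functions of the complex structure\<close>

lemma matrix_mult_norm_bound:
  "\<exists>K>0. \<forall>(A :: complex^'m^'m) (B :: complex^'m^'m). norm (A ** B) \<le> norm A * norm B * K"
  by (rule bounded_bilinear.pos_bounded[OF bounded_bilinear_matrix_mult])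

lemma cstr_props:
  assumes z: "z \<in> SO_star"
  shows "cstr z ** cstr z = - mat 1" "transpose (cstr z) = - cstr z"
    "cnj_mat (cstr z) = - (Jn ** cstr z ** Jn)"
proof -
  show "cstr z ** cstr z = - mat 1"
    unfolding cstr_def by (simp add: matrix_ring SO_starD(1,6)[OF z] Jn_Jn')
  show "transpose (cstr z) = - cstr z"
    unfolding cstr_def by (simp add: matrix_conv transpose_Jn matrix_ring)
  have "cnj_mat (cstr z) = Jn ** z ** Jn ** Jn ** Jn ** transpose z ** Jn"
    unfolding cstr_def using SO_starD(8)[OF z] SO_starD(8)[OF transpose_SO_star[OF z]]
    by (simp add: cnj_mat_mult cnj_mat_Jn matrix_ring)
  then show "cnj_mat (cstr z) = - (Jn ** cstr z ** Jn)"
    unfolding cstr_def by (simp add: Jn_Jn' matrix_ring)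
qed

lemma linear_p_part: "linear p_part"
  by (rule linearI) (simp_all add: p_part_def pc_part_def matrix_conv matrix_ring algebra_simps)

lemma p_part_eq: "Y \<in> p_alg \<Longrightarrow> p_part Y = Y"
proof -
  assume Y: "Y \<in> p_alg"
  have d: "p_part Y - Y \<in> p_alg" by (rule subspace_diff[OF subspace_p_alg p_part_p_alg Y])
  have "(p_part Y - Y) \<bullet> (p_part Y - Y) = 0"
    unfolding inner_diff_left[of "p_part Y" Y] inner_p_part[OF d] by simp
  then show ?thesis by simp
qed

text \<open>Two points of \<open>M = range cstr\<close> near \<open>\<Phi>\<close> differ by a matrix anticommuting with their sum, which is
  close to \<open>2 *\<^sub>R \<Phi>\<close>; hence the difference is almost tangent to \<open>M\<close> at \<open>\<Phi>\<close>, and there \<open>\<Lambda>\<close> is injective.\<close>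

lemma linear_chart_injective:
  fixes z0 :: "('n::finite) cmat2"
  assumes z0: "z0 \<in> SO_star" and lin: "linear \<Lambda>"
    and \<Lambda>: "\<And>Y. Y \<in> p_alg \<Longrightarrow> \<Lambda> (z0 ** Y ** transpose z0) = Y"
  shows "\<exists>\<rho>>0. \<forall>z\<in>SO_star. \<forall>w\<in>SO_star. norm (cstr z - cstr z0) < \<rho> \<longrightarrow>
      norm (cstr w - cstr z0) < \<rho> \<longrightarrow> \<Lambda> (cstr z) = \<Lambda> (cstr w) \<longrightarrow> cstr z = cstr w"
proof -
  let ?\<Phi> = "cstr z0"
  note \<Phi> = cstr_props[OF z0]
  from matrix_mult_norm_bound obtain K where K: "K > 0"
    and K2: "\<forall>(A :: 'n cmat2) (B :: 'n cmat2). norm (A ** B) \<le> norm A * norm B * K" by blast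
  note K = K K2[rule_format]
  \<comment> \<open>\<open>T\<close> vanishes on the tangent space at \<open>?\<Phi>\<close>, where
    \<Lambda> inverts conjugation by \<open>z0\<close>. For the difference \<open>D\<close> below
    \<open>\<Lambda> D = 0\<close>, so \<open>T\<close> fixes \<open>D\<close> and only the part of
    \<open>D\<close> off the tangent space contributes.\<close>
  define T where "T = (\<lambda>M. M - z0 ** \<Lambda> M ** transpose z0)"
  have "linear T"
    unfolding T_def by (rule linearI) (simp_all add: linear_add[OF lin] linear_cmul[OF lin] matrix_ring algebra_simps)
  from linear_bounded_pos[OF this] obtain C where C0: "C > 0 \<and> (\<forall>M. norm (T M) \<le> C * norm M)" by blast
  then have C: "C > 0" "norm (T M) \<le> C * norm M" for M by auto
  \<comment> \<open>Chosen so that the final estimate reads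
    \<open>norm D \<le> norm D * (1/2)\<close>; the \<open>+ 1\<close> ensures positivity.\<close>
  define c where "c = C * (K * K * (norm ?\<Phi> + 1))"
  have c: "c > 0" unfolding c_def using C(1) K(1) by (intro mult_pos_pos) (auto intro: add_nonneg_pos)
  define \<rho> where "\<rho> = 1 / (2 * c)"
  have \<rho>: "\<rho> > 0" "\<rho> * c = 1/2" using c unfolding \<rho>_def by auto
  have "cstr z = cstr w" if z: "z \<in> SO_star" and w: "w \<in> SO_star" and nz: "norm (cstr z - ?\<Phi>) < \<rho>"
    and nw: "norm (cstr w - ?\<Phi>) < \<rho>" and e: "\<Lambda> (cstr z) = \<Lambda> (cstr w)" for z w
  proof -
    define D where "D = cstr z - cstr w"
    define \<delta> where "\<delta> = (cstr z - ?\<Phi>) + (cstr w - ?\<Phi>)"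
    \<comment> \<open>The projection of \<open>D\<close> onto matrices anticommuting with
      \<open>?\<Phi>\<close>. The error \<open>D - Dt\<close> is linear in \<open>D\<close> and in
      the small matrix \<delta>.\<close>
    define Dt where "Dt = (1/2) *\<^sub>R (D + ?\<Phi> ** D ** ?\<Phi>)"
    have D: "transpose D = - D" "cnj_mat D = - (Jn ** D ** Jn)"
      unfolding D_def using cstr_props[OF z] cstr_props[OF w] by (simp_all add: matrix_conv matrix_ring)
    have 1: "D ** (cstr z + cstr w) + (cstr z + cstr w) ** D = 0"
      unfolding D_def using cstr_props(1)[OF z] cstr_props(1)[OF w] by (simp add: matrix_ring)
    have 2: "cstr z + cstr w = 2 *\<^sub>R ?\<Phi> + \<delta>" unfolding \<delta>_def by (simp add: scaleR_2)
    define E where "E = D ** \<delta> + \<delta> ** D"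
    have "E + 2 *\<^sub>R (D ** ?\<Phi> + ?\<Phi> ** D) = 0"
      using 1 unfolding 2 E_def by (simp add: matrix_ring scaleR_add_right ac_simps)
    then have E: "E = - (2 *\<^sub>R (D ** ?\<Phi> + ?\<Phi> ** D))" by (simp only: eq_neg_iff_add_eq_0)
    have "D ** ?\<Phi> ** ?\<Phi> = - D"
      using arg_cong[OF \<Phi>(1), of "\<lambda>M. D ** M"] by (simp add: matrix_mul_assoc matrix_mult_minus_right)
    then have E\<Phi>: "E ** ?\<Phi> = 2 *\<^sub>R (D - ?\<Phi> ** D ** ?\<Phi>)"
      unfolding E by (simp add: matrix_ring scaleR_add_right scaleR_diff_right)
    have "D - (1/2) *\<^sub>R (D + X) = (1/4) *\<^sub>R (2 *\<^sub>R (D - X))" for X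
      by (rule euclidean_eqI) (simp add: inner_diff_left inner_add_left field_simps)
    then have Dc: "D - Dt = (1/4) *\<^sub>R ((D ** \<delta> + \<delta> ** D) ** ?\<Phi>)"
      unfolding Dt_def E_def[symmetric] E\<Phi> .
    have "Dt \<in> ctang ?\<Phi>"
    proof -
      have f: "?\<Phi> ** D ** ?\<Phi> ** ?\<Phi> = - (?\<Phi> ** D)"
        using arg_cong[OF \<Phi>(1), of "\<lambda>M. ?\<Phi> ** D ** M"] by (simp add: matrix_mul_assoc matrix_mult_minus_right)
      have f': "?\<Phi> ** ?\<Phi> ** D = - D" unfolding \<Phi>(1) by (simp add: matrix_mult_minus_left)
      have "cnj_mat (?\<Phi> ** D ** ?\<Phi>) = - (Jn ** (?\<Phi> ** D ** ?\<Phi>) ** Jn)"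
        unfolding cnj_mat_mult \<Phi>(3) D(2) by (simp add: matrix_ring Jn_Jn')
      then have "D + ?\<Phi> ** D ** ?\<Phi> \<in> ctang ?\<Phi>"
        unfolding ctang_def using D \<Phi>(2) f f' by (simp add: matrix_conv matrix_ring)
      then show ?thesis unfolding Dt_def by (rule subspace_scale[OF subspace_ctang])
    qed
    from ctang_conj[OF z0, of Dt] \<Lambda>[OF ctang_p_alg[OF z0 this]]
    have "Dt = z0 ** \<Lambda> Dt ** transpose z0" by simp
    moreover have "\<Lambda> D = 0" unfolding D_def using e by (simp add: linear_diff[OF lin])
    then have "\<Lambda> Dt = - \<Lambda> (D - Dt)" by (simp add: linear_diff[OF lin])
    ultimately have "D = T (D - Dt)" unfolding T_def by (simp add: matrix_ring)
    then have "norm D \<le> C * norm (D - Dt)" using C(2)[of "D - Dt"] by simp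
    also have "norm (D - Dt) \<le> norm D * norm \<delta> * K * (norm ?\<Phi> * K) / 2"
    proof -
      have "norm ((D ** \<delta> + \<delta> ** D) ** ?\<Phi>) \<le> norm (D ** \<delta> + \<delta> ** D) * norm ?\<Phi> * K" by (rule K(2))
      also have "norm (D ** \<delta> + \<delta> ** D) \<le> norm D * norm \<delta> * K + norm D * norm \<delta> * K"
        using norm_triangle_ineq[of "D ** \<delta>" "\<delta> ** D"] K(2)[of D \<delta>] K(2)[of \<delta> D] by (simp add: mult.commute)
      finally have "norm ((D ** \<delta> + \<delta> ** D) ** ?\<Phi>) \<le> 2 * (norm D * norm \<delta> * K * (norm ?\<Phi> * K))"
        using K(1) by (simp add: mult_right_mono algebra_simps)
      then show ?thesis unfolding Dc by simp
    qed
    finally have n: "norm D \<le> norm D * (norm \<delta> * (C * (K * K * norm ?\<Phi>)) / 2)"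
      using C(1) by (simp add: mult_ac)
    have "norm \<delta> < 2 * \<rho>" unfolding \<delta>_def using norm_triangle_ineq nz nw by (smt (verit))
    moreover have "C * (K * K * norm ?\<Phi>) \<le> c" unfolding c_def using C(1) K(1) by simp
    ultimately have "norm \<delta> * (C * (K * K * norm ?\<Phi>)) \<le> (2 * \<rho>) * c"
      using C(1) K(1) \<rho>(1) by (intro mult_mono) auto
    then have "norm \<delta> * (C * (K * K * norm ?\<Phi>)) / 2 \<le> 1/2" using \<rho>(2) by simp
    then have "norm D \<le> norm D * (1/2)" using n mult_left_mono[OF _ norm_ge_zero] by (meson order_trans)
    then show "cstr z = cstr w" unfolding D_def by simp
  qed
  then show ?thesis using \<rho>(1) by blast
qed

text \<open>Points near \<open>z0\<close> are reached by Cayley transforms of \<open>p_alg\<close>;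
  inverting \<Lambda> along them gives a coset together with an explicit representative, hence a
  smooth section.\<close>

lemma linear_chart_section:
  fixes z0 :: "('n::finite) cmat2"
  assumes z0: "z0 \<in> SO_star" and lin: "linear \<Lambda>" and rng: "\<And>M. \<Lambda> M \<in> p_alg"
    and \<Lambda>: "\<And>Y. Y \<in> p_alg \<Longrightarrow> \<Lambda> (z0 ** Y ** transpose z0) = Y"
  obtains V s where "open V" "\<Lambda> (cstr z0) \<in> V" "\<forall>k. Ck_on k V s" "s (\<Lambda> (cstr z0)) = z0"
    "\<forall>r\<in>p_alg \<inter> V. s r \<in> SO_star \<and> \<Lambda> (cstr (s r)) = r"
proof -
  have bl: "bounded_linear \<Lambda>" "bounded_linear p_part"
    using lin linear_p_part linear_conv_bounded_linear by blast+
  define dom where "dom = (p_part -` cayley_dom :: 'n cmat2 set)"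
  have pc: "continuous_on UNIV p_part" by (rule linear_continuous_on[OF bl(2)])
  have dom: "open dom" "0 \<in> dom"
    unfolding dom_def
    by (rule open_vimage[OF open_cayley_dom pc]) (simp add: linear_0[OF linear_p_part] zero_in_cayley_dom)
  define w where "w = (\<lambda>m. z0 ** cayley (p_part m))"
  \<comment> \<open>The term \<open>m - p_part m\<close> fills up the complement of
    \<open>p_alg\<close>, so that \<open>K\<close> is defined near 0 in the space of all matrices
    with invertible derivative there.\<close>
  define K where "K = (\<lambda>m. \<Lambda> (cstr (w m)) + (m - p_part m))"
  have Cw: "Ck_on k dom w" for k
    unfolding w_def
    by (intro Ck_on_matrix_mult Ck_on_const dom(1)
        Ck_on_compose[OF dom(1) open_cayley_dom Ck_on_bounded_linear[OF dom(1) bl(2)] Ck_on_cayley])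
      (auto simp: dom_def)
  have CK: "Ck_on k dom K" for k
    unfolding K_def
    by (intro Ck_on_add Ck_on_diff Ck_on_linear[OF dom(1) bl(1)] Ck_on_cstr Cw Ck_on_ident
        Ck_on_bounded_linear bl(2) dom(1))
  have w0: "w 0 = z0" unfolding w_def by (simp add: linear_0[OF linear_p_part] cayley_0)
  have K0: "K 0 = \<Lambda> (cstr z0)" unfolding K_def by (simp add: w0 linear_0[OF linear_p_part])
  have wS: "w m \<in> SO_star" if "m \<in> dom" for m
    unfolding w_def
    by (intro SO_star_mult z0 cayley_SO_star p_alg_so_alg p_part_p_alg) (use that in \<open>simp add: dom_def\<close>)
  let ?K' = "frechet_derivative K (at 0)"
  have dK: "(K has_derivative ?K') (at 0)" by (rule Ck_on_has_derivative[OF dom(1) CK dom(2)])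
  \<comment> \<open>The 4 is the 2 of the Cayley transform times the 2 of
    \<open>cstr_has_vector_derivative\<close>.\<close>
  have K': "?K' h = - (4 *\<^sub>R (Jn ** p_part h)) + (h - p_part h)" for h
  proof -
    let ?Y = "p_part h"
    have l: "((\<lambda>t. t *\<^sub>R h) has_vector_derivative h) (at 0)"
      by (auto intro!: derivative_eq_intros simp: has_vector_derivative_def)
    have 1: "((\<lambda>t. K (t *\<^sub>R h)) has_vector_derivative ?K' h) (at 0)"
      by (rule has_vector_derivative_chain[OF l]) (use dK in simp)
    have ct: "curve_through SO_star (\<lambda>t. z0 ** cayley (t *\<^sub>R ?Y)) z0 (2 *\<^sub>R (z0 ** ?Y))"
      by (rule curve_through_SO_star[OF z0 p_alg_so_alg[OF p_part_p_alg]])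
    have weq: "w (t *\<^sub>R h) = z0 ** cayley (t *\<^sub>R ?Y)" for t
      unfolding w_def by (simp add: linear_cmul[OF linear_p_part])
    have dw: "((\<lambda>t. w (t *\<^sub>R h)) has_vector_derivative 2 *\<^sub>R (z0 ** ?Y)) (at 0)"
      using ct unfolding weq curve_through_def by blast
    have X: "transpose (w (0 *\<^sub>R h)) ** (2 *\<^sub>R (z0 ** ?Y)) = 2 *\<^sub>R ?Y"
      by (simp add: w0 matrix_ring SO_starD(2)[OF z0])
    have so: "2 *\<^sub>R ?Y \<in> so_alg" by (rule so_alg_scaleR[OF p_alg_so_alg[OF p_part_p_alg]])
    have "((\<lambda>t. cstr (w (t *\<^sub>R h))) has_vector_derivative
      w (0 *\<^sub>R h) ** (- (Jn ** (2 *\<^sub>R ?Y - cnj_mat (2 *\<^sub>R ?Y)))) ** transpose (w (0 *\<^sub>R h))) (at 0)"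
      using cstr_has_vector_derivative[OF dw] unfolding X using so w0 z0 by simp
    moreover have "2 *\<^sub>R ?Y - cnj_mat (2 *\<^sub>R ?Y) = 4 *\<^sub>R ?Y"
      using p_part_p_alg[of h] by (simp add: p_alg_def matrix_conv flip: scaleR_add_left)
    ultimately have "((\<lambda>t. cstr (w (t *\<^sub>R h))) has_vector_derivative
      z0 ** (- (4 *\<^sub>R (Jn ** ?Y))) ** transpose z0) (at 0)"
      using w0 by (simp add: matrix_ring)
    then have "((\<lambda>t. \<Lambda> (cstr (w (t *\<^sub>R h)))) has_vector_derivative
      \<Lambda> (z0 ** (- (4 *\<^sub>R (Jn ** ?Y))) ** transpose z0)) (at 0)"
      by (rule has_vector_derivative_linear_map[OF _ bl(1)])
    moreover have "- (4 *\<^sub>R (Jn ** ?Y)) \<in> p_alg"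
      by (intro subspace_neg[OF subspace_p_alg] p_alg_scaleR Jn_p_alg p_part_p_alg)
    ultimately have 2: "((\<lambda>t. \<Lambda> (cstr (w (t *\<^sub>R h)))) has_vector_derivative - (4 *\<^sub>R (Jn ** ?Y))) (at 0)"
      using \<Lambda> by simp
    have 3: "((\<lambda>t. t *\<^sub>R h - p_part (t *\<^sub>R h)) has_vector_derivative h - ?Y) (at 0)"
      by (intro has_vector_derivative_diff l has_vector_derivative_linear_map[OF l bl(2)])
    have "((\<lambda>t. K (t *\<^sub>R h)) has_vector_derivative - (4 *\<^sub>R (Jn ** ?Y)) + (h - ?Y)) (at 0)"
      unfolding K_def by (rule has_vector_derivative_add[OF 2 3])
    from vector_derivative_unique_at[OF 1 this] show ?thesis .
  qed
  have inj: "inj ?K'"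
  proof (rule linear_injective_0[OF has_derivative_linear[OF dK], THEN iffD2], intro allI impI)
    fix h assume "?K' h = 0"
    then have *: "- (4 *\<^sub>R (Jn ** p_part h)) + (h - p_part h) = 0" using K' by simp
    have "p_part (- (4 *\<^sub>R (Jn ** p_part h)) + (h - p_part h)) = - (4 *\<^sub>R (Jn ** p_part h))"
      by (simp add: linear_add[OF linear_p_part] linear_diff[OF linear_p_part] linear_neg[OF linear_p_part]
          linear_cmul[OF linear_p_part] p_part_eq[OF p_part_p_alg] p_part_eq[OF Jn_p_alg[OF p_part_p_alg]])
    then have "Jn ** p_part h = 0" unfolding * linear_0[OF linear_p_part] by simp
    then have "Jn ** (Jn ** p_part h) = 0" by simp
    then have "p_part h = 0" unfolding matrix_mul_assoc Jn_Jn by (simp add: matrix_ring)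
    then show "h = 0" using * by simp
  qed
  obtain U' V g where g: "open U'" "U' \<subseteq> dom" "0 \<in> U'" "open V" "K 0 \<in> V" "homeomorphism U' V K g"
    "\<forall>k. Ck_on k V g"
    by (rule smooth_inverse_function[OF dom CK inj]) (rule that, assumption+, simp)
  have gr: "g r \<in> U'" "K (g r) = r" if "r \<in> V" for r
    using g(6) that unfolding homeomorphism_def by auto
  have g0: "g (K 0) = 0" using g(3,6) unfolding homeomorphism_def by auto
  define s where "s = (\<lambda>r. w (g r))"
  have "Ck_on k V s" for k
    unfolding s_def by (rule Ck_on_compose[OF g(4) dom(1) g(7)[rule_format] Cw]) (use gr g(2) in auto)
  moreover have "s r \<in> SO_star \<and> \<Lambda> (cstr (s r)) = r" if r: "r \<in> p_alg \<inter> V" for r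
  proof
    have rV: "r \<in> V" using r by blast
    show "s r \<in> SO_star" unfolding s_def using wS gr(1)[OF rV] g(2) by blast
    have e: "\<Lambda> (cstr (w (g r))) + (g r - p_part (g r)) = r" using gr(2)[OF rV] unfolding K_def .
    then have "g r - p_part (g r) = r - \<Lambda> (cstr (w (g r)))" by (simp add: algebra_simps)
    moreover have "r - \<Lambda> (cstr (w (g r))) \<in> p_alg"
      using subspace_diff[OF subspace_p_alg] r rng by blast
    ultimately have "g r - p_part (g r) \<in> p_alg" by simp
    \<comment> \<open>For \<open>r\<close> in \<open>p_alg\<close> the complementary term lies in
      \<open>p_alg\<close> as well as in the kernel of \<open>p_part\<close>.\<close>
    from p_part_eq[OF this] have "g r - p_part (g r) = 0"
      by (simp add: linear_diff[OF linear_p_part] p_part_eq[OF p_part_p_alg])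
    then show "\<Lambda> (cstr (s r)) = r" using e unfolding s_def by simp
  qed
  ultimately show ?thesis using that[of V s] g(4,5) K0 g0 w0 unfolding s_def by simp
qed

lemma continuous_on_cstr: "continuous_on S (cstr :: ('a::finite) cmat2 \<Rightarrow> 'a cmat2)"
proof -
  have "Ck_on 0 UNIV (cstr :: 'a cmat2 \<Rightarrow> _)"
    by (rule Ck_on_cstr[OF open_UNIV Ck_on_ident[OF open_UNIV]])
  then have "continuous_on UNIV (cstr :: 'a cmat2 \<Rightarrow> _)" by simp
  then show ?thesis by (rule continuous_on_subset) simp
qed

text \<open>Any linear map inverting the tangent parametrisation at \<open>z0\<close> is a
  coordinate system nearby. The freedom in choosing \<Lambda> is what makes slice charts
  available.\<close>

lemma linear_chart:
  fixes z0 :: "('n::finite) cmat2"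
  assumes z0: "z0 \<in> SO_star" and lin: "linear \<Lambda>" and rng: "\<And>M. \<Lambda> M \<in> p_alg"
    and \<Lambda>: "\<And>Y. Y \<in> p_alg \<Longrightarrow> \<Lambda> (z0 ** Y ** transpose z0) = Y"
  obtains U where "(U, \<lambda>p. \<Lambda> (coset_cstr p)) \<in> SOU_atlas" "coset z0 \<in> U"
proof -
  from linear_chart_injective[OF z0 lin \<Lambda>]
  obtain \<rho> where \<rho>0: "\<rho> > 0" and \<rho>1: "\<forall>z\<in>SO_star. \<forall>w\<in>SO_star. norm (cstr z - cstr z0) < \<rho> \<longrightarrow>
      norm (cstr w - cstr z0) < \<rho> \<longrightarrow> \<Lambda> (cstr z) = \<Lambda> (cstr w) \<longrightarrow> cstr z = cstr w" by blast
  note \<rho> = \<rho>0 \<rho>1[rule_format]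
  obtain V s where V: "open V" "\<Lambda> (cstr z0) \<in> V" "\<forall>k. Ck_on k V s" "s (\<Lambda> (cstr z0)) = z0"
    "\<forall>r\<in>p_alg \<inter> V. s r \<in> SO_star \<and> \<Lambda> (cstr (s r)) = r"
    by (rule linear_chart_section[OF z0 lin rng \<Lambda>])
  have bl: "bounded_linear \<Lambda>" using lin linear_conv_bounded_linear by blast
  \<comment> \<open>Keeps the section inside the ball on which \<Lambda> is injective, so that the
    image of the chart is exactly \<open>p_alg \<inter> V0\<close>.\<close>
  define V0 where "V0 = {r \<in> V. cstr (s r) \<in> ball (cstr z0) \<rho>}"
  have "continuous_on V (\<lambda>r. cstr (s r))"
    using Ck_on_imp_continuous_on[OF Ck_on_cstr[OF V(1)]] V(3) by blast
  then have V0: "open V0"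
    using continuous_open_preimage[OF _ V(1), of "\<lambda>r. cstr (s r)" "ball (cstr z0) \<rho>"]
    unfolding V0_def by (simp add: vimage_def Int_def)
  have z0V: "\<Lambda> (cstr z0) \<in> V0" unfolding V0_def using V(2,4) \<rho>(1) by simp
  define P where "P = (\<lambda>\<Phi>. norm (\<Phi> - cstr z0) < \<rho> \<and> \<Lambda> \<Phi> \<in> V0)"
  define U where "U = coset ` {z \<in> SO_star. P (cstr z)}"
  let ?x = "\<lambda>p. \<Lambda> (coset_cstr p)"
  have mem: "coset z \<in> U \<longleftrightarrow> P (cstr z)" if "z \<in> SO_star" for z
    unfolding U_def using coset_eq_iff[OF that] that by (auto simp: image_iff)
  have pre: "{z \<in> SO_star. coset z \<in> U} = {z \<in> SO_star. P (cstr z)}" using mem by blast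
  have xz: "?x (coset z) = \<Lambda> (cstr z)" if "z \<in> SO_star" for z using coset_cstr_coset[OF that] by simp
  have sec: "s r \<in> SO_star" "coset (s r) \<in> U" "?x (coset (s r)) = r" if "r \<in> p_alg" "r \<in> V0" for r
  proof -
    have rV: "r \<in> p_alg \<inter> V" using that unfolding V0_def by blast
    then show 1: "s r \<in> SO_star" using V(5) by blast
    show "?x (coset (s r)) = r" using V(5) rV xz[OF 1] by simp
    show "coset (s r) \<in> U"
      unfolding mem[OF 1] P_def using V(5) rV that(2) by (auto simp: V0_def dist_norm norm_minus_commute)
  qed
  have img: "?x ` U = p_alg \<inter> V0"
  proof
    show "?x ` U \<subseteq> p_alg \<inter> V0" unfolding U_def using rng xz by (auto simp: P_def)
    show "p_alg \<inter> V0 \<subseteq> ?x ` U"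
    proof
      fix r assume "r \<in> p_alg \<inter> V0"
      then have "coset (s r) \<in> U" "r = ?x (coset (s r))" using sec(2,3)[of r] by simp_all
      then show "r \<in> ?x ` U" by (rule rev_image_eqI)
    qed
  qed
  have "(U, ?x) \<in> SOU_atlas"
    unfolding SOU_atlas_def SOU_model_eq mem_Collect_eq prod.case
  proof (intro conjI ballI)
    show "U \<subseteq> SOU" unfolding U_def SOU_def by blast
    show "inj_on ?x U"
    proof (rule inj_onI)
      fix p q assume pq: "p \<in> U" "q \<in> U" "?x p = ?x q"
      then obtain z w where zw: "z \<in> SO_star" "P (cstr z)" "p = coset z" "w \<in> SO_star" "P (cstr w)" "q = coset w"
        unfolding U_def by blast
      have "cstr z = cstr w"
        by (rule \<rho>(2)) (use zw pq(3) xz in \<open>auto simp: P_def\<close>)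
      then show "p = q" using zw coset_eq_iff by blast
    qed
    show "openin (top_of_set SO_star) {z \<in> SO_star. coset z \<in> U}"
    proof -
      have c: "continuous_on UNIV (\<lambda>z. norm (cstr z - cstr z0))" "continuous_on UNIV (\<lambda>z. \<Lambda> (cstr z))"
        by (intro continuous_intros continuous_on_cstr linear_continuous_on_compose[OF continuous_on_cstr lin])+
      have "open ((\<lambda>z. norm (cstr z - cstr z0)) -` {..<\<rho>} \<inter> (\<lambda>z. \<Lambda> (cstr z)) -` V0)"
        by (intro open_Int open_vimage c V0 open_lessThan)
      moreover have "{z \<in> SO_star. P (cstr z)} =
          SO_star \<inter> ((\<lambda>z. norm (cstr z - cstr z0)) -` {..<\<rho>} \<inter> (\<lambda>z. \<Lambda> (cstr z)) -` V0)"
        unfolding P_def by auto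
      ultimately show ?thesis unfolding pre by (simp only: openin_open_Int)
    qed
    show "openin (top_of_set p_alg) (?x ` U)" unfolding img using V0 by (rule openin_open_Int)
    show "smooth_on {z \<in> SO_star. coset z \<in> U} (?x \<circ> coset)"
    proof (rule smooth_onI_open[of UNIV "\<lambda>z. \<Lambda> (cstr z)"])
      show "Ck_on k UNIV (\<lambda>z. \<Lambda> (cstr z))" for k
        by (rule Ck_on_linear[OF open_UNIV bl Ck_on_cstr[OF open_UNIV Ck_on_ident[OF open_UNIV]]])
    qed (simp_all add: xz)
    fix q assume "q \<in> ?x ` U"
    have "smooth_on (p_alg \<inter> V0) s"
      by (rule smooth_onI_open[of V s]) (use V(1,3) in \<open>auto simp: V0_def\<close>)
    then show "\<exists>V s. q \<in> V \<and> V \<subseteq> ?x ` U \<and> openin (top_of_set p_alg) V \<and> smooth_on V s \<and>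
        (\<forall>r\<in>V. s r \<in> SO_star \<and> coset (s r) \<in> U \<and> ?x (coset (s r)) = r)"
      using \<open>q \<in> ?x ` U\<close> openin_open_Int[OF V0, of p_alg] unfolding img
      by (intro exI[of _ "p_alg \<inter> V0"] exI[of _ s] conjI ballI) (simp_all add: sec)
  qed
  moreover have "coset z0 \<in> U" unfolding mem[OF z0] P_def using \<rho>(1) z0V by simp
  ultimately show ?thesis using that by blast
qed

section \<open>Slice charts of the zero set\<close>

lemma phi_eq:
  assumes "z \<in> SO_star"
  shows "phi a b (coset z) = bilin b (cstr z *v a)"
  unfolding phi_coset[OF assms] cstr_def trace_outer[symmetric] by (simp add: matrix_mul_assoc)

lemma phi_eq': "p \<in> SOU \<Longrightarrow> phi a b p = bilin b (coset_cstr p *v a)"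
  unfolding SOU_def using phi_eq coset_cstr_coset by (metis (no_types, lifting) imageE)

lemma bilin_conj: "bilin b ((z ** M ** transpose z) *v a) = bilin (transpose z *v b) (M *v (transpose z *v a))"
  using bilin_mult_transpose[of b z "M *v (transpose z *v a)"]
  by (simp add: matrix_vector_mul_assoc matrix_mul_assoc)

lemma isotropic_pair_translate:
  assumes "bilin a a = 0" "bilin a b = 0" "bilin b b \<noteq> 0" "a \<noteq> 0"
    and z: "z \<in> SO_star" and 0: "bilin b (cstr z *v a) = 0"
  shows "isotropic_pair (transpose z *v a) (transpose z *v b)"
proof
  show "bilin (transpose z *v a) (transpose z *v a) = 0" "bilin (transpose z *v a) (transpose z *v b) = 0"
    "bilin (transpose z *v b) (transpose z *v b) \<noteq> 0"
    unfolding bilin_SO_star[OF z] using assms by auto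
  show "bilin (Jn *v (transpose z *v a)) (transpose z *v b) = 0"
    using 0 unfolding cstr_def bilin_conj by (metis bilin_commute)
  show "transpose z *v a \<noteq> 0"
  proof
    assume "transpose z *v a = 0"
    then have "z *v (transpose z *v a) = 0" by simp
    then show False using \<open>a \<noteq> 0\<close> SO_starD(1)[OF z]
      by (simp add: matrix_vector_mul_assoc)
  qed
qed

text \<open>In the coordinates given by projecting to \<open>p_alg\<close>, the components along the
  two gradients are replaced by the real and imaginary parts of \<open>phi\<close>. As
  \<open>phi\<close> is linear in the complex structure, the chart remains linear and the zero set
  is exactly a coordinate slice.\<close>

lemma slice_chart_exists:
  fixes a b :: "('n::finite) cvec2"
  assumes ab: "bilin a a = 0" "bilin a b = 0" "bilin b b \<noteq> 0" "a \<noteq> 0"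
    and z: "z \<in> SO_star" and 0: "bilin b (cstr z *v a) = 0"
  obtains U \<Lambda> L where "slice_chart p_alg SOU_atlas (phi a b -` {0} \<inter> SOU) (U, \<lambda>p. \<Lambda> (coset_cstr p)) L"
    "coset z \<in> U" "dim L + 2 = dim (p_alg :: 'n cmat2 set)" "linear \<Lambda>"
    "\<And>Y. Y \<in> p_alg \<Longrightarrow> \<Lambda> (z ** Y ** transpose z) = Y"
    "L = {Y \<in> p_alg. bilin (transpose z *v b) (Y *v (transpose z *v a)) = 0}"
proof -
  interpret isotropic_pair "transpose z *v a" "transpose z *v b"
    by (rule isotropic_pair_translate[OF ab z 0])
  define g where "g = G1 \<bullet> G1"
  have g: "g > 0" "G1 \<bullet> G1 = g" "G2 \<bullet> G2 = g" "G1 \<bullet> G2 = 0" "G2 \<bullet> G1 = 0"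
    using G_inner by (auto simp: g_def inner_commute)
  define f where "f = (\<lambda>M. bilin b (M *v a))"
  define pm where "pm = (\<lambda>M. p_part (transpose z ** M ** z))"
  \<comment> \<open>Dividing by the common squared length \<open>g\<close> makes
    \<open>G1 \<bullet> \<Lambda> M\<close> and \<open>G2 \<bullet> \<Lambda> M\<close> the real and
    imaginary parts of \<open>f M\<close>. On tangent vectors at \<open>z\<close> both corrections
    vanish.\<close>
  define \<Lambda> where "\<Lambda> = (\<lambda>M. pm M + ((Re (f M) - pm M \<bullet> G1) / g) *\<^sub>R G1 + ((Im (f M) - pm M \<bullet> G2) / g) *\<^sub>R G2)"
  have pml: "pm (M + M') = pm M + pm M'" "pm (r *\<^sub>R M) = r *\<^sub>R pm M" for M M' r
    unfolding pm_def by (simp_all add: matrix_ring linear_add[OF linear_p_part] linear_cmul[OF linear_p_part])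
  have fl: "f (M + M') = f M + f M'" "f (r *\<^sub>R M) = r *\<^sub>R f M" for M M' r
    unfolding f_def by (simp_all add: matrix_vector_mult_add_rdistrib bilin_add scaleR_matrix_vector_mult bilin_scaleR)
  have lin: "linear \<Lambda>"
    unfolding \<Lambda>_def
    by (rule linearI) (simp_all add: pml fl inner_add_left add_divide_distrib diff_divide_distrib algebra_simps)
  have rng: "\<Lambda> M \<in> p_alg" for M
    unfolding \<Lambda>_def pm_def by (intro subspace_add[OF subspace_p_alg] p_alg_scaleR G_p_alg p_part_p_alg)
  have \<Lambda>1: "\<Lambda> (z ** Y ** transpose z) = Y" if Y: "Y \<in> p_alg" for Y
  proof -
    have "transpose z ** (z ** Y ** transpose z) ** z = Y"
      by (simp add: matrix_mul_assoc SO_starD(2,6)[OF z])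
    then have "pm (z ** Y ** transpose z) = Y" unfolding pm_def using p_part_eq[OF Y] by simp
    moreover have "f (z ** Y ** transpose z) = Complex (G1 \<bullet> Y) (G2 \<bullet> Y)"
      unfolding f_def bilin_conj by (rule bilin_eq_G[OF Y])
    ultimately show ?thesis unfolding \<Lambda>_def by (simp add: inner_commute)
  qed
  obtain U where U: "(U, \<lambda>p. \<Lambda> (coset_cstr p)) \<in> SOU_atlas" "coset z \<in> U"
    by (rule linear_chart[OF z lin rng \<Lambda>1])
  define L where "L = {Y \<in> p_alg. bilin (transpose z *v b) (Y *v (transpose z *v a)) = 0}"
  have L: "Y \<in> L \<longleftrightarrow> Y \<in> p_alg \<and> G1 \<bullet> Y = 0 \<and> G2 \<bullet> Y = 0" for Y
    unfolding L_def using bilin_eq_G[of Y] by (auto simp: complex_eq_iff)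
  have subL: "subspace L"
    by (rule subspaceI)
      (simp_all add: L subspace_0[OF subspace_p_alg] subspace_add[OF subspace_p_alg] p_alg_scaleR inner_add_right)
  have \<Lambda>L: "\<Lambda> M \<in> L \<longleftrightarrow> f M = 0" for M
  proof -
    have "G1 \<bullet> \<Lambda> M = Re (f M)" "G2 \<bullet> \<Lambda> M = Im (f M)"
      unfolding \<Lambda>_def using g by (simp_all add: inner_add_right inner_commute[of "pm M"])
    then show ?thesis unfolding L using rng by (simp add: complex_eq_iff)
  qed
  have USOU: "U \<subseteq> SOU" by (rule SOU_atlasD(1)[OF U(1)])
  have mem: "\<Lambda> (coset_cstr p) \<in> L \<longleftrightarrow> phi a b p = 0" if "p \<in> U" for p
    unfolding \<Lambda>L f_def phi_eq'[OF subsetD[OF USOU that]] by (rule refl)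
  have "slice_chart p_alg SOU_atlas (phi a b -` {0} \<inter> SOU) (U, \<lambda>p. \<Lambda> (coset_cstr p)) L"
    unfolding slice_chart_def fst_conv snd_conv
  proof (intro conjI)
    show "L \<subseteq> p_alg" unfolding L_def by blast
    show "(\<lambda>p. \<Lambda> (coset_cstr p)) ` (U \<inter> (phi a b -` {0} \<inter> SOU)) = (\<lambda>p. \<Lambda> (coset_cstr p)) ` U \<inter> L"
      using mem USOU by auto
  qed (use U subL in auto)
  moreover have "dim L + 2 = dim (p_alg :: 'n cmat2 set)"
  proof -
    have ne: "G1 \<noteq> 0" "G2 \<noteq> 0" "G1 \<noteq> G2"
    proof -
      show "G1 \<noteq> 0" by (rule notI) (use g(1,2) in simp)
      show "G2 \<noteq> 0" by (rule notI) (use g(1,3) in simp)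
      show "G1 \<noteq> G2" by (rule notI) (use g(1,3,4) in simp)
    qed
    have "independent {G1, G2}"
      by (rule pairwise_orthogonal_independent)
        (use ne(1,2) in \<open>simp_all add: pairwise_insert orthogonal_def g(4,5)\<close>)
    then have d: "dim (span {G1, G2}) = 2" using ne(3) by (simp add: dim_eq_card_independent)
    have "L = {y \<in> p_alg. \<forall>x\<in>span {G1, G2}. orthogonal x y}"
    proof (intro set_eqI iffI)
      fix y assume y: "y \<in> L"
      have "orthogonal y x" if "x \<in> span {G1, G2}" for x
        by (rule orthogonal_to_span[OF that]) (use y L in \<open>auto simp: orthogonal_def inner_commute\<close>)
      then show "y \<in> {y \<in> p_alg. \<forall>x\<in>span {G1, G2}. orthogonal x y}"
        using y L orthogonal_commute by blast
    next
      fix y assume y: "y \<in> {y \<in> p_alg. \<forall>x\<in>span {G1, G2}. orthogonal x y}"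
      have "G1 \<in> span {G1, G2}" "G2 \<in> span {G1, G2}" by (auto intro: span_base)
      then show "y \<in> L" using y unfolding L orthogonal_def by blast
    qed
    then show ?thesis
      using dim_subspace_orthogonal_to_vectors[OF subspace_span subspace_p_alg, of "{G1, G2}"] d
        span_minimal[OF _ subspace_p_alg, of "{G1, G2}"] G_p_alg by simp
  qed
  ultimately show ?thesis using that U(2) lin \<Lambda>1 L_def by blast
qed

lemma submanifold_zero_set:
  fixes a b :: "('n::finite) cvec2"
  assumes ab: "bilin a a = 0" "bilin a b = 0" "bilin b b \<noteq> 0" "a \<noteq> 0"
  shows "submanifold_of_codim p_alg SOU_atlas (phi a b -` {0} \<inter> SOU) 2"
  unfolding submanifold_of_codim_def
proof
  fix p assume p: "p \<in> phi a b -` {0} \<inter> SOU"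
  then obtain z where z: "z \<in> SO_star" "p = coset z" unfolding SOU_def by blast
  then have "bilin b (cstr z *v a) = 0" using p phi_eq[OF z(1)] by auto
  then obtain U \<Lambda> L where "slice_chart p_alg SOU_atlas (phi a b -` {0} \<inter> SOU) (U, \<lambda>p. \<Lambda> (coset_cstr p)) L"
    "coset z \<in> U" "dim L + 2 = dim (p_alg :: 'n cmat2 set)"
    by (rule slice_chart_exists[OF ab z(1)])
  then show "\<exists>X L. slice_chart p_alg SOU_atlas (phi a b -` {0} \<inter> SOU) X L \<and> p \<in> fst X \<and> dim L + 2 = dim (p_alg :: 'n cmat2 set)"
    unfolding z(2) by (intro exI[of _ "(U, \<lambda>p. \<Lambda> (coset_cstr p))"] exI[of _ L]) simp
qed

section \<open>The Levi-Civita connection and minimality\<close>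

lemma trace_linear: "linear (trace :: complex^'m^'m \<Rightarrow> complex)"
  using bounded_linear_trace bounded_linear.linear by blast

lemma bounded_linear_bilin_mult: "bounded_linear (\<lambda>M. bilin b (M *v a))"
  unfolding linear_conv_bounded_linear[symmetric]
  by (rule linearI) (simp_all add: matrix_vector_mult_add_rdistrib bilin_add scaleR_matrix_vector_mult bilin_scaleR)

text \<open>Conjugation by \<Phi> fixes \<open>A\<close> and negates \<open>B\<close>, so the trace
  equals its own negative. Applied to \<open>D r e ** D r e ** F r\<close>, this says that the
  quadratic term is normal to the orbit.\<close>

lemma Re_trace_commuting_anticommuting:
  assumes \<Phi>: "\<Phi> ** \<Phi> = - mat 1" and A: "A ** \<Phi> = \<Phi> ** A" and B: "B ** \<Phi> = - (\<Phi> ** B)"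
  shows "trace (A ** B) = (0 :: complex)"
proof -
  have "trace (A ** B) = - trace (\<Phi> ** \<Phi> ** (A ** B))"
    unfolding \<Phi> by (simp add: matrix_mult_minus_left linear_neg[OF trace_linear])
  also have "trace (\<Phi> ** \<Phi> ** (A ** B)) = trace (\<Phi> ** (A ** B) ** \<Phi>)"
    using trace_mul_sym[of \<Phi> "\<Phi> ** (A ** B)"] by (simp add: matrix_mul_assoc)
  also have "\<Phi> ** (A ** B) ** \<Phi> = A ** \<Phi> ** (B ** \<Phi>)" unfolding A by (simp add: matrix_mul_assoc)
  also have "\<dots> = - (A ** (\<Phi> ** \<Phi>) ** B)" unfolding B by (simp add: matrix_mult_minus_right matrix_mul_assoc)
  also have "\<dots> = A ** B" unfolding \<Phi> by (simp add: matrix_mult_minus_right matrix_mult_minus_left)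
  finally have "2 * trace (A ** B) = 0" by simp
  then show ?thesis by simp
qed

lemma anticommute_square:
  fixes A B :: "complex^'m^'m"
  assumes "A ** B = - (B ** A)"
  shows "A ** A ** B = B ** (A ** A)"
proof -
  have "A ** A ** B = A ** (A ** B)" by (simp only: matrix_mul_assoc)
  also have "\<dots> = - (A ** B ** A)" by (simp only: assms matrix_mult_minus_right matrix_mul_assoc)
  also have "\<dots> = - (- (B ** A) ** A)" by (simp only: assms)
  also have "\<dots> = B ** (A ** A)" by (simp add: matrix_mult_minus_left matrix_mul_assoc)
  finally show ?thesis .
qed

context sou_section
begin

definition "DD v r = frechet_derivative (\<lambda>r. D r v) (at r)"

lemma Ck_D: "Ck_on k W (\<lambda>r. D r v)"
  using Ck_F[of "Suc k"] unfolding D_def by simp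

lemma D_has_derivative: "r \<in> W \<Longrightarrow> ((\<lambda>r. D r v) has_derivative DD v r) (at r)"
  unfolding DD_def by (rule Ck_on_has_derivative[OF open_W Ck_D])

lemma DD_symmetric: "r \<in> W \<Longrightarrow> DD v r w = DD w r v"
  unfolding DD_def D_def by (rule second_derivative_symmetric[OF open_W _ Ck_F])

lemma D_line_derivative:
  assumes "r \<in> W"
  shows "((\<lambda>t. D (r + t *\<^sub>R a) v) has_vector_derivative DD v r a) (at 0)"
  by (rule has_vector_derivative_chain[OF line_derivative]) (use D_has_derivative assms in simp)

lemma metric_derivative:
  assumes r: "r \<in> W" "r \<in> p_alg" and v: "a \<in> p_alg" "b \<in> p_alg" "c \<in> p_alg"
  shows "deriv (\<lambda>t. SOU_metric (U, x) (r + t *\<^sub>R a) b c) 0 =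
    Re (trace (DD b r a ** D r c + D r b ** DD c r a)) / 4"
proof -
  obtain T where T: "open T" "(0::real) \<in> T" "\<forall>t\<in>T. r + t *\<^sub>R a \<in> W \<and> r + t *\<^sub>R a \<in> p_alg"
    by (rule line_near[OF r v(1)])
  have bl: "bounded_linear (\<lambda>M :: 'n cmat2. Re (trace M) / 4)"
    by (rule bounded_linear_compose[OF bounded_linear_divide
        bounded_linear_compose[OF bounded_linear_Re bounded_linear_trace]])
  have "((\<lambda>t. D (r + t *\<^sub>R a) b ** D (r + t *\<^sub>R a) c) has_vector_derivative
      D (r + 0 *\<^sub>R a) b ** DD c r a + DD b r a ** D (r + 0 *\<^sub>R a) c) (at 0)"
    by (intro has_vector_derivative_matrix_mult D_line_derivative r)
  then have "((\<lambda>t. Re (trace (D (r + t *\<^sub>R a) b ** D (r + t *\<^sub>R a) c)) / 4) has_vector_derivative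
      Re (trace (D (r + 0 *\<^sub>R a) b ** DD c r a + DD b r a ** D (r + 0 *\<^sub>R a) c)) / 4) (at 0)"
    by (rule has_vector_derivative_linear_map[OF _ bl])
  then have "((\<lambda>t. SOU_metric (U, x) (r + t *\<^sub>R a) b c) has_vector_derivative
      Re (trace (D (r + 0 *\<^sub>R a) b ** DD c r a + DD b r a ** D (r + 0 *\<^sub>R a) c)) / 4) (at 0)"
    by (rule has_vector_derivative_transform_within_open[OF _ T(1,2)])
      (use T(3) SOU_metric_eq v in simp)
  then have "((\<lambda>t. SOU_metric (U, x) (r + t *\<^sub>R a) b c) has_real_derivative
      Re (trace (DD b r a ** D r c + D r b ** DD c r a)) / 4) (at 0)"
    by (simp add: has_real_derivative_iff_has_vector_derivative add.commute)
  then show ?thesis by (rule DERIV_imp_deriv)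
qed

lemma F_square: "r \<in> W \<Longrightarrow> r \<in> p_alg \<Longrightarrow> F r ** F r = - mat 1"
  unfolding F_def using cstr_props(1) local_sectionD(3)[OF sec] by blast

text \<open>Differentiating \<open>A ** \<Phi> = - (\<Phi> ** A)\<close> along a coordinate line
  shows that the second derivative has anticommutator \<open>- 2 A ** A\<close> with \<Phi>. The
  subtracted term has the same anticommutator, so the difference anticommutes with \<Phi>.\<close>

lemma covariant_ctang:
  assumes r: "r \<in> W" "r \<in> p_alg" and e: "e \<in> p_alg"
  shows "DD e r e - D r e ** D r e ** F r \<in> ctang (F r)"
proof -
  obtain T where T: "open T" "(0::real) \<in> T" "\<forall>t\<in>T. r + t *\<^sub>R e \<in> W \<and> r + t *\<^sub>R e \<in> p_alg"
    by (rule line_near[OF r e])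
  let ?A = "\<lambda>t. D (r + t *\<^sub>R e) e" and ?\<Phi> = "\<lambda>t. F (r + t *\<^sub>R e)"
  let ?S = "DD e r e" and ?a = "D r e" and ?f = "F r"
  have ct: "?A t \<in> ctang (?\<Phi> t)" if "t \<in> T" for t using D_ctang e T(3) that by blast
  have dA: "(?A has_vector_derivative ?S) (at 0)" by (rule D_line_derivative[OF r(1)])
  have d\<Phi>: "(?\<Phi> has_vector_derivative ?a) (at 0)"
    by (rule has_vector_derivative_chain[OF line_derivative]) (use F_has_derivative r in simp)
  have 1: "transpose ?S = - ?S"
    by (rule has_vector_derivative_eq_locally[OF has_vector_derivative_linear_map[OF dA bounded_linear_transpose]
          has_vector_derivative_minus[OF dA] T(1,2)])
      (use ct in \<open>simp add: ctang_def\<close>)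
  have 2: "cnj_mat ?S = - (Jn ** ?S ** Jn)"
  proof -
    have "((\<lambda>t. - (Jn ** ?A t ** Jn)) has_vector_derivative
        - (Jn ** ?A 0 ** 0 + (Jn ** ?S + 0 ** ?A 0) ** Jn)) (at 0)"
      by (intro has_vector_derivative_minus has_vector_derivative_matrix_mult has_vector_derivative_const dA)
    from has_vector_derivative_eq_locally[OF has_vector_derivative_linear_map[OF dA bounded_linear_cnj_mat] this T(1,2)]
    show ?thesis using ct by (simp add: ctang_def)
  qed
  have 3: "?a ** ?a + ?S ** ?f = - (?f ** ?S + ?a ** ?a)"
  proof -
    have "((\<lambda>t. ?A t ** ?\<Phi> t) has_vector_derivative ?A 0 ** ?a + ?S ** ?\<Phi> 0) (at 0)"
      by (intro has_vector_derivative_matrix_mult dA d\<Phi>)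
    moreover have "((\<lambda>t. - (?\<Phi> t ** ?A t)) has_vector_derivative - (?\<Phi> 0 ** ?S + ?a ** ?A 0)) (at 0)"
      by (intro has_vector_derivative_minus has_vector_derivative_matrix_mult dA d\<Phi>)
    ultimately have "?A 0 ** ?a + ?S ** ?\<Phi> 0 = - (?\<Phi> 0 ** ?S + ?a ** ?A 0)"
      by (rule has_vector_derivative_eq_locally[OF _ _ T(1,2)]) (use ct in \<open>simp add: ctang_def\<close>)
    then show ?thesis by simp
  qed
  have a: "transpose ?a = - ?a" "cnj_mat ?a = - (Jn ** ?a ** Jn)" "?a ** ?f = - (?f ** ?a)"
    using D_ctang[OF r e] by (auto simp: ctang_def)
  have z: "S r \<in> SO_star" using local_sectionD(3)[OF sec] r by blast
  have f': "transpose ?f = - ?f" "cnj_mat ?f = - (Jn ** ?f ** Jn)" "?f ** ?f = - mat 1"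
    using cstr_props[OF z] unfolding F_def by blast+
  have aaf: "?a ** ?a ** ?f = ?f ** (?a ** ?a)" by (rule anticommute_square[OF a(3)])
  then have aaf': "?a ** ?a ** ?f = ?f ** ?a ** ?a" by (simp only: matrix_mul_assoc)
  have aff: "?a ** ?a ** ?f ** ?f = - (?a ** ?a)"
    using arg_cong[OF f'(3), of "\<lambda>M. ?a ** ?a ** M"] by (simp add: matrix_mul_assoc matrix_mult_minus_right)
  have "(?S - ?a ** ?a ** ?f) ** ?f = - (?f ** (?S - ?a ** ?a ** ?f))"
  proof -
    have "?f ** (?a ** ?a ** ?f) = - (?a ** ?a)"
      unfolding matrix_mul_assoc[of ?f "?a ** ?a" ?f] aaf[symmetric] by (rule aff)
    then have "(?S - ?a ** ?a ** ?f) ** ?f + ?f ** (?S - ?a ** ?a ** ?f) =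
        (?a ** ?a + ?S ** ?f) + (?f ** ?S + ?a ** ?a)"
      unfolding matrix_diff_rdistrib matrix_diff_ldistrib aff by simp
    also have "\<dots> = 0" unfolding 3 by simp
    finally show ?thesis by (simp only: eq_neg_iff_add_eq_0)
  qed
  moreover have "transpose (?S - ?a ** ?a ** ?f) = - (?S - ?a ** ?a ** ?f)"
    unfolding matrix_conv 1 a(1) f'(1) by (simp add: matrix_ring aaf')
  moreover have "cnj_mat (?S - ?a ** ?a ** ?f) = - (Jn ** (?S - ?a ** ?a ** ?f) ** Jn)"
    unfolding cnj_mat_diff cnj_mat_mult 2 a(2) f'(2) by (simp add: matrix_ring Jn_Jn')
  ultimately show ?thesis by (simp add: ctang_def)
qed

lemma metric_diff_left:
  assumes r: "r \<in> W" "r \<in> p_alg" and v: "u \<in> p_alg" "v \<in> p_alg" "w \<in> p_alg"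
  shows "SOU_metric (U, x) r (u - v) w = SOU_metric (U, x) r u w - SOU_metric (U, x) r v w"
proof -
  have "u - v \<in> p_alg" using subspace_diff[OF subspace_p_alg] v by blast
  then show ?thesis
    using v by (simp add: SOU_metric_eq[OF r] linear_diff[OF linear_D[OF r(1)]] matrix_diff_rdistrib
        trace_sub diff_divide_distrib)
qed

lemma metric_nondegenerate:
  assumes r: "r \<in> W" "r \<in> p_alg" and v: "u \<in> p_alg" "v \<in> p_alg"
    and e: "\<And>w. w \<in> p_alg \<Longrightarrow> SOU_metric (U, x) r u w = SOU_metric (U, x) r v w"
  shows "u = v"
proof -
  have d: "u - v \<in> p_alg" using subspace_diff[OF subspace_p_alg] v by blast
  have "SOU_metric (U, x) r (u - v) (u - v) = 0"
    using metric_diff_left[OF r v d] e[OF d] by simp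
  from SOU_metric_pos(2)[OF r d this] show ?thesis by simp
qed

text \<open>As for submanifolds of a flat space, the connection is the tangential part of the second
  derivative of \<open>F\<close>; symmetry of second derivatives cancels the other Koszul terms.
  Equal arguments are enough for the mean curvature.\<close>

lemma levi_civita_eq:
  assumes r: "r \<in> W" "r \<in> p_alg" and e: "e \<in> p_alg"
  obtains y where "y \<in> p_alg" "levi_civita p_alg SOU_metric (U, x) r e e = y"
    "D r y = DD e r e - D r e ** D r e ** F r"
proof -
  let ?g = "SOU_metric (U, x)"
  obtain y where y: "y \<in> p_alg" "D r y = DD e r e - D r e ** D r e ** F r"
    by (rule D_surj[OF r covariant_ctang[OF r e]])
  define K where "K = (\<lambda>a b c. deriv (\<lambda>t. ?g (r + t *\<^sub>R a) b c) 0)"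
  have kos: "2 * ?g r y w = K e e w + K e e w - K w e e" if w: "w \<in> p_alg" for w
  proof -
    have ca: "D r e ** D r e ** F r ** F r = F r ** (D r e ** D r e ** F r)"
    proof -
      have "D r e ** F r = - (F r ** D r e)" using D_ctang[OF r e] by (simp add: ctang_def)
      note s = anticommute_square[OF this]
      have "D r e ** D r e ** F r ** F r = F r ** (D r e ** D r e) ** F r" by (simp only: s)
      then show ?thesis by (simp only: matrix_mul_assoc)
    qed
    have "D r w ** F r = - (F r ** D r w)" using D_ctang[OF r w] by (simp add: ctang_def)
    from Re_trace_commuting_anticommuting[OF F_square[OF r] ca this]
    have "trace (D r y ** D r w) = trace (DD e r e ** D r w)"
      unfolding y(2) matrix_diff_rdistrib trace_sub by simp
    then have l: "2 * ?g r y w = Re (trace (DD e r e ** D r w)) / 2"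
      unfolding SOU_metric_eq[OF r y(1) w] by simp
    have s: "trace (DD e r w ** D r e) = trace (D r e ** DD w r e)"
      unfolding DD_symmetric[OF r(1), of e w] by (rule trace_mul_sym)
    have s': "trace (D r e ** DD e r w) = trace (D r e ** DD w r e)"
      unfolding DD_symmetric[OF r(1), of e w] ..
    show ?thesis
      unfolding l K_def metric_derivative[OF r e e w] metric_derivative[OF r w e e]
      by (simp add: trace_add s s' add_divide_distrib)
  qed
  have "levi_civita p_alg SOU_metric (U, x) r e e = y"
    unfolding levi_civita_def Let_def
  proof (rule the_equality)
    show "y \<in> p_alg \<and> (\<forall>w\<in>p_alg. 2 * ?g r y w = deriv (\<lambda>t. ?g (r + t *\<^sub>R e) e w) 0 +
        deriv (\<lambda>t. ?g (r + t *\<^sub>R e) e w) 0 - deriv (\<lambda>t. ?g (r + t *\<^sub>R w) e e) 0)"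
      using y(1) kos unfolding K_def by blast
    fix y' assume y': "y' \<in> p_alg \<and> (\<forall>w\<in>p_alg. 2 * ?g r y' w = deriv (\<lambda>t. ?g (r + t *\<^sub>R e) e w) 0 +
        deriv (\<lambda>t. ?g (r + t *\<^sub>R e) e w) 0 - deriv (\<lambda>t. ?g (r + t *\<^sub>R w) e e) 0)"
    show "y' = y"
    proof (rule metric_nondegenerate[OF r _ y(1)])
      fix w :: "'n cmat2" assume w: "w \<in> p_alg"
      have "2 * ?g r y' w = 2 * ?g r y w" using y' kos[OF w] w unfolding K_def by simp
      then show "?g r y' w = ?g r y w" by simp
    qed (use y' in blast)
  qed
  then show ?thesis using that y by blast
qed

end

locale zero_set_slice = sou_section U x W S
  for U :: "('n::finite) cmat2 set set" and x W S +
  fixes a b :: "'n cvec2" and L q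
  assumes ab: "bilin a a = 0" "bilin a b = 0" "bilin b b \<noteq> 0" "a \<noteq> 0"
    and slice: "slice_chart p_alg SOU_atlas (phi a b -` {0} \<inter> SOU) (U, x) L"
    and q: "q \<in> x ` (U \<inter> (phi a b -` {0} \<inter> SOU))" "q \<in> W"
begin

lemma L: "subspace L" "L \<subseteq> p_alg" and image_slice: "x ` (U \<inter> (phi a b -` {0} \<inter> SOU)) = x ` U \<inter> L"
  using slice unfolding slice_chart_def by auto

lemma qL: "q \<in> L" "q \<in> p_alg"
  using q(1) L(2) image_slice by auto

lemma bilin_F_zero:
  assumes "r \<in> W" "r \<in> L"
  shows "bilin b (F r *v a) = 0"
proof -
  have r: "r \<in> p_alg" using assms L(2) by blast
  have s: "S r \<in> SO_star" "coset (S r) \<in> U" "x (coset (S r)) = r"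
    using local_sectionD(3-5)[OF sec r assms(1)] by blast+
  have "r \<in> x ` U \<inter> L" using s assms(2) by (metis IntI image_eqI)
  then obtain p where p: "p \<in> U" "phi a b p = 0" "x p = r" unfolding image_slice[symmetric] by blast
  have "p = coset (S r)" using SOU_atlasD(2)[OF atlas] p s by (metis inj_onD)
  then show ?thesis using p(2) phi_eq[OF s(1)] unfolding F_def by simp
qed

lemma z: "S q \<in> SO_star" "coset (S q) \<in> U" "x (coset (S q)) = q"
  using local_sectionD(3-5)[OF sec qL(2) q(2)] by blast+

lemma Fq: "bilin b (F q *v a) = 0"
  by (rule bilin_F_zero[OF q(2) qL(1)])

text \<open>The line through \<open>q\<close> in direction \<open>v\<close> stays in
  \<open>L\<close>, so near \<open>q\<close> the function \<open>phi\<close> is zero along it; the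
  two equations are its first and second derivatives.\<close>

lemma tangent_bilin_zero:
  assumes v: "v \<in> L"
  shows "bilin b (D q v *v a) = 0" "bilin b (DD v q v *v a) = 0"
proof -
  let ?f = "\<lambda>M. bilin b (M *v a)"
  have vp: "v \<in> p_alg" using v L(2) by blast
  obtain T where T: "open T" "(0::real) \<in> T" "\<forall>t\<in>T. q + t *\<^sub>R v \<in> W \<and> q + t *\<^sub>R v \<in> p_alg"
    by (rule line_near[OF q(2) qL(2) vp])
  have inL: "q + t *\<^sub>R v \<in> L" for t using L(1) qL(1) v by (simp add: subspace_add subspace_scale)
  have 1: "?f (D (q + t *\<^sub>R v) v) = 0" if t: "t \<in> T" for t
  proof -
    have d: "((\<lambda>s. F (q + s *\<^sub>R v)) has_vector_derivative D (q + t *\<^sub>R v) v) (at t)"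
      by (rule has_vector_derivative_chain[OF line_derivative F_has_derivative]) (use T(3) t in blast)
    show ?thesis
      by (rule has_vector_derivative_eq_locally[OF has_vector_derivative_linear_map[OF d bounded_linear_bilin_mult]
            has_vector_derivative_const T(1) t])
        (use T(3) bilin_F_zero inL in blast)
  qed
  from 1[OF T(2)] show "?f (D q v) = 0" by simp
  show "?f (DD v q v) = 0"
    by (rule has_vector_derivative_eq_locally[OF has_vector_derivative_linear_map[OF D_line_derivative[OF q(2)]
            bounded_linear_bilin_mult] has_vector_derivative_const T(1,2)])
      (use 1 in blast)
qed

text \<open>No dimension of \<open>L\<close> is available. The constructed slice chart provides a
  curve in the zero set whose complex structure has velocity \<open>D q v\<close>. Read in the given
  chart it stays in \<open>L\<close>, hence so does its chart velocity, which is \<open>v\<close> by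
  injectivity of \<open>D\<close>.\<close>

lemma kernel_tangent:
  assumes v: "v \<in> p_alg" and 0: "bilin b (D q v *v a) = 0"
  shows "v \<in> L"
proof -
  let ?z = "S q" and ?N = "phi a b -` {0} \<inter> SOU"
  have A: "D q v \<in> ctang (cstr ?z)" using D_ctang[OF q(2) qL(2) v] unfolding F_def .
  define Y where "Y = transpose ?z ** D q v ** ?z"
  have Y: "Y \<in> p_alg" unfolding Y_def by (rule ctang_p_alg[OF z(1) A])
  have AY: "D q v = ?z ** Y ** transpose ?z" unfolding Y_def by (rule ctang_conj[OF z(1)])
  have "bilin b (cstr ?z *v a) = 0" using Fq unfolding F_def .
  then obtain U0 \<Lambda> L0 where s0: "slice_chart p_alg SOU_atlas ?N (U0, \<lambda>p. \<Lambda> (coset_cstr p)) L0"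
    "coset ?z \<in> U0" "linear \<Lambda>" and \<Lambda>: "\<And>Y. Y \<in> p_alg \<Longrightarrow> \<Lambda> (?z ** Y ** transpose ?z) = Y"
    and L0: "L0 = {Y \<in> p_alg. bilin (transpose ?z *v b) (Y *v (transpose ?z *v a)) = 0}"
    by (rule slice_chart_exists[OF ab z(1)]) blast
  let ?x0 = "\<lambda>p. \<Lambda> (coset_cstr p)"
  let ?q0 = "\<Lambda> (cstr ?z)"
  have at0: "(U0, ?x0) \<in> SOU_atlas" and sub0: "subspace L0"
    and im0: "?x0 ` (U0 \<inter> ?N) = ?x0 ` U0 \<inter> L0"
    using s0(1) unfolding slice_chart_def by auto
  have YL0: "Y \<in> L0" unfolding L0 using Y 0 unfolding AY bilin_conj by blast
  have czN: "coset ?z \<in> ?N" using phi_eq[OF z(1)] Fq z(1) unfolding F_def SOU_def by auto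
  have q0: "?q0 = ?x0 (coset ?z)" using coset_cstr_coset[OF z(1)] by simp
  then have q0U: "?q0 \<in> ?x0 ` U0" "?q0 \<in> L0" using s0(2) czN im0 by blast+
  obtain W0 S0 where W0: "?q0 \<in> W0" "local_section U0 ?x0 W0 S0"
    by (rule local_section_exists[OF at0 q0U(1)])
  interpret C: sou_section U0 ?x0 W0 S0 by unfold_locales (rule at0, rule W0(2))
  have q0p: "?q0 \<in> p_alg" using q0U(2) L0 by blast
  obtain T X where T: "open T" "(0::real) \<in> T" "\<forall>t\<in>T. S0 (?q0 + t *\<^sub>R Y) \<in> SO_star"
    and dc: "((\<lambda>t. S0 (?q0 + t *\<^sub>R Y)) has_vector_derivative S0 ?q0 ** X) (at 0)"
    by (rule C.section_line[OF W0(1) q0p Y])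
  obtain T1 where T1: "open T1" "(0::real) \<in> T1" "\<forall>t\<in>T1. ?q0 + t *\<^sub>R Y \<in> W0 \<and> ?q0 + t *\<^sub>R Y \<in> p_alg"
    by (rule C.line_near[OF W0(1) q0p Y])
  let ?c = "\<lambda>t. S0 (?q0 + t *\<^sub>R Y)"
  have c0: "coset (?c 0) = coset ?z"
    using C.coset_eq_section[OF s0(2)] W0(1) unfolding q0[symmetric] by simp
  have cN: "coset (?c t) \<in> ?N" if t: "t \<in> T1" for t
  proof -
    let ?r = "?q0 + t *\<^sub>R Y"
    have rL: "?r \<in> L0" using sub0 q0U(2) YL0 by (simp add: subspace_add subspace_scale)
    have s: "coset (?c t) \<in> U0" "?x0 (coset (?c t)) = ?r"
      using local_sectionD(4,5)[OF W0(2)] T1(3) t by blast+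
    have "?x0 (coset (?c t)) \<in> ?x0 ` U0" by (rule imageI[OF s(1)])
    then have "?r \<in> ?x0 ` U0" by (simp only: s(2))
    then have "?r \<in> ?x0 ` (U0 \<inter> ?N)" unfolding im0 using rL by (rule IntI)
    then obtain p where p': "?r = ?x0 p" "p \<in> U0 \<inter> ?N" by (rule imageE)
    then have p: "p \<in> U0" "p \<in> ?N" "?x0 p = ?r" by simp_all
    have "p = coset (?c t)"
      by (rule inj_onD[OF SOU_atlasD(2)[OF at0] _ p(1) s(1)]) (simp only: p(3) s(2))
    then show ?thesis using p(2) by simp
  qed
  have F0: "((\<lambda>t. C.F (?q0 + t *\<^sub>R Y)) has_vector_derivative C.D ?q0 Y) (at 0)"
    by (rule has_vector_derivative_chain[OF line_derivative]) (use C.F_has_derivative W0(1) in simp)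
  \<comment> \<open>Both sides are tangent at \<open>cstr ?z\<close>, where \<Lambda> is injective,
    and \<Lambda> sends both to \<open>Y\<close>.\<close>
  have Dq: "C.D ?q0 Y = D q v"
  proof -
    have bl: "bounded_linear \<Lambda>" using s0(3) linear_conv_bounded_linear by blast
    have "\<Lambda> (C.D ?q0 Y) = Y"
    proof (rule has_vector_derivative_eq_locally[OF has_vector_derivative_linear_map[OF F0 bl] line_derivative T1(1,2)])
      fix t assume t: "t \<in> T1"
      let ?r = "?q0 + t *\<^sub>R Y"
      have "?x0 (coset (S0 ?r)) = ?r" "S0 ?r \<in> SO_star" using local_sectionD(3,5)[OF W0(2)] T1(3) t by blast+
      then show "\<Lambda> (C.F ?r) = ?r" unfolding C.F_def using coset_cstr_coset by metis
    qed
    have "C.F ?q0 = cstr ?z"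
      using C.coset_cstr_eq_F[OF s0(2)] W0(1) coset_cstr_coset[OF z(1)] by simp
    then have "C.D ?q0 Y \<in> ctang (cstr ?z)" using C.D_ctang[OF W0(1) q0p Y] by simp
    from \<Lambda>[OF ctang_p_alg[OF z(1) this]] ctang_conj[OF z(1), of "C.D ?q0 Y"] \<open>\<Lambda> (C.D ?q0 Y) = Y\<close>
    have "transpose ?z ** C.D ?q0 Y ** ?z = Y" by metis
    then show ?thesis using ctang_conj[OF z(1), of "C.D ?q0 Y"] AY by simp
  qed
  have c0U: "coset (?c 0) \<in> U" using c0 z(2) by simp
  have inS: "?c t \<in> SO_star" if "t \<in> T" for t using T(3) that by blast
  obtain T' d where T': "open T'" "0 \<in> T'" "T' \<subseteq> T" "\<forall>t\<in>T'. coset (?c t) \<in> U"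
    and d: "d \<in> p_alg" "((\<lambda>t. x (coset (?c t))) has_vector_derivative d) (at 0)"
    by (rule chart_curve_derivative[OF atlas dc T(1,2) inS c0U])
  have "d \<in> L"
  proof (rule has_vector_derivative_in_subspace[OF L(1) d(2), of "T' \<inter> T1"])
    fix t assume t: "t \<in> T' \<inter> T1"
    then have "x (coset (?c t)) \<in> x ` (U \<inter> ?N)" using T'(4) cN by blast
    then show "x (coset (?c t)) \<in> L" unfolding image_slice by blast
  qed (use T' T1 in auto)
  moreover have "d = v"
  proof (rule D_inj[OF q(2) qL(2) d(1) v])
    have xc0: "x (coset (?c 0)) = q" using c0 z(3) by simp
    have 1: "((\<lambda>t. coset_cstr (coset (?c t))) has_vector_derivative D (x (coset (?c 0))) d) (at 0)"
      by (rule curve_coset_cstr_derivative(2)[OF T'(1,2) _ d(2)]) (use T'(4) xc0 q(2) in auto)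
    have "D (x (coset (?c 0))) d = C.D ?q0 Y"
      by (rule has_vector_derivative_eq_locally[OF 1 F0 T(1,2)])
        (simp only: C.F_def coset_cstr_coset[OF inS])
    then show "D q d = D q v" unfolding xc0 Dq .
  qed
  ultimately show ?thesis by simp
qed

text \<open>The metric at \<open>q\<close>, extended by the trace formula to all matrices so that
  bilinearity needs no membership conditions.\<close>

definition "G u v = Re (trace (D q u ** D q v)) / 4"

lemma linear_G: "linear (\<lambda>u. G u v)" "linear (G u)"
proof -
  note l = linear_add[OF linear_D[OF q(2)]] linear_cmul[OF linear_D[OF q(2)]] linear_cmul[OF trace_linear]
  show "linear (\<lambda>u. G u v)" "linear (G u)"
    unfolding G_def
    by (rule linearI; simp add: l matrix_ring trace_add add_divide_distrib)+
qed

lemma metric_G: "u \<in> p_alg \<Longrightarrow> v \<in> p_alg \<Longrightarrow> SOU_metric (U, x) q u v = G u v"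
  unfolding G_def by (rule SOU_metric_eq[OF q(2) qL(2)])

lemma G_eq_0: "v \<in> p_alg \<Longrightarrow> G v v = 0 \<Longrightarrow> v = 0"
  using SOU_metric_pos(2)[OF q(2) qL(2)] metric_G by simp

text \<open>The given orthonormal basis provides the orthogonal projection to \<open>L\<close>;
  definiteness of the metric makes the normal part unique.\<close>

lemma normal_part_exists:
  assumes B: "orthonormal_basis SOU_metric (U, x) q L B" and y: "y \<in> p_alg"
  obtains n where "normal_part p_alg SOU_metric (U, x) L q y = n" "n \<in> p_alg" "y - n \<in> L"
    "\<forall>l\<in>L. G n l = 0"
proof -
  have fin: "finite B" and span: "span B = L"
    and on: "\<And>e f. e \<in> B \<Longrightarrow> f \<in> B \<Longrightarrow> SOU_metric (U, x) q e f = (if e = f then 1 else 0)"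
    using B unfolding orthonormal_basis_def by auto
  have BL: "e \<in> L" "e \<in> p_alg" if "e \<in> B" for e
    using span_base[OF that] span L(2) by blast+
  define n where "n = y - (\<Sum>f\<in>B. G y f *\<^sub>R f)"
  have sL: "(\<Sum>f\<in>B. G y f *\<^sub>R f) \<in> L"
    by (intro subspace_sum[OF L(1)] subspace_scale[OF L(1)] BL(1))
  have n: "n \<in> p_alg" unfolding n_def using subspace_diff[OF subspace_p_alg y] sL L(2) by blast
  have yn: "y - n \<in> L" unfolding n_def using sL by simp
  have nB: "G n f = 0" if f: "f \<in> B" for f
  proof -
    have "G (\<Sum>f\<in>B. G y f *\<^sub>R f) f = (\<Sum>e\<in>B. G y e * G e f)"
      by (simp add: linear_sum[OF linear_G(1)] linear_cmul[OF linear_G(1)])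
    also have "\<dots> = (\<Sum>e\<in>B. if e = f then G y e else 0)"
      by (rule sum.cong[OF refl]) (use on[OF _ f] metric_G BL(2) f in simp)
    also have "\<dots> = G y f" using fin f by simp
    finally show ?thesis unfolding n_def by (simp add: linear_diff[OF linear_G(1)])
  qed
  have "subspace {l. G n l = 0}"
    by (rule subspaceI) (simp_all add: linear_0[OF linear_G(2)] linear_add[OF linear_G(2)] linear_cmul[OF linear_G(2)])
  then have nL: "\<forall>l\<in>L. G n l = 0" using span_minimal[of B "{l. G n l = 0}"] nB span by blast
  have "normal_part p_alg SOU_metric (U, x) L q y = n"
    unfolding normal_part_def
  proof (rule the_equality)
    show "n \<in> p_alg \<and> y - n \<in> L \<and> (\<forall>l\<in>L. SOU_metric (U, x) q n l = 0)"
      using n yn nL metric_G[OF n] L(2) by auto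
    fix m assume m: "m \<in> p_alg \<and> y - m \<in> L \<and> (\<forall>l\<in>L. SOU_metric (U, x) q m l = 0)"
    have "(y - n) - (y - m) \<in> L" using yn m subspace_diff[OF L(1)] by blast
    then have d: "m - n \<in> L" by simp
    then have "G m (m - n) = 0" using m metric_G L(2) by (metis subsetD)
    moreover have "G n (m - n) = 0" using nL d by blast
    ultimately have "G (m - n) (m - n) = 0" by (simp add: linear_diff[OF linear_G(1)])
    moreover have "m - n \<in> p_alg" using d L(2) by blast
    ultimately have "m - n = 0" using G_eq_0 by blast
    then show "m = n" by simp
  qed
  then show ?thesis using that n yn nL by blast
qed

lemma mean_curvature_eq_0:
  assumes B: "orthonormal_basis SOU_metric (U, x) q L B"
  shows "mean_curvature p_alg SOU_metric (U, x) L q B = 0"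
proof -
  let ?z = "S q"
  let ?a = "transpose ?z *v a" and ?b = "transpose ?z *v b"
  interpret P: isotropic_pair ?a ?b
    by (rule isotropic_pair_translate[OF ab z(1)]) (use Fq in \<open>simp add: F_def\<close>)
  have fin: "finite B" and span: "span B = L"
    and on: "\<And>e f. e \<in> B \<Longrightarrow> f \<in> B \<Longrightarrow> SOU_metric (U, x) q e f = (if e = f then 1 else 0)"
    using B unfolding orthonormal_basis_def by auto
  have BL: "e \<in> L" "e \<in> p_alg" if "e \<in> B" for e
    using span_base[OF that] span L(2) by blast+
  \<comment> \<open>The half absorbs the quarter: \<tau> carries the metric at \<open>q\<close> to
    the Euclidean inner product and \<open>L\<close> onto the kernel of the differential of
    \<open>phi\<close>, seen at the base point.\<close>
  define \<tau> where "\<tau> = (\<lambda>v. (1/2) *\<^sub>R (transpose ?z ** D q v ** ?z))"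
  have Dct: "D q v \<in> ctang (cstr ?z)" if "v \<in> p_alg" for v
    using D_ctang[OF q(2) qL(2) that] unfolding F_def .
  have \<tau>p: "\<tau> v \<in> p_alg" if "v \<in> p_alg" for v
    unfolding \<tau>_def by (rule p_alg_scaleR[OF ctang_p_alg[OF z(1) Dct[OF that]]])
  have D\<tau>: "D q v = 2 *\<^sub>R (?z ** \<tau> v ** transpose ?z)" for v
    unfolding \<tau>_def using ctang_conj[OF z(1), of "D q v"] by (simp add: matrix_ring)
  have b\<tau>: "bilin b (D q v *v a) = 2 *\<^sub>R bilin ?b (\<tau> v *v ?a)" for v
    unfolding D\<tau> scaleR_matrix_vector_mult bilin_scaleR bilin_conj ..
  have lin: "linear \<tau>"
    unfolding \<tau>_def
    by (rule linearI) (simp_all add: linear_add[OF linear_D[OF q(2)]] linear_cmul[OF linear_D[OF q(2)]]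
        matrix_ring scaleR_add_right)
  have in\<tau>: "\<tau> u \<bullet> \<tau> v = G u v" if "u \<in> p_alg" "v \<in> p_alg" for u v
    using Re_trace_ctang[OF z(1) Dct[OF that(2)], of "D q u"] unfolding \<tau>_def G_def by simp
  have inj: "inj_on \<tau> B"
  proof (rule inj_onI)
    fix e f assume ef: "e \<in> B" "f \<in> B" "\<tau> e = \<tau> f"
    then have "G e f = G e e" using in\<tau> BL(2) by metis
    then show "e = f" using on[OF ef(1,2)] on[OF ef(1,1)] metric_G BL(2) ef by (auto split: if_splits)
  qed
  have spT: "span (\<tau> ` B) = {Y \<in> p_alg. bilin ?b (Y *v ?a) = 0}"
  proof -
    have "span (\<tau> ` B) = \<tau> ` L" unfolding linear_span_image[OF lin] span ..
    also have "\<dots> = {Y \<in> p_alg. bilin ?b (Y *v ?a) = 0}"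
    proof (intro equalityI subsetI)
      fix Y assume "Y \<in> \<tau> ` L"
      then obtain v where v: "v \<in> L" "Y = \<tau> v" by blast
      have "2 *\<^sub>R bilin ?b (\<tau> v *v ?a) = 0" using tangent_bilin_zero(1)[OF v(1)] b\<tau> by metis
      then show "Y \<in> {Y \<in> p_alg. bilin ?b (Y *v ?a) = 0}" using v \<tau>p L(2) by auto
    next
      fix Y assume Y: "Y \<in> {Y \<in> p_alg. bilin ?b (Y *v ?a) = 0}"
      have "2 *\<^sub>R (?z ** Y ** transpose ?z) \<in> ctang (F q)"
        unfolding F_def by (rule subspace_scale[OF subspace_ctang p_alg_ctang[OF z(1)]]) (use Y in blast)
      then obtain v where v: "v \<in> p_alg" "D q v = 2 *\<^sub>R (?z ** Y ** transpose ?z)"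
        by (rule D_surj[OF q(2) qL(2)])
      have "\<tau> v = Y"
        unfolding \<tau>_def v(2) by (simp add: matrix_ring SO_starD(2,6)[OF z(1)])
      moreover have "v \<in> L" by (rule kernel_tangent[OF v(1)]) (use b\<tau>[of v] \<open>\<tau> v = Y\<close> Y in simp)
      ultimately show "Y \<in> \<tau> ` L" by blast
    qed
    finally show ?thesis .
  qed
  have onT: "\<forall>Y\<in>\<tau> ` B. \<forall>Y'\<in>\<tau> ` B. Y \<bullet> Y' = (if Y = Y' then 1 else 0)"
  proof (intro ballI)
    fix Y Y' assume "Y \<in> \<tau> ` B" "Y' \<in> \<tau> ` B"
    then obtain e f where ef: "e \<in> B" "f \<in> B" "Y = \<tau> e" "Y' = \<tau> f" by blast
    then have "(Y = Y') = (e = f)" using inj by (auto simp: inj_on_def)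
    then show "Y \<bullet> Y' = (if Y = Y' then 1 else 0)"
      using on[OF ef(1,2)] metric_G in\<tau> BL(2) ef by simp
  qed
  have "(\<Sum>Y\<in>\<tau> ` B. bilin ?b ((Y ** Y) *v (Jn *v ?a))) = 0"
    by (rule P.tangential_sum[OF finite_imageI[OF fin] spT onT])
  then have sum0: "(\<Sum>e\<in>B. bilin ?b ((\<tau> e ** \<tau> e) *v (Jn *v ?a))) = 0"
    unfolding sum.reindex[OF inj] by simp
  define n where "n = (\<lambda>e. second_fundamental_form p_alg SOU_metric (U, x) L q e e)"
  have n: "n e \<in> p_alg \<and> (\<forall>l\<in>L. G (n e) l = 0) \<and>
      bilin b (D q (n e) *v a) = - 4 * bilin ?b ((\<tau> e ** \<tau> e) *v (Jn *v ?a))" if e: "e \<in> B" for e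
  proof -
    obtain y where y: "y \<in> p_alg" "levi_civita p_alg SOU_metric (U, x) q e e = y"
      "D q y = DD e q e - D q e ** D q e ** F q"
      by (rule levi_civita_eq[OF q(2) qL(2) BL(2)[OF e]])
    obtain m where m: "normal_part p_alg SOU_metric (U, x) L q y = m" "m \<in> p_alg" "y - m \<in> L"
      "\<forall>l\<in>L. G m l = 0"
      by (rule normal_part_exists[OF B y(1)])
    have nm: "n e = m" unfolding n_def second_fundamental_form_def y(2) m(1) ..
    have "D q e ** D q e ** F q = 4 *\<^sub>R (?z ** (\<tau> e ** \<tau> e ** Jn) ** transpose ?z)"
      unfolding D\<tau> F_def cstr_def by (simp add: matrix_ring SO_starD(6)[OF z(1)])
    then have "bilin b ((D q e ** D q e ** F q) *v a) = 4 *\<^sub>R bilin ?b ((\<tau> e ** \<tau> e ** Jn) *v ?a)"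
      by (simp only: scaleR_matrix_vector_mult bilin_scaleR bilin_conj)
    also have "(\<tau> e ** \<tau> e ** Jn) *v ?a = (\<tau> e ** \<tau> e) *v (Jn *v ?a)"
      by (simp only: matrix_vector_mul_assoc matrix_mul_assoc)
    finally have 1: "bilin b ((D q e ** D q e ** F q) *v a) = 4 * bilin ?b ((\<tau> e ** \<tau> e) *v (Jn *v ?a))"
      by (simp add: scaleR_conv_of_real)
    \<comment> \<open>\<open>m\<close> and \<open>y\<close> differ by a tangent vector, so the
      differential of \<open>phi\<close> agrees on them. On \<open>y\<close> the second derivative
      of \<open>F\<close> contributes 0 and the quadratic term is left.\<close>
    have "bilin b (D q (y - m) *v a) = 0" by (rule tangent_bilin_zero(1)[OF m(3)])
    then have "bilin b (D q m *v a) = bilin b (D q y *v a)"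
      by (simp add: linear_diff[OF linear_D[OF q(2)]] matrix_vector_mult_diff_rdistrib bilin_diff)
    also have "\<dots> = - 4 * bilin ?b ((\<tau> e ** \<tau> e) *v (Jn *v ?a))"
      unfolding y(3) matrix_vector_mult_diff_rdistrib bilin_diff 1 tangent_bilin_zero(2)[OF BL(1)[OF e]] by simp
    finally show ?thesis unfolding nm using m by blast
  qed
  define M where "M = (\<Sum>e\<in>B. n e)"
  have Mp: "M \<in> p_alg" unfolding M_def by (rule subspace_sum[OF subspace_p_alg]) (use n in blast)
  have GM: "G M l = 0" if "l \<in> L" for l
    unfolding M_def linear_sum[OF linear_G(1)] by (rule sum.neutral) (use n that in blast)
  have "bilin b (D q M *v a) = (\<Sum>e\<in>B. bilin b (D q (n e) *v a))"
  proof -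
    have "linear (\<lambda>v. bilin b (D q v *v a))"
      using linear_compose[OF linear_D[OF q(2)] bounded_linear.linear[OF bounded_linear_bilin_mult]]
      by (simp add: o_def)
    then show ?thesis unfolding M_def by (rule linear_sum)
  qed
  also have "\<dots> = (\<Sum>e\<in>B. - 4 * bilin ?b ((\<tau> e ** \<tau> e) *v (Jn *v ?a)))"
    by (rule sum.cong[OF refl]) (use n in blast)
  also have "\<dots> = 0" unfolding sum_distrib_left[symmetric] sum0 by simp
  \<comment> \<open>\<open>M\<close> is orthogonal to \<open>L\<close> and, being killed by the
    differential of \<open>phi\<close>, also belongs to \<open>L\<close>.\<close>
  finally have "M \<in> L" by (rule kernel_tangent[OF Mp])
  then have "M = 0" using GM G_eq_0[OF Mp] by blast
  then show ?thesis unfolding mean_curvature_def M_def n_def by simp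
qed

end

lemma minimal_zero_set:
  assumes ab: "bilin a a = 0" "bilin a b = 0" "bilin b b \<noteq> 0" "a \<noteq> 0"
  shows "minimal_submanifold p_alg SOU_atlas SOU_metric (phi a b -` {0} \<inter> SOU)"
  unfolding minimal_submanifold_def
proof (intro allI impI)
  fix X L q B
  assume X: "slice_chart p_alg SOU_atlas (phi a b -` {0} \<inter> SOU) X L"
    and q: "q \<in> snd X ` (fst X \<inter> (phi a b -` {0} \<inter> SOU))" and B: "orthonormal_basis SOU_metric X q L B"
  obtain U x where Ux: "X = (U, x)" by (cases X)
  have at: "(U, x) \<in> SOU_atlas" using X unfolding slice_chart_def Ux by blast
  have qU: "q \<in> x ` U" using q unfolding Ux by auto
  obtain W S where WS: "q \<in> W" "local_section U x W S" by (rule local_section_exists[OF at qU])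
  interpret zero_set_slice U x W S a b L q
    by unfold_locales (use at WS ab X q Ux in auto)
  show "mean_curvature p_alg SOU_metric X L q B = 0"
    unfolding Ux by (rule mean_curvature_eq_0) (use B Ux in simp)
qed

section \<open>Speed of curves\<close>

text \<open>Justifies the choice of a chart made in \<open>speed\<close>. The chart used is the
  projection to \<open>p_alg\<close> of the complex structure translated by
  \<open>z\<close>.\<close>

lemma atlas_point:
  assumes "p \<in> SOU"
  shows "\<exists>X. X \<in> SOU_atlas \<and> p \<in> fst X"
proof -
  obtain z where z: "z \<in> SO_star" "p = coset z" using assms unfolding SOU_def by blast
  let ?L = "\<lambda>M. p_part (transpose z ** M ** z)"
  have lin: "linear ?L"
    by (rule linearI) (simp_all add: matrix_ring linear_add[OF linear_p_part] linear_cmul[OF linear_p_part])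
  have "?L (z ** Y ** transpose z) = Y" if "Y \<in> p_alg" for Y
    using p_part_eq[OF that] by (simp add: matrix_mul_assoc SO_starD(2,6)[OF z(1)])
  then obtain U where "(U, \<lambda>p. ?L (coset_cstr p)) \<in> SOU_atlas" "coset z \<in> U"
    by (rule linear_chart[OF z(1) lin p_part_p_alg])
  then show ?thesis unfolding z(2) by (intro exI[of _ "(U, \<lambda>p. ?L (coset_cstr p))"]) simp
qed

text \<open>In terms of the complex structures, the speed of a curve is given by the trace form,
  whatever chart \<open>speed\<close> has chosen.\<close>

lemma speed_eq:
  assumes p: "c t \<in> SOU"
    and near: "\<And>U x. (U, x) \<in> SOU_atlas \<Longrightarrow> c t \<in> U \<Longrightarrow>
      (x \<circ> c) differentiable (at t) \<and> (\<exists>T. open T \<and> t \<in> T \<and> (\<forall>s\<in>T. c s \<in> U))"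
  obtains A where "A \<in> ctang (coset_cstr (c t))"
    "((\<lambda>t. coset_cstr (c t)) has_vector_derivative A) (at t)"
    "speed SOU_atlas SOU_metric c t = sqrt (Re (trace (A ** A)) / 4)"
proof -
  define X where "X = (SOME X. X \<in> SOU_atlas \<and> c t \<in> fst X)"
  have X: "X \<in> SOU_atlas \<and> c t \<in> fst X"
    unfolding X_def by (rule someI_ex[OF atlas_point[OF p]])
  obtain U x where Ux: "X = (U, x)" by (cases X)
  have at: "(U, x) \<in> SOU_atlas" "c t \<in> U" using X Ux by auto
  obtain T where T: "open T" "t \<in> T" "\<forall>s\<in>T. c s \<in> U" using near[OF at] by blast
  define d where "d = vector_derivative (x \<circ> c) (at t)"
  have "((x \<circ> c) has_vector_derivative d) (at t)"
    unfolding d_def using near[OF at] vector_derivative_works by blast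
  then have d: "((\<lambda>t. x (c t)) has_vector_derivative d) (at t)" by (simp add: o_def)
  have "x (c t) \<in> x ` U" using at(2) by blast
  then obtain W S where WS: "x (c t) \<in> W" "local_section U x W S"
    by (rule local_section_exists[OF at(1)])
  interpret sou_section U x W S by unfold_locales (rule at(1), rule WS(2))
  have Tc: "\<And>s. s \<in> T \<Longrightarrow> c s \<in> U" using T(3) by blast
  note dc = curve_coset_cstr_derivative[OF T(1,2) Tc d WS(1)]
  have xp: "x (c t) \<in> p_alg" using SOU_atlasD(6)[OF at] .
  have "D (x (c t)) d \<in> ctang (coset_cstr (c t))"
    using D_ctang[OF WS(1) xp dc(1)] coset_cstr_eq_F[OF at(2) WS(1)] by simp
  moreover have "speed SOU_atlas SOU_metric c t = sqrt (SOU_metric (U, x) (x (c t)) d d)"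
    unfolding speed_def Let_def X_def[symmetric] Ux snd_conv d_def ..
  ultimately show ?thesis using that dc(2) SOU_metric_eq[OF WS(1) xp dc(1) dc(1)] by simp
qed

section \<open>Lower bounds for the intrinsic distance\<close>

text \<open>\<open>herm u (cstr z)\<close> is the value at \<open>u\<close> of the positive Hermitian form of \<open>z\<close> times its conjugate
  transpose; its logarithm is Lipschitz along curves.\<close>

definition herm :: "('n::finite) cvec2 \<Rightarrow> 'n cmat2 \<Rightarrow> real" where
  "herm u M = - (u \<bullet> (M *v (Jn *v u)))"

lemma inner_matrix_vector: "u \<bullet> (M *v v) = (ctranspose M *v u) \<bullet> (v :: complex^'m)"
proof -
  have "u \<bullet> (M *v v) = (\<Sum>i\<in>UNIV. \<Sum>j\<in>UNIV. u $ i \<bullet> (M $ i $ j * v $ j))"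
    by (simp add: inner_vec_def matrix_vector_mult_def inner_sum_right)
  also have "\<dots> = (\<Sum>j\<in>UNIV. \<Sum>i\<in>UNIV. u $ i \<bullet> (M $ i $ j * v $ j))" by (rule sum.swap)
  also have "\<dots> = (\<Sum>j\<in>UNIV. \<Sum>i\<in>UNIV. (cnj (M $ i $ j) * u $ i) \<bullet> v $ j)"
    by (intro sum.cong refl) (simp add: inner_complex_def algebra_simps)
  also have "\<dots> = (ctranspose M *v u) \<bullet> v"
    by (simp add: inner_vec_def matrix_vector_mult_def inner_sum_left ctranspose_def transpose_def cnj_mat_def)
  finally show ?thesis .
qed

lemma transpose_Jn_ctranspose:
  assumes "z \<in> SO_star"
  shows "transpose z ** Jn = Jn ** ctranspose z"
  unfolding ctranspose_def SO_starD(9)[OF assms] by (simp add: matrix_ring Jn_Jn matrix_mult_minus_left)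

lemma herm_cstr:
  assumes z: "z \<in> SO_star"
  shows "herm u (cstr z) = (norm (ctranspose z *v u))\<^sup>2"
proof -
  have "cstr z ** Jn = - (z ** ctranspose z)"
    unfolding cstr_def matrix_mul_assoc[symmetric] transpose_Jn_ctranspose[OF z]
    by (simp add: matrix_mul_assoc Jn_Jn' matrix_mult_minus_left)
  then have "cstr z *v (Jn *v u) = - (z *v (ctranspose z *v u))"
    by (simp add: matrix_vector_mul_assoc matrix_vector_mult_minus)
  then have "herm u (cstr z) = u \<bullet> (z *v (ctranspose z *v u))" unfolding herm_def by simp
  then show ?thesis unfolding inner_matrix_vector[of u z] by (simp add: dot_square_norm)
qed

lemma herm_cstr_pos:
  assumes z: "z \<in> SO_star" and u: "u \<noteq> 0"
  shows "herm u (cstr z) > 0"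
proof -
  have "ctranspose z *v u \<noteq> 0"
  proof
    assume "ctranspose z *v u = 0"
    then have "Jn *v (ctranspose z *v u) = 0" by simp
    then have 0: "transpose z *v (Jn *v u) = 0"
      by (simp only: matrix_vector_mul_assoc transpose_Jn_ctranspose[OF z])
    have "z *v (transpose z *v (Jn *v u)) = Jn *v u"
      by (simp add: matrix_vector_mul_assoc SO_starD(1)[OF z] matrix_mul_assoc)
    then have "Jn *v u = 0" using 0 by simp
    then have "Jn *v (Jn *v u) = 0" by simp
    then show False using u by (simp add: Jn_Jn_vector)
  qed
  then show ?thesis unfolding herm_cstr[OF z] by simp
qed

lemma bounded_linear_herm: "bounded_linear (herm u)"
  unfolding linear_conv_bounded_linear[symmetric] herm_def
  by (rule linearI) (simp_all add: matrix_vector_mult_add_rdistrib inner_add_right scaleR_matrix_vector_mult)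

text \<open>Replacing \<open>u\<close> by \<open>ctranspose z *v u\<close> moves the estimate to the
  base point, where it is a plain operator bound; hence \<open>K\<close> depends on neither
  \<open>z\<close> nor \<open>u\<close>.\<close>

lemma herm_ctang_bound:
  "\<exists>K>0. \<forall>(u :: ('n::finite) cvec2). \<forall>z\<in>SO_star. \<forall>A\<in>ctang (cstr z).
     \<bar>herm u A\<bar> \<le> K * norm (transpose z ** A ** z) * herm u (cstr z)"
proof -
  have s: "M *v (r *\<^sub>R v) = r *\<^sub>R (M *v v)" for M :: "'n cmat2" and r v
    by (simp add: matrix_vector_mult_def vec_eq_iff scaleR_sum_right)
  have bb: "bounded_bilinear (\<lambda>(M :: 'n cmat2) (w :: 'n cvec2). M *v (Jn *v w))"
    unfolding bilinear_conv_bounded_bilinear[symmetric] bilinear_def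
    by (intro conjI allI linearI)
      (simp_all add: matrix_vector_mult_add_rdistrib matrix_vector_right_distrib scaleR_matrix_vector_mult s)
  obtain K where K: "K > 0" "\<forall>(M :: 'n cmat2) (w :: 'n cvec2). norm (M *v (Jn *v w)) \<le> norm M * norm w * K"
    using bounded_bilinear.pos_bounded[OF bb] by blast
  have "\<bar>herm u A\<bar> \<le> K * norm (transpose z ** A ** z) * herm u (cstr z)"
    if z: "z \<in> SO_star" and A: "A \<in> ctang (cstr z)" for u :: "'n cvec2" and z A :: "'n cmat2"
  proof -
    let ?w = "ctranspose z *v u" and ?A = "transpose z ** A ** z"
    have "A ** Jn = z ** ?A ** (transpose z ** Jn)"
      using ctang_conj[OF z, of A] by (simp add: matrix_mul_assoc)
    also have "\<dots> = z ** (?A ** Jn ** ctranspose z)"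
      unfolding transpose_Jn_ctranspose[OF z] by (simp add: matrix_mul_assoc)
    finally have "A *v (Jn *v u) = z *v (?A *v (Jn *v ?w))"
      by (simp add: matrix_vector_mul_assoc matrix_mul_assoc)
    then have "\<bar>herm u A\<bar> = \<bar>?w \<bullet> (?A *v (Jn *v ?w))\<bar>"
      unfolding herm_def inner_matrix_vector[of u z, symmetric] by simp
    also have "\<dots> \<le> norm ?w * norm (?A *v (Jn *v ?w))" by (rule Cauchy_Schwarz_ineq2)
    also have "\<dots> \<le> norm ?w * (norm ?A * norm ?w * K)" using K(2) by (intro mult_left_mono) auto
    also have "\<dots> = K * norm ?A * herm u (cstr z)"
      unfolding herm_cstr[OF z] by (simp add: power2_eq_square)
    finally show ?thesis .
  qed
  then show ?thesis using K(1) by blast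
qed

lemma norm_ctang:
  assumes "z \<in> SO_star" "A \<in> ctang (cstr z)"
  shows "norm (transpose z ** A ** z) = 2 * sqrt (Re (trace (A ** A)) / 4)"
  unfolding Re_trace_ctang[OF assms] by (simp add: dot_square_norm real_sqrt_divide)

text \<open>The fundamental theorem of calculus is applied on the closed interval with exceptional
  points, so continuity is required also where no derivative is given.\<close>

lemma continuous_coset_cstr_curve:
  assumes c: "piecewise_C1_curve SOU_atlas c" and cS: "c ` {0..1} \<subseteq> SOU"
  shows "continuous_on {0..1} (\<lambda>t. coset_cstr (c t))"
  unfolding continuous_on_eq_continuous_within
proof
  fix t :: real assume t: "t \<in> {0..1}"
  have cU: "\<And>U x. (U, x) \<in> SOU_atlas \<Longrightarrow> openin (top_of_set {0..1}) ({0..1} \<inter> c -` U) \<and>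
      continuous_on ({0..1} \<inter> c -` U) (x \<circ> c)"
    using c unfolding piecewise_C1_curve_def by auto
  have "c t \<in> SOU" using cS t by blast
  then obtain X where X: "X \<in> SOU_atlas \<and> c t \<in> fst X" using atlas_point by blast
  obtain U x where Ux: "X = (U, x)" by (cases X)
  have at: "(U, x) \<in> SOU_atlas" "c t \<in> U" using X Ux by auto
  have "x (c t) \<in> x ` U" using at(2) by blast
  then obtain W S where WS: "x (c t) \<in> W" "local_section U x W S"
    by (rule local_section_exists[OF at(1)])
  interpret sou_section U x W S by unfold_locales (rule at(1), rule WS(2))
  let ?V = "{0..1} \<inter> c -` U"
  have tV: "t \<in> ?V" using t at(2) by blast
  have xc: "continuous (at t within ?V) (x \<circ> c)"
    using cU[OF at(1)] tV continuous_on_eq_continuous_within by blast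
  have "isCont F (x (c t))" using has_derivative_continuous[OF F_has_derivative[OF WS(1)]] .
  then have Fc: "continuous (at t within ?V) (\<lambda>s. F ((x \<circ> c) s))"
    using continuous_within_compose3[OF _ xc, of F] by (simp add: o_def)
  have "eventually (\<lambda>s. (x \<circ> c) s \<in> W) (at t within ?V)"
    by (rule topological_tendstoD[OF xc[unfolded continuous_within] open_W]) (use WS(1) in simp)
  moreover have "eventually (\<lambda>s. s \<in> ?V) (at t within ?V)"
    unfolding eventually_at_filter by (rule always_eventually) simp
  ultimately have "eventually (\<lambda>s. F ((x \<circ> c) s) = coset_cstr (c s)) (at t within ?V)"
    by eventually_elim (use coset_cstr_eq_F in auto)
  then have "continuous (at t within ?V) (\<lambda>s. coset_cstr (c s))"
    using Fc coset_cstr_eq_F[OF at(2) WS(1)] unfolding continuous_within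
    by (auto elim: Lim_transform_eventually)
  moreover obtain O' where O': "open O'" "?V = {0..1} \<inter> O'"
    using cU[OF at(1)] unfolding openin_open by blast
  have "at t within ?V = at t within {0..1}"
    unfolding O'(2) by (rule at_within_nhd[OF _ O'(1)]) (use O'(2) tV in auto)
  ultimately show "continuous (at t within {0..1}) (\<lambda>t. coset_cstr (c t))" by simp
qed

lemma ln_herm_lipschitz:
  "\<exists>K>0. \<forall>(u :: ('n::finite) cvec2) c l. u \<noteq> 0 \<longrightarrow> piecewise_C1_curve SOU_atlas c \<longrightarrow> c ` {0..1} \<subseteq> SOU \<longrightarrow>
     (speed SOU_atlas SOU_metric c has_integral l) {0..1} \<longrightarrow>
     \<bar>ln (herm u (coset_cstr (c 1))) - ln (herm u (coset_cstr (c 0)))\<bar> \<le> K * l"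
proof -
  obtain K where K: "K > 0" "\<forall>(u :: 'n cvec2). \<forall>z\<in>SO_star. \<forall>A\<in>ctang (cstr z).
     \<bar>herm u A\<bar> \<le> K * norm (transpose z ** A ** z) * herm u (cstr z)"
    using herm_ctang_bound by blast
  have "\<bar>ln (herm u (coset_cstr (c 1))) - ln (herm u (coset_cstr (c 0)))\<bar> \<le> 2 * K * l"
    if u: "u \<noteq> 0" and c: "piecewise_C1_curve SOU_atlas c" and cS: "c ` {0..1} \<subseteq> SOU"
    and l: "(speed SOU_atlas SOU_metric c has_integral l) {0..1}" for u :: "'n cvec2" and c l
  proof -
    let ?sp = "speed SOU_atlas SOU_metric c"
    define h where "h = (\<lambda>t. ln (herm u (coset_cstr (c t))))"
    have pos: "herm u (coset_cstr (c t)) > 0" if t: "t \<in> {0..1}" for t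
    proof -
      have "c t \<in> SOU" using cS t by blast
      then obtain z where "z \<in> SO_star" "c t = coset z" unfolding SOU_def by blast
      then show ?thesis using herm_cstr_pos[OF _ u] coset_cstr_coset by metis
    qed
    have contF: "continuous_on {0..1} (\<lambda>t. herm u (coset_cstr (c t)))"
      using bounded_linear.continuous_on[OF bounded_linear_herm continuous_coset_cstr_curve[OF c cS]] .
    have conth: "continuous_on {0..1} h"
      unfolding h_def by (rule continuous_on_ln[OF contF]) (use pos in fastforce)
    have "\<exists>T. finite T \<and> (\<forall>(U, x)\<in>SOU_atlas. (x \<circ> c) C1_differentiable_on ({0<..<1} \<inter> c -` U - T))"
      using c unfolding piecewise_C1_curve_def by (rule conjunct2)
    then obtain T where T: "finite T"
      and C1': "\<forall>(U, x)\<in>SOU_atlas. (x \<circ> c) C1_differentiable_on ({0<..<1} \<inter> c -` U - T)" by blast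
    have C1: "\<And>U x. (U, x) \<in> SOU_atlas \<Longrightarrow> (x \<circ> c) C1_differentiable_on ({0<..<1} \<inter> c -` U - T)"
      using C1' by auto
    have opn: "\<And>U x. (U, x) \<in> SOU_atlas \<Longrightarrow> openin (top_of_set {0..1}) ({0..1} \<inter> c -` U)"
      using c unfolding piecewise_C1_curve_def by auto
    have der: "\<exists>h'. (h has_vector_derivative h') (at t) \<and> \<bar>h'\<bar> \<le> 2 * K * ?sp t" if t: "t \<in> {0<..<1} - T" for t
    proof -
      have t01: "t \<in> {0..1}" using t by auto
      have ctS: "c t \<in> SOU" using cS t01 by blast
      have near: "(x \<circ> c) differentiable (at t) \<and> (\<exists>T. open T \<and> t \<in> T \<and> (\<forall>s\<in>T. c s \<in> U))"
        if at: "(U, x) \<in> SOU_atlas" "c t \<in> U" for U x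
      proof
        have "t \<in> {0<..<1} \<inter> c -` U - T" using t at(2) by blast
        then show "(x \<circ> c) differentiable (at t)"
          using C1[OF at(1)] unfolding C1_differentiable_on_eq by blast
        obtain O' where O': "open O'" "{0..1} \<inter> c -` U = {0..1} \<inter> O'"
          using opn[OF at(1)] unfolding openin_open by blast
        have "t \<in> {0..1} \<inter> c -` U" using t01 at(2) by blast
        then have "t \<in> O' \<inter> {0<..<1}" unfolding O'(2) using t by blast
        moreover have "c s \<in> U" if "s \<in> O' \<inter> {0<..<1}" for s
        proof -
          have "s \<in> {0..1} \<inter> O'" using that by auto
          then show ?thesis unfolding O'(2)[symmetric] by blast
        qed
        ultimately show "\<exists>T. open T \<and> t \<in> T \<and> (\<forall>s\<in>T. c s \<in> U)"
          using O'(1) by (intro exI[of _ "O' \<inter> {0<..<1}"]) (simp add: open_Int)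
      qed
      obtain A where A: "A \<in> ctang (coset_cstr (c t))"
        "((\<lambda>t. coset_cstr (c t)) has_vector_derivative A) (at t)"
        "?sp t = sqrt (Re (trace (A ** A)) / 4)"
        by (rule speed_eq[OF ctS near])
      obtain z where z: "z \<in> SO_star" "c t = coset z" using ctS unfolding SOU_def by blast
      have cz: "coset_cstr (c t) = cstr z" using coset_cstr_coset[OF z(1)] z(2) by simp
      have Az: "A \<in> ctang (cstr z)" using A(1) cz by simp
      have "((\<lambda>t. herm u (coset_cstr (c t))) has_vector_derivative herm u A) (at t)"
        by (rule has_vector_derivative_linear_map[OF A(2) bounded_linear_herm])
      then have "((\<lambda>t. herm u (coset_cstr (c t))) has_real_derivative herm u A) (at t)"
        by (simp add: has_real_derivative_iff_has_vector_derivative)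
      from DERIV_chain2[where f=ln and g="\<lambda>t. herm u (coset_cstr (c t))", OF DERIV_ln_divide[OF pos[OF t01]] this]
      have "(h has_real_derivative (1 / herm u (coset_cstr (c t))) * herm u A) (at t)"
        unfolding h_def .
      moreover have "\<bar>(1 / herm u (coset_cstr (c t))) * herm u A\<bar> \<le> 2 * K * ?sp t"
      proof -
        have "\<bar>herm u A\<bar> \<le> K * norm (transpose z ** A ** z) * herm u (cstr z)" using K(2) z(1) Az by blast
        also have "\<dots> = 2 * K * ?sp t * herm u (cstr z)" unfolding norm_ctang[OF z(1) Az] A(3) by simp
        finally have "\<bar>herm u A\<bar> / herm u (cstr z) \<le> 2 * K * ?sp t"
          using herm_cstr_pos[OF z(1) u] by (simp add: divide_le_eq)
        then show ?thesis unfolding cz using herm_cstr_pos[OF z(1) u] by (simp add: abs_mult)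
      qed
      ultimately show ?thesis unfolding has_real_derivative_iff_has_vector_derivative by blast
    qed
    have "\<forall>t\<in>{0<..<1} - T. \<exists>h'. (h has_vector_derivative h') (at t) \<and> \<bar>h'\<bar> \<le> 2 * K * ?sp t"
      using der by (rule ballI)
    from bchoice[OF this] obtain h' where h'': "\<forall>t\<in>{0<..<1} - T. (h has_vector_derivative h' t) (at t) \<and> \<bar>h' t\<bar> \<le> 2 * K * ?sp t"
      by (elim exE)
    then have h': "\<And>t. t \<in> {0<..<1} - T \<Longrightarrow> (h has_vector_derivative h' t) (at t)"
      "\<And>t. t \<in> {0<..<1} - T \<Longrightarrow> \<bar>h' t\<bar> \<le> 2 * K * ?sp t"
      by blast+
    have fin: "finite (T \<union> {0, 1})" using T by simp
    \<comment> \<open>Both integrands are set to 0 at the finitely many parameters without a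
      derivative bound, so that they can be compared everywhere.\<close>
    have I1: "((\<lambda>t. if t \<in> {0<..<1} - T then h' t else 0) has_integral h 1 - h 0) {0..1}"
    proof (rule has_integral_spike_finite[OF fin])
      show "(h' has_integral h 1 - h 0) {0..1}"
        by (rule fundamental_theorem_of_calculus_interior_strong[OF T _ _ conth]) (use h'(1) in auto)
    qed auto
    have I2: "((\<lambda>t. if t \<in> {0<..<1} - T then 2 * K * ?sp t else 0) has_integral 2 * K * l) {0..1}"
      by (rule has_integral_spike_finite[OF fin _ has_integral_mult_right[OF l]]) auto
    have "h 1 - h 0 \<le> 2 * K * l"
      by (rule has_integral_le[OF I1 I2]) (use h'(2) in force)
    moreover have "- (2 * K * l) \<le> h 1 - h 0"
      by (rule has_integral_le[OF has_integral_neg[OF I2] I1]) (use h'(2) in force)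
    ultimately show ?thesis unfolding h_def by linarith
  qed
  then show ?thesis using K(1) by (intro exI[of _ "2 * K"]) auto
qed

lemma intrinsic_dist_lower:
  "\<exists>K>0. \<forall>(u :: ('n::finite) cvec2) N p q e. u \<noteq> 0 \<longrightarrow> N \<subseteq> SOU \<longrightarrow>
     intrinsic_dist SOU_atlas SOU_metric N p q < ereal e \<longrightarrow>
     \<bar>ln (herm u (coset_cstr q)) - ln (herm u (coset_cstr p))\<bar> \<le> K * e"
proof -
  obtain K where K: "K > 0" "\<forall>(u :: 'n cvec2) c l. u \<noteq> 0 \<longrightarrow> piecewise_C1_curve SOU_atlas c \<longrightarrow> c ` {0..1} \<subseteq> SOU \<longrightarrow>
     (speed SOU_atlas SOU_metric c has_integral l) {0..1} \<longrightarrow>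
     \<bar>ln (herm u (coset_cstr (c 1))) - ln (herm u (coset_cstr (c 0)))\<bar> \<le> K * l"
    using ln_herm_lipschitz by blast
  have "\<bar>ln (herm u (coset_cstr q)) - ln (herm u (coset_cstr p))\<bar> \<le> K * e"
    if u: "u \<noteq> 0" and N: "N \<subseteq> SOU" and d: "intrinsic_dist SOU_atlas SOU_metric N p q < ereal e"
    for u :: "'n cvec2" and N p q e
  proof -
    obtain l c where c: "piecewise_C1_curve SOU_atlas c" "c ` {0..1} \<subseteq> N" "c 0 = p" "c 1 = q"
      "(speed SOU_atlas SOU_metric c has_integral l) {0..1}" "ereal l < ereal e"
      using d unfolding intrinsic_dist_def Inf_less_iff by blast
    have "\<bar>ln (herm u (coset_cstr (c 1))) - ln (herm u (coset_cstr (c 0)))\<bar> \<le> K * l"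
      by (rule K(2)[rule_format, OF u c(1) subset_trans[OF c(2) N] c(5)])
    also have "\<dots> \<le> K * e" using c(6) K(1) by simp
    finally show ?thesis unfolding c(3,4) .
  qed
  then show ?thesis using K(1) by blast
qed

text \<open>Lengths are nonnegative because the Lipschitz estimate bounds an absolute value by
  \<open>K * l\<close>; any nonzero \<open>u\<close> will do.\<close>

lemma intrinsic_dist_nonneg:
  assumes "N \<subseteq> SOU"
  shows "intrinsic_dist SOU_atlas SOU_metric (N :: ('n::finite) cmat2 set set) p q \<ge> 0"
  unfolding intrinsic_dist_def
proof (rule Inf_greatest)
  fix y assume "y \<in> {ereal l |l c. piecewise_C1_curve SOU_atlas c \<and> c ` {0..1} \<subseteq> N \<and> c 0 = p \<and> c 1 = q \<and>
      (speed SOU_atlas SOU_metric c has_integral l) {0..1}}"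
  then obtain l c where c: "y = ereal l" "piecewise_C1_curve SOU_atlas c" "c ` {0..1} \<subseteq> N"
      "(speed SOU_atlas SOU_metric c has_integral l) {0..1}" by blast
  obtain K where K: "K > 0" "\<forall>(u :: 'n cvec2) c l. u \<noteq> 0 \<longrightarrow> piecewise_C1_curve SOU_atlas c \<longrightarrow> c ` {0..1} \<subseteq> SOU \<longrightarrow>
     (speed SOU_atlas SOU_metric c has_integral l) {0..1} \<longrightarrow>
     \<bar>ln (herm u (coset_cstr (c 1))) - ln (herm u (coset_cstr (c 0)))\<bar> \<le> K * l"
    using ln_herm_lipschitz by blast
  have "(1 :: 'n cvec2) \<noteq> 0" by simp
  from order_trans[OF abs_ge_zero K(2)[rule_format, OF this c(2) subset_trans[OF c(3) assms] c(4)]]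
  have "0 \<le> K * l" .
  then show "0 \<le> y" using K(1) c(1) by (simp add: zero_le_mult_iff)
qed

section \<open>Completeness\<close>

lemma C1_differentiable_on_local:
  fixes f :: "real \<Rightarrow> 'a::euclidean_space"
  assumes "\<And>t. t \<in> A \<Longrightarrow> \<exists>B. open B \<and> t \<in> B \<and> Ck_on (Suc 0) B f"
  shows "f C1_differentiable_on A"
  unfolding C1_differentiable_on_eq
proof
  have *: "f differentiable at t \<and> isCont (\<lambda>t. vector_derivative f (at t)) t" if t: "t \<in> A" for t
  proof -
    obtain B where B: "open B" "t \<in> B" "Ck_on (Suc 0) B f" using assms[OF t] by blast
    have d: "(f has_vector_derivative frechet_derivative f (at s) 1) (at s)" if "s \<in> B" for s
      using has_vector_derivative_chain[OF has_vector_derivative_id Ck_on_has_derivative[OF B(1,3) that]] .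
    have "continuous_on B (\<lambda>s. frechet_derivative f (at s) 1)" using B(3) unfolding Ck_on.simps by blast
    then have c: "continuous_on B (\<lambda>t. vector_derivative f (at t))"
      by (rule continuous_on_eq) (use vector_derivative_at[OF d] in simp)
    have "isCont (\<lambda>t. vector_derivative f (at t)) t"
      using iffD1[OF continuous_on_eq_continuous_at[OF B(1)] c] B(2) by blast
    then show ?thesis using differentiableI_vector[OF d[OF B(2)]] by blast
  qed
  then show "\<forall>t\<in>A. f differentiable at t" by blast
  show "continuous_on A (\<lambda>t. vector_derivative f (at t))"
    by (rule continuous_at_imp_continuous_on) (use * in blast)
qed

lemma lifted_curve_C1:
  assumes J: "open J" and \<gamma>: "\<And>k. Ck_on k J \<gamma>" and S: "\<And>t. t \<in> J \<Longrightarrow> \<gamma> t \<in> SO_star"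
    and A: "(U, x) \<in> SOU_atlas"
  shows "(x \<circ> (\<lambda>t. coset (\<gamma> t))) C1_differentiable_on {t \<in> J. coset (\<gamma> t) \<in> U}"
    "openin (top_of_set J) {t \<in> J. coset (\<gamma> t) \<in> U}"
proof -
  have local: "\<exists>B. open B \<and> t \<in> B \<and> B \<subseteq> {t \<in> J. coset (\<gamma> t) \<in> U} \<and> Ck_on (Suc 0) B (x \<circ> (\<lambda>t. coset (\<gamma> t)))"
    if t: "t \<in> {t \<in> J. coset (\<gamma> t) \<in> U}" for t
  proof -
    have g: "\<gamma> t \<in> SO_star" "coset (\<gamma> t) \<in> U" using t S by auto
    obtain W H where W: "open W" "\<gamma> t \<in> W" "\<forall>k. Ck_on k W H"
      and H: "\<forall>w\<in>SO_star \<inter> W. coset w \<in> U \<and> H w = x (coset w)"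
      by (rule chart_lift_exists[OF A g])
    let ?B = "J \<inter> \<gamma> -` W"
    have B: "open ?B"
      by (rule continuous_open_preimage[OF Ck_on_imp_continuous_on[OF \<gamma>[of 0]] J W(1)])
    have "Ck_on (Suc 0) ?B (\<lambda>t. H (\<gamma> t))"
      by (rule Ck_on_compose[OF B W(1) Ck_on_subset[OF \<gamma>] W(3)[rule_format]]) auto
    moreover have "H (\<gamma> s) = (x \<circ> (\<lambda>t. coset (\<gamma> t))) s \<and> coset (\<gamma> s) \<in> U" if "s \<in> ?B" for s
      using H S[of s] that by auto
    ultimately have "Ck_on (Suc 0) ?B (x \<circ> (\<lambda>t. coset (\<gamma> t)))"
      "?B \<subseteq> {t \<in> J. coset (\<gamma> t) \<in> U}"
      using Ck_on_cong[OF B, of "\<lambda>t. H (\<gamma> t)" "x \<circ> (\<lambda>t. coset (\<gamma> t))" "Suc 0"] by blast+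
    then show ?thesis using B t W(2) by (intro exI[of _ ?B]) auto
  qed
  show "(x \<circ> (\<lambda>t. coset (\<gamma> t))) C1_differentiable_on {t \<in> J. coset (\<gamma> t) \<in> U}"
    by (rule C1_differentiable_on_local) (use local in blast)
  have "open {t \<in> J. coset (\<gamma> t) \<in> U}"
    unfolding open_subopen[of "{t \<in> J. coset (\<gamma> t) \<in> U}"] using local by blast
  then show "openin (top_of_set J) {t \<in> J. coset (\<gamma> t) \<in> U}"
    using J by (simp add: openin_open_eq)
qed

lemma lifted_curve_piecewise_C1:
  fixes \<gamma> :: "real \<Rightarrow> ('n::finite) cmat2"
  assumes J: "open J" "{0..1} \<subseteq> J" and \<gamma>: "\<And>k. Ck_on k J \<gamma>" and S: "\<And>t. t \<in> J \<Longrightarrow> \<gamma> t \<in> SO_star"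
  shows "piecewise_C1_curve SOU_atlas (\<lambda>t. coset (\<gamma> t))"
proof -
  let ?c = "\<lambda>t. coset (\<gamma> t)"
  have main: "openin (top_of_set {0..1}) ({0..1} \<inter> ?c -` U) \<and> continuous_on ({0..1} \<inter> ?c -` U) (x \<circ> ?c) \<and>
      (x \<circ> ?c) C1_differentiable_on ({0<..<1} \<inter> ?c -` U - {})"
    if A: "(U, x) \<in> SOU_atlas" for U x
  proof (intro conjI)
    let ?P = "{t \<in> J. ?c t \<in> U}"
    note l = lifted_curve_C1[OF J(1) \<gamma> S A]
    have "open ?P" using l(2) openin_open_eq[OF J(1)] by blast
    moreover have "{0..1} \<inter> ?c -` U = {0..1} \<inter> ?P" using J(2) by auto
    ultimately show "openin (top_of_set {0..1}) ({0..1} \<inter> ?c -` U)" by (simp only: openin_open_Int)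
    have sub: "{0..1} \<inter> ?c -` U \<subseteq> ?P" "{0<..<1} \<inter> ?c -` U - {} \<subseteq> ?P" using J(2) by auto
    have "continuous_on ?P (x \<circ> ?c)"
      using C1_differentiable_imp_continuous_on[OF l(1)] .
    then show "continuous_on ({0..1} \<inter> ?c -` U) (x \<circ> ?c)" using sub(1) by (rule continuous_on_subset)
    show "(x \<circ> ?c) C1_differentiable_on ({0<..<1} \<inter> ?c -` U - {})"
      by (rule C1_differentiable_on_subset[OF l(1) sub(2)])
  qed
  show ?thesis
    unfolding piecewise_C1_curve_def
    by (intro conjI exI[of _ "{}"] ballI) (use main in auto)
qed

lemma lifted_curve_speed:
  fixes \<gamma> :: "real \<Rightarrow> ('n::finite) cmat2"
  assumes J: "open J" and \<gamma>: "\<And>k. Ck_on k J \<gamma>" and S: "\<And>t. t \<in> J \<Longrightarrow> \<gamma> t \<in> SO_star" and t: "t \<in> J"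
    and A: "((\<lambda>t. cstr (\<gamma> t)) has_vector_derivative A) (at t)"
  shows "speed SOU_atlas SOU_metric (\<lambda>t. coset (\<gamma> t)) t = sqrt (Re (trace (A ** A)) / 4)"
proof -
  let ?c = "\<lambda>t. coset (\<gamma> t)"
  have cS: "?c t \<in> SOU" unfolding SOU_def using S[OF t] by blast
  have near: "(x \<circ> ?c) differentiable (at t) \<and> (\<exists>T. open T \<and> t \<in> T \<and> (\<forall>s\<in>T. ?c s \<in> U))"
    if at: "(U, x) \<in> SOU_atlas" "?c t \<in> U" for U x
  proof
    note l = lifted_curve_C1[OF J \<gamma> S at(1)]
    have tP: "t \<in> {t \<in> J. ?c t \<in> U}" using t at(2) by simp
    then show "(x \<circ> ?c) differentiable (at t)" using l(1) unfolding C1_differentiable_on_eq by blast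
    have "open {t \<in> J. ?c t \<in> U}" using l(2) openin_open_eq[OF J] by blast
    then show "\<exists>T. open T \<and> t \<in> T \<and> (\<forall>s\<in>T. ?c s \<in> U)" using tP by blast
  qed
  obtain B where B: "((\<lambda>t. coset_cstr (?c t)) has_vector_derivative B) (at t)"
    "speed SOU_atlas SOU_metric ?c t = sqrt (Re (trace (B ** B)) / 4)"
    by (rule speed_eq[OF cS near])
  have "B = A"
    by (rule has_vector_derivative_eq_locally[OF B(1) A J t]) (simp only: coset_cstr_coset[OF S])
  then show ?thesis using B(2) by simp
qed

text \<open>Segments in a slice chart stay in \<open>L\<close>, hence in the zero set, and their
  length is at most a constant times the coordinate distance. This turns convergence of matrices
  into convergence for the intrinsic distance.\<close>

lemma intrinsic_dist_upper:
  fixes a b :: "('n::finite) cvec2"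
  assumes ab: "bilin a a = 0" "bilin a b = 0" "bilin b b \<noteq> 0" "a \<noteq> 0"
    and zS: "z \<in> SO_star" and 0: "bilin b (cstr z *v a) = 0" and \<epsilon>: "\<epsilon> > 0"
  shows "\<exists>\<delta>>0. \<forall>w\<in>SO_star. norm (w - z) < \<delta> \<longrightarrow> bilin b (cstr w *v a) = 0 \<longrightarrow>
    intrinsic_dist SOU_atlas SOU_metric (phi a b -` {0} \<inter> SOU) (coset w) (coset z) < ereal \<epsilon>"
proof -
  let ?N = "phi a b -` {0} \<inter> SOU"
  obtain U \<Lambda> L where sl: "slice_chart p_alg SOU_atlas ?N (U, \<lambda>p. \<Lambda> (coset_cstr p)) L" "coset z \<in> U"
    by (rule slice_chart_exists[OF ab zS 0]) blast
  define x where "x = (\<lambda>p. \<Lambda> (coset_cstr p))"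
  have slice: "slice_chart p_alg SOU_atlas ?N (U, x) L" using sl(1) unfolding x_def .
  have at: "(U, x) \<in> SOU_atlas" using slice unfolding slice_chart_def by simp
  have inN: "coset w \<in> ?N" if "w \<in> SO_star" "bilin b (cstr w *v a) = 0" for w
    using phi_eq[OF that(1)] that unfolding SOU_def by auto
  define q where "q = x (coset z)"
  have qN: "q \<in> x ` (U \<inter> ?N)" unfolding q_def using sl(2) inN[OF zS 0] by blast
  then have "q \<in> x ` U" by blast
  then obtain W S where WS: "q \<in> W" "local_section U x W S" by (rule local_section_exists[OF at])
  interpret zero_set_slice U x W S a b L q
    by unfold_locales (fact at, fact WS(2), fact ab(1), fact ab(2), fact ab(3), fact ab(4), fact slice, fact qN, fact WS(1))
  obtain \<rho> where \<rho>: "\<rho> > 0" "cball q \<rho> \<subseteq> W" using open_contains_cball open_W WS(1) by blast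
  have "\<exists>C>0. \<forall>r\<in>cball q \<rho>. \<forall>v. norm (D r v) \<le> C * norm v"
  proof -
    have "\<exists>M. \<forall>r\<in>cball q \<rho>. norm (D r e) \<le> M" for e
    proof -
      have "continuous_on (cball q \<rho>) (\<lambda>r. D r e)"
        using continuous_on_subset[OF Ck_on_imp_continuous_on[OF Ck_D[of 0 e]] \<rho>(2)] .
      then have "compact ((\<lambda>r. D r e) ` cball q \<rho>)" by (rule compact_continuous_image) simp
      then obtain M where "\<forall>y\<in>(\<lambda>r. D r e) ` cball q \<rho>. norm y \<le> M"
        using compact_imp_bounded bounded_iff by blast
      then show ?thesis by blast
    qed
    then have "\<forall>e. \<exists>M. \<forall>r\<in>cball q \<rho>. norm (D r e) \<le> M" by (rule allI)
    from choice[OF this] obtain M where M: "\<forall>e. \<forall>r\<in>cball q \<rho>. norm (D r e) \<le> M e" by (elim exE)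
    have "norm (D r v) \<le> (1 + (\<Sum>e\<in>Basis. \<bar>M e\<bar>)) * norm v" if r: "r \<in> cball q \<rho>" for r v
    proof -
      have "D r v = (\<Sum>e\<in>Basis. (v \<bullet> e) *\<^sub>R D r e)"
        by (rule linear_Basis_expansion[OF linear_D]) (use r \<rho>(2) in blast)
      also have "norm \<dots> \<le> (\<Sum>e\<in>Basis. norm v * \<bar>M e\<bar>)"
      proof (rule sum_norm_le)
        fix e :: "'n cmat2" assume e: "e \<in> Basis"
        have "norm (D r e) \<le> \<bar>M e\<bar>" using M r by (meson abs_ge_self order_trans)
        then show "norm ((v \<bullet> e) *\<^sub>R D r e) \<le> norm v * \<bar>M e\<bar>"
          unfolding norm_scaleR using Basis_le_norm[OF e, of v] by (intro mult_mono) auto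
      qed
      also have "\<dots> = (\<Sum>e\<in>Basis. \<bar>M e\<bar>) * norm v" by (simp add: sum_distrib_left mult.commute)
      also have "\<dots> \<le> (1 + (\<Sum>e\<in>Basis. \<bar>M e\<bar>)) * norm v" by (simp add: distrib_right)
      finally show ?thesis .
    qed
    moreover have "1 + (\<Sum>e\<in>(Basis :: 'n cmat2 set). \<bar>M e\<bar>) > 0"
      by (intro add_pos_nonneg sum_nonneg) auto
    ultimately show ?thesis by (intro exI[of _ "1 + (\<Sum>e\<in>(Basis :: 'n cmat2 set). \<bar>M e\<bar>)"] conjI ballI allI)
  qed
  then obtain C where C: "C > 0" "\<forall>r\<in>cball q \<rho>. \<forall>v. norm (D r v) \<le> C * norm v" by blast
  have "\<exists>K>0. \<forall>A :: 'n cmat2. sqrt (Re (trace (A ** A)) / 4) \<le> K * norm A"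
  proof -
    obtain K1 where K1: "K1 > 0" "\<forall>(A :: 'n cmat2) (B :: 'n cmat2). norm (A ** B) \<le> norm A * norm B * K1"
      using matrix_mult_norm_bound by blast
    obtain K2 where K2: "K2 > 0" "\<forall>A :: 'n cmat2. norm (trace A) \<le> norm A * K2"
      using bounded_linear.pos_bounded[OF bounded_linear_trace] by blast
    have "sqrt (Re (trace (A ** A)) / 4) \<le> sqrt (K1 * K2) * norm A" for A :: "'n cmat2"
    proof -
      have "Re (trace (A ** A)) \<le> norm (trace (A ** A))" by (rule complex_Re_le_cmod)
      also have "\<dots> \<le> norm (A ** A) * K2" using K2(2) by blast
      also have "\<dots> \<le> norm A * norm A * K1 * K2" using K1(2) K2(1) by (intro mult_right_mono) auto
      also have "\<dots> = (K1 * K2) * (norm A)\<^sup>2" by (simp add: power2_eq_square mult_ac)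
      finally have 1: "Re (trace (A ** A)) \<le> (K1 * K2) * (norm A)\<^sup>2" .
      have "(K1 * K2) * (norm A)\<^sup>2 \<ge> 0" using K1(1) K2(1) by simp
      with 1 have "Re (trace (A ** A)) / 4 \<le> (K1 * K2) * (norm A)\<^sup>2" by linarith
      then have "sqrt (Re (trace (A ** A)) / 4) \<le> sqrt ((K1 * K2) * (norm A)\<^sup>2)" by (rule real_sqrt_le_mono)
      then show ?thesis by (simp add: real_sqrt_mult)
    qed
    then show ?thesis using K1(1) K2(1) by (intro exI[of _ "sqrt (K1 * K2)"]) simp
  qed
  then obtain K where K: "K > 0" "\<forall>A :: 'n cmat2. sqrt (Re (trace (A ** A)) / 4) \<le> K * norm A" by blast
  have near: "intrinsic_dist SOU_atlas SOU_metric ?N (coset w) (coset z) \<le> ereal (K * C * norm (q - x (coset w)))"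
    if w: "w \<in> SO_star" "coset w \<in> U" "bilin b (cstr w *v a) = 0" and r: "norm (x (coset w) - q) \<le> \<rho>" for w
  proof -
    define r where "r = x (coset w)"
    have rL: "r \<in> L"
    proof -
      have "r \<in> x ` (U \<inter> ?N)" unfolding r_def using w(2) inN[OF w(1,3)] by blast
      then show ?thesis unfolding image_slice by blast
    qed
    have rq: "norm (r - q) \<le> \<rho>" using r unfolding r_def .
    let ?v = "q - r"
    define \<sigma> where "\<sigma> = (\<lambda>t::real. r + t *\<^sub>R ?v)"
    have \<sigma>L: "\<sigma> t \<in> L" for t
      unfolding \<sigma>_def using rL qL(1) L(1) by (simp add: subspace_add subspace_scale subspace_diff)
    have \<sigma>p: "\<sigma> t \<in> p_alg" for t using \<sigma>L L(2) by blast
    have \<sigma>ball: "\<sigma> t \<in> cball q \<rho>" if t: "t \<in> {0..1}" for t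
    proof -
      have "q - \<sigma> t = (1 - t) *\<^sub>R (q - r)" unfolding \<sigma>_def by (simp add: algebra_simps)
      then have "norm (q - \<sigma> t) = (1 - t) * norm (r - q)" using t by (simp add: norm_minus_commute)
      also have "\<dots> \<le> 1 * norm (r - q)" using t by (intro mult_right_mono) auto
      finally show ?thesis using rq by (simp add: dist_norm)
    qed
    define J where "J = \<sigma> -` W"
    have J: "open J" unfolding J_def \<sigma>_def by (rule open_vimage[OF open_W]) (intro continuous_intros)
    have J01: "{0..1} \<subseteq> J" unfolding J_def using \<sigma>ball \<rho>(2) by blast
    define \<gamma> where "\<gamma> = (\<lambda>t. S (\<sigma> t))"
    have C\<sigma>: "Ck_on k J \<sigma>" for k
      unfolding \<sigma>_def by (intro Ck_on_add J Ck_on_const Ck_on_bounded_linear bounded_linear_scaleR_left)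
    have C\<gamma>: "Ck_on k J \<gamma>" for k
      unfolding \<gamma>_def
      by (rule Ck_on_compose[OF J open_W C\<sigma> local_sectionD(2)[OF sec]]) (auto simp: J_def)
    have \<gamma>S: "\<gamma> t \<in> SO_star" if "t \<in> J" for t
      unfolding \<gamma>_def using local_sectionD(3)[OF sec \<sigma>p] that unfolding J_def by simp
    let ?c = "\<lambda>t. coset (\<gamma> t)"
    have c1: "piecewise_C1_curve SOU_atlas ?c" by (rule lifted_curve_piecewise_C1[OF J J01 C\<gamma> \<gamma>S])
    have c2: "?c ` {0..1} \<subseteq> ?N"
    proof (rule image_subsetI)
      fix t :: real assume "t \<in> {0..1}"
      then have t: "t \<in> J" using J01 by blast
      then have "bilin b (F (\<sigma> t) *v a) = 0" using bilin_F_zero[OF _ \<sigma>L] unfolding J_def by simp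
      then show "?c t \<in> ?N" using inN[OF \<gamma>S[OF t]] unfolding F_def \<gamma>_def by simp
    qed
    have "r \<in> W" using \<sigma>ball[of 0] \<rho>(2) unfolding \<sigma>_def by auto
    then have c3: "?c 0 = coset w" using coset_eq_section[OF w(2)] unfolding \<gamma>_def \<sigma>_def r_def by simp
    have c4: "?c 1 = coset z"
      using coset_eq_section[OF sl(2)] WS(1) unfolding \<gamma>_def \<sigma>_def q_def[symmetric] by simp
    define f where "f = (\<lambda>t. sqrt (Re (trace (D (\<sigma> t) ?v ** D (\<sigma> t) ?v)) / 4))"
    have sp: "speed SOU_atlas SOU_metric ?c t = f t" if t: "t \<in> {0..1}" for t
    proof -
      have tJ: "t \<in> J" using t J01 by blast
      then have "\<sigma> t \<in> W" unfolding J_def by simp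
      then have "((\<lambda>t. F (\<sigma> t)) has_vector_derivative D (\<sigma> t) ?v) (at t)"
        unfolding \<sigma>_def by (intro has_vector_derivative_chain[OF line_derivative] F_has_derivative)
      then have "((\<lambda>t. cstr (\<gamma> t)) has_vector_derivative D (\<sigma> t) ?v) (at t)" unfolding F_def \<gamma>_def .
      from lifted_curve_speed[OF J C\<gamma> \<gamma>S tJ this] show ?thesis unfolding f_def .
    qed
    have cD: "continuous_on {0..1} (\<lambda>t. D (\<sigma> t) ?v)"
    proof (rule continuous_on_compose2[OF Ck_on_imp_continuous_on[OF Ck_D[of 0 ?v]]])
      show "continuous_on {0..1} \<sigma>" unfolding \<sigma>_def by (intro continuous_intros)
      show "\<sigma> ` {0..1} \<subseteq> W" using J01 unfolding J_def by blast
    qed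
    have "continuous_on {0..1} f"
      unfolding f_def
      by (intro continuous_on_real_sqrt continuous_on_divide continuous_on_Re continuous_on_const
          bounded_linear.continuous_on[OF bounded_linear_trace]
          bounded_bilinear.continuous_on[OF bounded_bilinear_matrix_mult] cD) simp
    then obtain l where l: "(f has_integral l) {0..1}"
      using integrable_continuous_real integrable_on_def by blast
    have l': "(speed SOU_atlas SOU_metric ?c has_integral l) {0..1}"
      by (rule has_integral_eq[OF _ l]) (use sp in simp)
    have "f t \<le> K * C * norm ?v" if t: "t \<in> {0..1}" for t
    proof -
      have "f t \<le> K * norm (D (\<sigma> t) ?v)" unfolding f_def using K(2) by blast
      also have "\<dots> \<le> K * (C * norm ?v)" using C(2) \<sigma>ball[OF t] K(1) by (intro mult_left_mono) auto
      finally show ?thesis by (simp add: mult.assoc)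
    qed
    then have "l \<le> K * C * norm ?v"
      using has_integral_le[OF l has_integral_const_real[of "K * C * norm ?v" 0 1]] by simp
    moreover have "intrinsic_dist SOU_atlas SOU_metric ?N (coset w) (coset z) \<le> ereal l"
      unfolding intrinsic_dist_def by (rule Inf_lower) (use c1 c2 c3 c4 l' in blast)
    ultimately show ?thesis unfolding r_def by (meson ereal_less_eq(3) order_trans)
  qed
  \<comment> \<open>The factor 2 leaves room for the strict inequality, and \<rho> keeps the segment
    inside the domain of the section.\<close>
  define \<eta> where "\<eta> = min \<rho> (\<epsilon> / (2 * K * C))"
  have \<eta>: "\<eta> > 0" "\<eta> \<le> \<rho>" "K * C * \<eta> < \<epsilon>"
  proof -
    show "\<eta> > 0" "\<eta> \<le> \<rho>" unfolding \<eta>_def using \<rho>(1) \<epsilon> K(1) C(1) by auto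
    have "K * C * \<eta> \<le> K * C * (\<epsilon> / (2 * K * C))" unfolding \<eta>_def using K(1) C(1) by (intro mult_left_mono) auto
    also have "\<dots> = \<epsilon> / 2" using K(1) C(1) by simp
    finally show "K * C * \<eta> < \<epsilon>" using \<epsilon> by simp
  qed
  obtain W' H where W': "open W'" "z \<in> W'" "\<forall>k. Ck_on k W' H"
    and H: "\<forall>w\<in>SO_star \<inter> W'. coset w \<in> U \<and> H w = x (coset w)"
    by (rule chart_lift_exists[OF at zS sl(2)])
  have "isCont H z"
    using iffD1[OF continuous_on_eq_continuous_at[OF W'(1)] Ck_on_imp_continuous_on[OF W'(3)[rule_format, of 0]]] W'(2)
    by (rule bspec)
  then obtain \<delta>1 where \<delta>1: "\<delta>1 > 0" "\<forall>w. dist w z < \<delta>1 \<longrightarrow> dist (H w) (H z) < \<eta>"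
    using \<eta>(1) unfolding continuous_at_eps_delta by blast
  obtain \<delta>2 where \<delta>2: "\<delta>2 > 0" "ball z \<delta>2 \<subseteq> W'" using W'(1,2) openE by blast
  show ?thesis
  proof (intro exI[of _ "min \<delta>1 \<delta>2"] conjI ballI impI)
    show "min \<delta>1 \<delta>2 > 0" using \<delta>1 \<delta>2 by simp
    fix w assume w: "w \<in> SO_star" "norm (w - z) < min \<delta>1 \<delta>2" "bilin b (cstr w *v a) = 0"
    have "w \<in> W'" using \<delta>2(2) w(2) by (auto simp: dist_norm norm_minus_commute)
    then have wU: "coset w \<in> U" "H w = x (coset w)" using H w(1) by blast+
    have "H z = q" using H zS W'(2) unfolding q_def by blast
    moreover have "dist (H w) (H z) < \<eta>" using \<delta>1(2) w(2) by (simp add: dist_norm)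
    ultimately have n: "norm (x (coset w) - q) < \<eta>" unfolding wU(2) by (simp add: dist_norm)
    have "intrinsic_dist SOU_atlas SOU_metric ?N (coset w) (coset z) \<le> ereal (K * C * norm (q - x (coset w)))"
      by (rule near[OF w(1) wU(1) w(3)]) (use n \<eta>(2) in simp)
    also have "\<dots> < ereal \<epsilon>"
    proof -
      have "K * C * norm (q - x (coset w)) \<le> K * C * \<eta>"
        using n K(1) C(1) by (intro mult_left_mono) (auto simp: norm_minus_commute)
      then show ?thesis using \<eta>(3) by simp
    qed
    finally show "intrinsic_dist SOU_atlas SOU_metric ?N (coset w) (coset z) < ereal \<epsilon>" .
  qed
qed

text \<open>\<open>cstr z ** Jn\<close> is Hermitian, so polarisation recovers it from the quadratic
  form \<open>herm\<close>, and \<open>Jn\<close> is invertible.\<close>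

lemma herm_determines_cstr:
  fixes z w :: "('n::finite) cmat2"
  assumes z: "z \<in> SO_star" and w: "w \<in> SO_star" and e: "\<And>u. u \<noteq> 0 \<Longrightarrow> herm u (cstr z) = herm u (cstr w)"
  shows "cstr z = cstr w"
proof -
  define M where "M = (cstr z - cstr w) ** Jn"
  have h: "ctranspose (cstr v ** Jn) = cstr v ** Jn" if v: "v \<in> SO_star" for v :: "'n cmat2"
  proof -
    have "ctranspose (cstr v ** Jn) = transpose Jn ** transpose (cnj_mat (cstr v))"
      unfolding ctranspose_def cnj_mat_mult cnj_mat_Jn matrix_transpose_mul ..
    also have "transpose (cnj_mat (cstr v)) = Jn ** cstr v ** Jn"
      unfolding cstr_props(3)[OF v]
      by (simp add: transpose_minus matrix_transpose_mul transpose_Jn cstr_props(2)[OF v] matrix_ring)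
    finally show ?thesis unfolding transpose_Jn
      by (simp add: matrix_mult_minus_left matrix_mul_assoc Jn_Jn)
  qed
  have hM: "ctranspose M = M"
    using h[OF z] h[OF w] unfolding M_def by (simp add: ctranspose_def matrix_conv matrix_diff_rdistrib)
  have q0: "u \<bullet> (M *v u) = 0" for u
  proof (cases "u = 0")
    case False
    then have "herm u (cstr z) - herm u (cstr w) = 0" using e by simp
    then show ?thesis
      unfolding herm_def M_def
      by (simp add: matrix_vector_mul_assoc matrix_diff_rdistrib matrix_vector_mult_diff_rdistrib inner_diff_right)
  qed simp
  have "u \<bullet> (M *v v) = 0" for u v
  proof -
    have "(u + v) \<bullet> (M *v (u + v)) = 0" by (rule q0)
    then have "u \<bullet> (M *v v) + v \<bullet> (M *v u) = 0"
      by (simp add: matrix_vector_right_distrib inner_add_left inner_add_right q0)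
    moreover have "v \<bullet> (M *v u) = u \<bullet> (M *v v)"
      using inner_matrix_vector[of v M u] hM by (simp add: inner_commute)
    ultimately show ?thesis by simp
  qed
  then have "M *v v = 0" for v using inner_eq_zero_iff by metis
  then have "M = 0" by (metis matrix_eq matrix_vector_mult_0)
  then have "M ** Jn = 0" by simp
  then show ?thesis unfolding M_def by (simp add: Jn_Jn')
qed

lemma closed_SO_star: "closed (SO_star :: ('n::finite) cmat2 set)"
proof -
  have c: "continuous_on UNIV (\<lambda>z :: 'n cmat2. z ** transpose z)"
    "continuous_on UNIV (\<lambda>z :: 'n cmat2. cnj_mat z ** Jn ** transpose z)"
    by (intro bounded_bilinear.continuous_on[OF bounded_bilinear_matrix_mult] continuous_on_id continuous_on_const
        linear_continuous_on[OF bounded_linear_transpose] linear_continuous_on[OF bounded_linear_cnj_mat])+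
  have "closed ({z. z ** transpose z = mat 1} \<inter> {z. det z = 1} \<inter> {z :: 'n cmat2. cnj_mat z ** Jn ** transpose z = Jn})"
    by (intro closed_Int closed_Collect_eq c continuous_on_det continuous_on_const)
  moreover have "SO_star = {z. z ** transpose z = mat 1} \<inter> {z. det z = 1} \<inter> {z :: 'n cmat2. cnj_mat z ** Jn ** transpose z = Jn}"
    unfolding SO_star_def by auto
  ultimately show ?thesis by simp
qed

text \<open>The vectors on the right are the conjugated rows of \<open>z\<close>; for group elements
  \<open>herm\<close> at the coordinate vectors controls their norms.\<close>

lemma norm_matrix_le_columns:
  fixes z :: "complex^'m^'m"
  shows "norm z \<le> (\<Sum>j\<in>UNIV. norm (ctranspose z *v axis j 1))"
proof -
  have "ctranspose z *v axis j 1 = (\<chi> k. cnj (z $ j $ k))" for j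
    by (simp add: vec_eq_iff matrix_vector_mult_def axis_def ctranspose_def transpose_def cnj_mat_def
        if_distrib cong: if_cong)
  then have "norm (ctranspose z *v axis j 1) = norm (z $ j)" for j
    by (simp add: norm_vec_def)
  then show ?thesis unfolding norm_vec_def[of z] using L2_set_le_sum[of UNIV "\<lambda>i. norm (z $ i)"] by simp
qed

lemma complete_zero_set:
  fixes a b :: "('n::finite) cvec2"
  assumes ab: "bilin a a = 0" "bilin a b = 0" "bilin b b \<noteq> 0" "a \<noteq> 0"
  shows "complete_submanifold SOU_atlas SOU_metric (phi a b -` {0} \<inter> SOU)"
  unfolding complete_submanifold_def
proof (intro allI impI)
  let ?N = "phi a b -` {0} \<inter> SOU" and ?d = "intrinsic_dist SOU_atlas SOU_metric (phi a b -` {0} \<inter> SOU)"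
  fix p :: "nat \<Rightarrow> 'n cmat2 set"
  assume pN: "\<forall>i. p i \<in> ?N" and cauchy: "\<forall>e>0. \<exists>k. \<forall>i\<ge>k. \<forall>j\<ge>k. ?d (p i) (p j) < ereal e"
  have NS: "?N \<subseteq> SOU" by blast
  have "\<forall>i. \<exists>z. z \<in> SO_star \<and> p i = coset z" using pN unfolding SOU_def by blast
  from choice[OF this] obtain z where z: "\<forall>i. z i \<in> SO_star \<and> p i = coset (z i)" by (elim exE)
  have zS: "z i \<in> SO_star" and pz: "p i = coset (z i)" for i using z by auto
  have zc: "coset_cstr (p i) = cstr (z i)" for i unfolding pz by (rule coset_cstr_coset[OF zS])
  have z0: "bilin b (cstr (z i) *v a) = 0" for i
  proof -
    have "phi a b (p i) = 0" using pN by simp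
    then show ?thesis unfolding pz phi_eq[OF zS] .
  qed
  obtain K where K: "K > 0" "\<forall>(u :: 'n cvec2) N p q e. u \<noteq> 0 \<longrightarrow> N \<subseteq> SOU \<longrightarrow>
     intrinsic_dist SOU_atlas SOU_metric N p q < ereal e \<longrightarrow>
     \<bar>ln (herm u (coset_cstr q)) - ln (herm u (coset_cstr p))\<bar> \<le> K * e"
    using intrinsic_dist_lower by blast
  have lip: "\<bar>ln (herm u (cstr (z j))) - ln (herm u (cstr (z i)))\<bar> \<le> K * e"
    if "u \<noteq> 0" "?d (p i) (p j) < ereal e" for u i j e
    using K(2)[rule_format, OF that(1) NS that(2)] unfolding zc .
  obtain k where k: "\<forall>i\<ge>k. \<forall>j\<ge>k. ?d (p i) (p j) < ereal 1" using cauchy zero_less_one by blast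
  \<comment> \<open>Tolerance 1 is enough for boundedness: from index \<open>k\<close> on, the
    logarithms stay within \<open>K\<close> of their value at \<open>k\<close>.\<close>
  have "\<exists>B. \<forall>i\<ge>k. norm (ctranspose (z i) *v axis j 1) \<le> B" for j
  proof -
    let ?u = "axis j 1 :: 'n cvec2"
    have u: "?u \<noteq> 0" by (simp add: axis_eq_0_iff)
    have "norm (ctranspose (z i) *v ?u) \<le> sqrt (exp (ln (herm ?u (cstr (z k))) + K))" if i: "i \<ge> k" for i
    proof -
      have "\<bar>ln (herm ?u (cstr (z i))) - ln (herm ?u (cstr (z k)))\<bar> \<le> K * 1"
        by (rule lip[OF u]) (use k i in simp)
      then have "ln (herm ?u (cstr (z i))) \<le> ln (herm ?u (cstr (z k))) + K" by linarith
      then have "exp (ln (herm ?u (cstr (z i)))) \<le> exp (ln (herm ?u (cstr (z k))) + K)" by simp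
      then have "herm ?u (cstr (z i)) \<le> exp (ln (herm ?u (cstr (z k))) + K)"
        using herm_cstr_pos[OF zS u] by simp
      then show ?thesis unfolding herm_cstr[OF zS] by (rule real_le_rsqrt)
    qed
    then show ?thesis by blast
  qed
  then have "\<forall>j. \<exists>B. \<forall>i\<ge>k. norm (ctranspose (z i) *v axis j 1) \<le> B" by (rule allI)
  from choice[OF this] obtain B where B: "\<forall>j. \<forall>i\<ge>k. norm (ctranspose (z i) *v axis j 1) \<le> B j" by (elim exE)
  have zb: "norm (z i) \<le> (\<Sum>j\<in>UNIV. B j)" if "i \<ge> k" for i
    using norm_matrix_le_columns[of "z i"] sum_mono[of UNIV "\<lambda>j. norm (ctranspose (z i) *v axis j 1)" B] B that
    by force
  \<comment> \<open>Representatives are determined only up to unitary factors, so they need not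
    converge even if the cosets do. The statement is kept for arbitrary index sequences because it
    is applied twice.\<close>
  have limit: "\<exists>l r. strict_mono (r :: nat \<Rightarrow> nat) \<and> (\<lambda>n. z (s (r n))) \<longlonglongrightarrow> l \<and> l \<in> SO_star \<and> bilin b (cstr l *v a) = 0"
    if s: "\<And>n. s n \<ge> k" for s :: "nat \<Rightarrow> nat"
  proof -
    have "bounded (range (\<lambda>n. z (s n)))" unfolding bounded_iff using zb s by blast
    from bounded_imp_convergent_subsequence[OF this]
    obtain l r where lr: "strict_mono r" "((\<lambda>n. z (s n)) \<circ> r) \<longlonglongrightarrow> l" by blast
    then have lim: "(\<lambda>n. z (s (r n))) \<longlonglongrightarrow> l" by (simp add: o_def)
    have lS: "l \<in> SO_star"
      by (rule closed_sequentially[OF closed_SO_star _ lim]) (rule zS)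
    have "continuous_on UNIV (\<lambda>z :: 'n cmat2. bilin b (cstr z *v a))"
      by (rule bounded_linear.continuous_on[OF bounded_linear_bilin_mult continuous_on_cstr])
    then have "isCont (\<lambda>z. bilin b (cstr z *v a)) l" by (simp add: continuous_on_eq_continuous_at)
    from isCont_tendsto_compose[OF this lim] have "(\<lambda>n. 0) \<longlonglongrightarrow> bilin b (cstr l *v a)" unfolding z0 .
    from LIMSEQ_unique[OF tendsto_const this] have "bilin b (cstr l *v a) = 0" by simp
    then show ?thesis using lr(1) lim lS by blast
  qed
  obtain l r where r: "strict_mono (r :: nat \<Rightarrow> nat)" and lr: "(\<lambda>n. z (k + r n)) \<longlonglongrightarrow> l"
    and l: "l \<in> SO_star" "bilin b (cstr l *v a) = 0"
    using limit[of "\<lambda>n. k + n"] by auto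
  have hc: "(\<lambda>n. ln (herm u (cstr (w n)))) \<longlonglongrightarrow> ln (herm u (cstr v))"
    if u: "u \<noteq> 0" and v: "v \<in> SO_star" and w: "w \<longlonglongrightarrow> v" for u v and w :: "nat \<Rightarrow> 'n cmat2"
  proof -
    have "continuous_on UNIV (\<lambda>z :: 'n cmat2. herm u (cstr z))"
      by (rule bounded_linear.continuous_on[OF bounded_linear_herm continuous_on_cstr])
    then have "isCont (\<lambda>z. herm u (cstr z)) v" by (simp add: continuous_on_eq_continuous_at)
    from isCont_tendsto_compose[OF this w] show ?thesis
      by (rule tendsto_ln) (use herm_cstr_pos[OF v u] in simp)
  qed
  \<comment> \<open>Otherwise infinitely many terms stay away from \<open>coset l\<close>. Some of
    them converge to another limit \<open>l'\<close>; the Cauchy condition gives both limits the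
    same Hermitian form, hence the same coset, and short curves into \<open>coset l'\<close>
    contradict the assumption.\<close>
  have ev: "eventually (\<lambda>i. ?d (p i) (coset l) < ereal \<epsilon>) sequentially" if \<epsilon>: "\<epsilon> > 0" for \<epsilon>
  proof (rule ccontr)
    assume "\<not> eventually (\<lambda>i. ?d (p i) (coset l) < ereal \<epsilon>) sequentially"
    then have "\<forall>m. \<exists>i\<ge>m. \<not> ?d (p i) (coset l) < ereal \<epsilon>" unfolding eventually_sequentially by blast
    \<comment> \<open>The bound \<open>k + m\<close> puts the index into the bounded tail and also
      makes it at least \<open>m\<close>, so that it tends to infinity along
      \<open>r'\<close>.\<close>
    then have "\<forall>m. \<exists>i. i \<ge> k + m \<and> \<not> ?d (p i) (coset l) < ereal \<epsilon>" by blast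
    from choice[OF this] obtain s where s: "\<forall>m. s m \<ge> k + m \<and> \<not> ?d (p (s m)) (coset l) < ereal \<epsilon>" by (elim exE)
    have sk: "s m \<ge> k" "s m \<ge> m" for m using s[rule_format, of m] by linarith+
    obtain l' r' where r': "strict_mono (r' :: nat \<Rightarrow> nat)" and lr': "(\<lambda>n. z (s (r' n))) \<longlonglongrightarrow> l'"
      and l': "l' \<in> SO_star" "bilin b (cstr l' *v a) = 0"
      using limit[of s, OF sk(1)] by blast
    have "herm u (cstr l') = herm u (cstr l)" if u: "u \<noteq> 0" for u :: "'n cvec2"
    proof -
      let ?f = "\<lambda>z. ln (herm u (cstr z))"
      have t: "(\<lambda>n. ?f (z (s (r' n))) - ?f (z (k + r n))) \<longlonglongrightarrow> ?f l' - ?f l"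
        by (intro tendsto_diff hc u l l' lr lr')
      have "\<bar>?f l' - ?f l\<bar> \<le> K * e" if e: "e > 0" for e
      proof -
        obtain m where m: "\<forall>i\<ge>m. \<forall>j\<ge>m. ?d (p i) (p j) < ereal e" using cauchy e by blast
        have "\<bar>?f (z (s (r' n))) - ?f (z (k + r n))\<bar> \<le> K * e" if n: "n \<ge> m" for n
        proof (rule lip[OF u])
          have "s (r' n) \<ge> m" using sk(2)[of "r' n"] seq_suble[OF r', of n] n by linarith
          moreover have "k + r n \<ge> m" using seq_suble[OF r, of n] n by linarith
          ultimately show "?d (p (k + r n)) (p (s (r' n))) < ereal e" using m by blast
        qed
        then have "eventually (\<lambda>n. \<bar>?f (z (s (r' n))) - ?f (z (k + r n))\<bar> \<le> K * e) sequentially"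
          unfolding eventually_sequentially by blast
        then show ?thesis using tendsto_upperbound[OF tendsto_rabs[OF t]] by simp
      qed
      then have "\<bar>?f l' - ?f l\<bar> \<le> 0"
      proof -
        assume *: "\<And>e. e > 0 \<Longrightarrow> \<bar>?f l' - ?f l\<bar> \<le> K * e"
        show ?thesis
        proof (rule field_le_epsilon)
          fix e :: real assume "e > 0"
          then have "\<bar>?f l' - ?f l\<bar> \<le> K * (e / K)" using K(1) by (intro *) simp
          then show "\<bar>?f l' - ?f l\<bar> \<le> 0 + e" using K(1) by simp
        qed
      qed
      then have "?f l' = ?f l" by simp
      then show ?thesis using herm_cstr_pos[OF l'(1) u] herm_cstr_pos[OF l(1) u] by simp
    qed
    then have "cstr l' = cstr l" by (rule herm_determines_cstr[OF l'(1) l(1)])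
    then have cl: "coset l' = coset l" using coset_eq_iff[OF l'(1) l(1)] by simp
    obtain \<delta> where \<delta>: "\<delta> > 0" "\<forall>w\<in>SO_star. norm (w - l') < \<delta> \<longrightarrow> bilin b (cstr w *v a) = 0 \<longrightarrow>
        ?d (coset w) (coset l') < ereal \<epsilon>"
      using intrinsic_dist_upper[OF ab l' \<epsilon>] by blast
    obtain n where "norm (z (s (r' n)) - l') < \<delta>"
      using LIMSEQ_D[OF lr' \<delta>(1)] by blast
    then have "?d (p (s (r' n))) (coset l) < ereal \<epsilon>" using \<delta>(2) zS z0 cl pz by metis
    then show False using s by blast
  qed
  show "\<exists>l\<in>?N. (\<lambda>i. ?d (p i) l) \<longlonglongrightarrow> 0"
  proof (rule bexI[of _ "coset l"])
    show "(\<lambda>i. ?d (p i) (coset l)) \<longlonglongrightarrow> 0"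
    proof (rule order_tendstoI)
      fix y :: ereal assume "y < 0"
      then show "eventually (\<lambda>i. y < ?d (p i) (coset l)) sequentially"
        using intrinsic_dist_nonneg[OF NS] by (intro always_eventually) (meson less_le_trans)
    next
      fix y :: ereal assume y: "0 < y"
      obtain e where e: "0 < ereal e" "ereal e < y" using ereal_dense2[OF y] by blast
      then have e0: "0 < e" by simp
      show "eventually (\<lambda>i. ?d (p i) (coset l) < y) sequentially"
        using ev[OF e0] by eventually_elim (rule less_trans[OF _ e(2)])
    qed
    show "coset l \<in> ?N" using phi_eq[OF l(1)] l unfolding SOU_def by auto
  qed
qed

theorem theorem2p3:
  fixes a b :: "complex ^ ('n::finite + 'n)"
  assumes "CARD('n) \<ge> 2"
    and "a \<noteq> b" and "vec.independent {a, b}"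
    and "bilin a a = 0" and "bilin a b = 0" and "bilin (Jn *v a) b = 0" and "bilin b b \<noteq> 0"
  shows "let N = phi a b -` {0} \<inter> SOU
         in submanifold_of_codim SOU_model SOU_atlas N 2 \<and>
            minimal_submanifold SOU_model SOU_atlas SOU_metric N \<and>
            complete_submanifold SOU_atlas SOU_metric N"
proof -
  have a0: "a \<noteq> 0" using assms(3) vec.dependent_zero by blast
  note ab = assms(4,5,7) a0
  show ?thesis
    unfolding Let_def SOU_model_eq
    using submanifold_zero_set[OF ab] minimal_zero_set[OF ab] complete_zero_set[OF ab] by blast
qed

end
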